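(* Let $G$ and $H$ be finite groups with $H$ acting freely on a finite set $X$ and let $\Phi\colon X\to\mathrm{Aut}(G)\cup\mathrm{Hom}(G,H)$ be the data defining a multispinal group. Let $A=\langle\Phi(X)\cap\mathrm{Aut}(G)\rangle$ and $B=(\Phi(X)\cap\mathrm{Hom}(G,H))\cdot A$. Let $\mathfrak G$ be the corresponding self-similar multispinal group over $X$ and $K$ a field. If $\lambda\colon G\to H$ is a homomorphism, let $\widetilde\lambda\colon KG\to KH$ denote the induced homomorphism of group algebras. Then: (1) The Nekrashevych algebra $\mathcal N_K(\mathfrak G,X)$ is simple if and only if $\bigcap_{\lambda\in B}\ker\widetilde\lambda=0$. (2) If the characteristic of $K$ does not divide $|G|$, then $\mathcal N_K(\mathfrak G,X)$ is simple if and only if, for each irreducible representation $\rho$ of $G$ over the algebraic closure of $K$, there exists $\lambda\in B$ with $\ker\lambda\le\ker\rho$. (3) If the characteristic of $K$ divides $|\ker\lambda|$ for all $\lambda\in\Phi(X)\cap\mathrm{Hom}(G,H)$, then $\mathcal N_K(\mathfrak G,X)$ is not simple.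
   Context: For a finite alphabet $X$ with $|X|\ge2$, $X^*$ is the free monoid on $X$. A self-similar group over $X$ is a group $\Gamma$ with a faithful action on $X^*$ by length-preserving permutations such that for all $g\in\Gamma$, $x\in X$ there is $g|_x\in\Gamma$ (the section) with $g(xw)=g(x)\,g|_x(w)$ for all $w\in X^*$. For a field $K$, the Nekrashevych algebra $\mathcal N_K(\Gamma,X)$ is the $*$-algebra over $K$ (with $K$-linear involution satisfying $(ab)^*=b^*a^*$) generated by $X\cup\Gamma$ with relations: $g^*=g^{-1}$ and $g\cdot h=gh$ for $g,h\in\Gamma$; $gx=g(x)g|_x$ for $g\in\Gamma$, $x\in X$; $y^*x=\delta_{x,y}$ for $x,y\in X$; $\sum_{x\in X}xx^*=1$. Simple means nonzero with no two-sided ideals other than $0$ and itself. Multispinal groups. $\mathrm{Aut}(G)$ acts on the right of $\mathrm{Hom}(G,H)$ by precomposition. The data of a multispinal group over a finite set $X$ are a finite group $G$, a finite group $H$ with a free left action on $X$ (all point stabilizers trivial), and a map $\Phi\colon X\to\mathrm{Aut}(G)\cup\mathrm{Hom}(G,H)$ (the two sets being regarded as disjoint) such that: (S1) $\Phi(X)\cap\mathrm{Aut}(G)\ne\emptyset$; (S2) $\Phi(X)\cap\mathrm{Hom}(G,H)\neq\emptyset$; (S3) with $A=\langle\Phi(X)\cap\mathrm{Aut}(G)\rangle\le\mathrm{Aut}(G)$ and $B=(\Phi(X)\cap\mathrm{Hom}(G,H))\cdot A=\{\lambda\circ\alpha:\lambda\in\Phi(X)\cap\mathrm{Hom}(G,H),\alpha\in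 A\}$, one has $\bigcap_{\lambda\in B}\ker\lambda=\{1\}$. Elements of $H$ and $G$ act on $X^*$ (fixing the empty word) by $h(xw)=h(x)w$ for $h\in H$, and, recursively, $g(xw)=x\,(\Phi(x)(g))(w)$ for $g\in G$, where $\Phi(x)(g)$ lies in $G$ or in $H$ according as $\Phi(x)\in\mathrm{Aut}(G)$ or $\Phi(x)\in\mathrm{Hom}(G,H)$. The multispinal group $\mathfrak G$ is the (self-similar) group of permutations of $X^*$ generated by these permutations for all $g\in G$ and $h\in H$. *)

theory Defs
  imports
    "HOL-Algebra.Group_Action"
    "HOL-Algebra.Generated_Groups"
    "HOL-Algebra.QuotRing"
    "HOL-Algebra.Algebraic_Closure_Type"
    "Jordan_Normal_Form.VS_Connect"
begin

section \<open>Monoid algebras\<close>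

text \<open>
  The monoid algebra \<open>KM\<close>: finitely supported functions on \<open>M\<close> under convolution. For a group it is
  the group algebra, for a free monoid it is the free unital algebra. The argument of type
  \<open>'k itself\<close> only carries the field of coefficients.
\<close>

definition supp :: "('a \<Rightarrow> 'k::zero) \<Rightarrow> 'a set" where
  "supp f = {a. f a \<noteq> 0}"

definition delta :: "'a \<Rightarrow> 'a \<Rightarrow> 'k::zero_neq_one" where
  "delta a = (\<lambda>b. if b = a then 1 else 0)"

definition monoid_algebra :: "'k::field itself \<Rightarrow> ('a, 'b) monoid_scheme \<Rightarrow> ('a \<Rightarrow> 'k) ring" where
  "monoid_algebra K M = \<lparr>
     carrier = {f. finite (supp f) \<and> supp f \<subseteq> carrier M},
     monoid.mult = (\<lambda>f g m. \<Sum>(a, b) \<in> {(a, b). a \<in> supp f \<and> b \<in> supp g \<and> a \<otimes>\<^bsub>M\<^esub> b = m}. f a * g b),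
     one = delta \<one>\<^bsub>M\<^esub>,
     ring.zero = (\<lambda>_. 0),
     add = (\<lambda>f g a. f a + g a)\<rparr>"

text \<open>The linear extension of a map \<open>\<lambda>\<close> to monoid algebras.\<close>

definition lin_ext :: "('a \<Rightarrow> 'b) \<Rightarrow> ('a \<Rightarrow> 'k::field) \<Rightarrow> 'b \<Rightarrow> 'k" where
  "lin_ext l f = (\<lambda>b. \<Sum>a \<in> {a \<in> supp f. l a = b}. f a)"


section \<open>Presentations of unital \<open>*\<close>-algebras\<close>

text \<open>
  The free unital \<open>*\<close>-algebra on \<open>S\<close> is the free unital algebra on two copies of \<open>S\<close>: the letter
  \<open>(s, False)\<close> stands for \<open>s\<close> and \<open>(s, True)\<close> for \<open>s\<^sup>*\<close>. The involution reverses words, exchanges the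
  two copies and is linear in the coefficients.
\<close>

definition star_words :: "'s set \<Rightarrow> ('s \<times> bool) list monoid" where
  "star_words S = \<lparr>carrier = lists (S \<times> UNIV), monoid.mult = (@), one = []\<rparr>"

definition word_star :: "('s \<times> bool) list \<Rightarrow> ('s \<times> bool) list" where
  "word_star w = rev (map (\<lambda>(s, b). (s, \<not> b)) w)"

abbreviation free_star_algebra ::
  "'k::field itself \<Rightarrow> 's set \<Rightarrow> (('s \<times> bool) list \<Rightarrow> 'k) ring" where
  "free_star_algebra K S \<equiv> monoid_algebra K (star_words S)"

definition free_star :: "(('s \<times> bool) list \<Rightarrow> 'k) \<Rightarrow> ('s \<times> bool) list \<Rightarrow> 'k" where
  "free_star f = (\<lambda>w. f (word_star w))"

text \<open>
  The ideal generated by a set of relators together with their adjoints is the \<open>*\<close>-ideal generated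
  by the relators, so the following quotient is the \<open>*\<close>-algebra presented by \<open>S\<close> and \<open>R\<close>; only its
  ring structure is recorded. Two-sided ideals of a unital algebra are closed under scalars, so
  ring ideals and algebra ideals coincide.
\<close>

definition star_algebra_pres ::
  "'k::field itself \<Rightarrow> 's set \<Rightarrow> (('s \<times> bool) list \<Rightarrow> 'k) set \<Rightarrow> (('s \<times> bool) list \<Rightarrow> 'k) set ring" where
  "star_algebra_pres K S R =
     free_star_algebra K S Quot (Idl\<^bsub>free_star_algebra K S\<^esub> (R \<union> free_star ` R))"

definition simple_ring :: "('a, 'b) ring_scheme \<Rightarrow> bool" where
  "simple_ring R \<longleftrightarrow>
     carrier R \<noteq> {\<zero>\<^bsub>R\<^esub>} \<and> (\<forall>I. ideal I R \<longrightarrow> I = {\<zero>\<^bsub>R\<^esub>} \<or> I = carrier R)"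


section \<open>Self-similar groups and their Nekrashevych algebras\<close>

text \<open>Words over \<open>\<X>\<close> are lists; for a letter \<open>x\<close>, the one-letter word \<open>g(x)\<close> is \<open>act g [x]\<close>.\<close>

locale self_similar_group = faithful_action \<Gamma> "lists \<X>" act
  for \<Gamma> (structure) and \<X> :: "'x set" and act :: "'a \<Rightarrow> 'x list \<Rightarrow> 'x list" +
  assumes finite_X: "finite \<X>"
    and card_X: "card \<X> \<ge> 2"
    and length_preserving: "\<lbrakk>g \<in> carrier \<Gamma>; w \<in> lists \<X>\<rbrakk> \<Longrightarrow> length (act g w) = length w"
    and section_exists: "\<lbrakk>g \<in> carrier \<Gamma>; x \<in> \<X>\<rbrakk> \<Longrightarrow>
      \<exists>k \<in> carrier \<Gamma>. \<forall>w \<in> lists \<X>. act g (x # w) = act g [x] @ act k w"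

text \<open>The section \<open>g|\<^sub>x\<close>; it is unique because the action is faithful.\<close>

definition word_section ::
  "('a, 'b) monoid_scheme \<Rightarrow> 'x set \<Rightarrow> ('a \<Rightarrow> 'x list \<Rightarrow> 'x list) \<Rightarrow> 'a \<Rightarrow> 'x \<Rightarrow> 'a" where
  "word_section \<Gamma> \<X> act g x =
     (THE k. k \<in> carrier \<Gamma> \<and> (\<forall>w \<in> lists \<X>. act g (x # w) = act g [x] @ act k w))"

text \<open>
  The generators are \<open>\<X> <+> carrier \<Gamma>\<close>. The relator \<open>1\<^sub>\<Gamma> - 1\<close> expresses the convention that the
  identity of \<open>\<Gamma>\<close> and the unit of the algebra are the same element, so that group elements become units;
  it does not follow from the others (which are satisfied in the Leavitt algebra with all group
  elements sent to \<open>0\<close>). Equivalently, the presentation is that of a not necessarily unital algebra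
  in which the symbol \<open>1\<close> in \<open>\<Sum>x x\<^sup>* = 1\<close> is the identity of \<open>\<Gamma>\<close>.
\<close>

definition nekrashevych_relators ::
  "'k::field itself \<Rightarrow> ('a, 'b) monoid_scheme \<Rightarrow> 'x set \<Rightarrow> ('a \<Rightarrow> 'x list \<Rightarrow> 'x list) \<Rightarrow>
    ((('x + 'a) \<times> bool) list \<Rightarrow> 'k) set" where
  "nekrashevych_relators K \<Gamma> \<X> act =
     (let F = free_star_algebra K (\<X> <+> carrier \<Gamma>);
          lt = (\<lambda>x. delta [(Inl x, False)]); lt_star = (\<lambda>x. delta [(Inl x, True)]);
          gr = (\<lambda>g. delta [(Inr g, False)]); gr_star = (\<lambda>g. delta [(Inr g, True)])
      in {gr \<one>\<^bsub>\<Gamma>\<^esub> \<ominus>\<^bsub>F\<^esub> \<one>\<^bsub>F\<^esub>}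
       \<union> {gr_star g \<ominus>\<^bsub>F\<^esub> gr (inv\<^bsub>\<Gamma>\<^esub> g) | g. g \<in> carrier \<Gamma>}
       \<union> {gr g \<otimes>\<^bsub>F\<^esub> gr h \<ominus>\<^bsub>F\<^esub> gr (g \<otimes>\<^bsub>\<Gamma>\<^esub> h) | g h. g \<in> carrier \<Gamma> \<and> h \<in> carrier \<Gamma>}
       \<union> {gr g \<otimes>\<^bsub>F\<^esub> lt x \<ominus>\<^bsub>F\<^esub> lt (hd (act g [x])) \<otimes>\<^bsub>F\<^esub> gr (word_section \<Gamma> \<X> act g x)
            | g x. g \<in> carrier \<Gamma> \<and> x \<in> \<X>}
       \<union> {lt_star y \<otimes>\<^bsub>F\<^esub> lt x \<ominus>\<^bsub>F\<^esub> (if x = y then \<one>\<^bsub>F\<^esub> else \<zero>\<^bsub>F\<^esub>) | x y. x \<in> \<X> \<and> y \<in> \<X>}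
       \<union> {(\<Oplus>\<^bsub>F\<^esub>x\<in>\<X>. lt x \<otimes>\<^bsub>F\<^esub> lt_star x) \<ominus>\<^bsub>F\<^esub> \<one>\<^bsub>F\<^esub>})"

definition nekrashevych_algebra ::
  "'k::field itself \<Rightarrow> ('a, 'b) monoid_scheme \<Rightarrow> 'x set \<Rightarrow> ('a \<Rightarrow> 'x list \<Rightarrow> 'x list) \<Rightarrow>
    ((('x + 'a) \<times> bool) list \<Rightarrow> 'k) set ring" where
  "nekrashevych_algebra K \<Gamma> \<X> act =
     star_algebra_pres K (\<X> <+> carrier \<Gamma>) (nekrashevych_relators K \<Gamma> \<X> act)"


section \<open>Multispinal groups\<close>

text \<open>
  The disjoint union of \<open>Aut(G)\<close> and \<open>Hom(G,H)\<close> is the tagged sum \<open>auto G <+> hom G H\<close>. No condition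
  on \<open>card \<X>\<close> is needed: the two nonemptiness conditions force \<open>card \<X> \<ge> 2\<close>.
\<close>

definition spinal_aut :: "'x set \<Rightarrow> ('x \<Rightarrow> ('g \<Rightarrow> 'g) + ('g \<Rightarrow> 'h)) \<Rightarrow> ('g \<Rightarrow> 'g) set" where
  "spinal_aut \<X> \<Phi> = {\<alpha>. Inl \<alpha> \<in> \<Phi> ` \<X>}"

definition spinal_hom :: "'x set \<Rightarrow> ('x \<Rightarrow> ('g \<Rightarrow> 'g) + ('g \<Rightarrow> 'h)) \<Rightarrow> ('g \<Rightarrow> 'h) set" where
  "spinal_hom \<X> \<Phi> = {l. Inr l \<in> \<Phi> ` \<X>}"

definition spinal_A ::
  "('g, 'c) monoid_scheme \<Rightarrow> 'x set \<Rightarrow> ('x \<Rightarrow> ('g \<Rightarrow> 'g) + ('g \<Rightarrow> 'h)) \<Rightarrow> ('g \<Rightarrow> 'g) set" where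
  "spinal_A G \<X> \<Phi> = generate (AutoGroup G) (spinal_aut \<X> \<Phi>)"

definition spinal_B ::
  "('g, 'c) monoid_scheme \<Rightarrow> 'x set \<Rightarrow> ('x \<Rightarrow> ('g \<Rightarrow> 'g) + ('g \<Rightarrow> 'h)) \<Rightarrow> ('g \<Rightarrow> 'h) set" where
  "spinal_B G \<X> \<Phi> = {compose (carrier G) l \<alpha> | l \<alpha>. l \<in> spinal_hom \<X> \<Phi> \<and> \<alpha> \<in> spinal_A G \<X> \<Phi>}"

locale multispinal_data = G: group G + H: group_action H \<X> act
  for G :: "('g, 'c) monoid_scheme" and H :: "('h, 'd) monoid_scheme"
    and \<X> :: "'x set" and act :: "'h \<Rightarrow> 'x \<Rightarrow> 'x" +
  fixes \<Phi> :: "'x \<Rightarrow> ('g \<Rightarrow> 'g) + ('g \<Rightarrow> 'h)"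
  assumes finite_G: "finite (carrier G)"
    and finite_H: "finite (carrier H)"
    and finite_X: "finite \<X>"
    and free: "x \<in> \<X> \<Longrightarrow> stabilizer H act x = {\<one>\<^bsub>H\<^esub>}"
    and \<Phi>_type: "\<Phi> \<in> \<X> \<rightarrow> auto G <+> hom G H"
    and S1: "spinal_aut \<X> \<Phi> \<noteq> {}"
    and S2: "spinal_hom \<X> \<Phi> \<noteq> {}"
    and S3: "(\<Inter>l \<in> spinal_B G \<X> \<Phi>. kernel G H l) = {\<one>\<^bsub>G\<^esub>}"

fun H_word_act :: "('h \<Rightarrow> 'x \<Rightarrow> 'x) \<Rightarrow> 'h \<Rightarrow> 'x list \<Rightarrow> 'x list" where
  "H_word_act act h [] = []"
| "H_word_act act h (x # w) = act h x # w"

fun G_word_act ::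
  "('h \<Rightarrow> 'x \<Rightarrow> 'x) \<Rightarrow> ('x \<Rightarrow> ('g \<Rightarrow> 'g) + ('g \<Rightarrow> 'h)) \<Rightarrow> 'g \<Rightarrow> 'x list \<Rightarrow> 'x list" where
  "G_word_act act \<Phi> g [] = []"
| "G_word_act act \<Phi> g (x # w) =
     x # (case \<Phi> x of Inl \<alpha> \<Rightarrow> G_word_act act \<Phi> (\<alpha> g) w | Inr l \<Rightarrow> H_word_act act (l g) w)"

definition multispinal_gens ::
  "('g, 'c) monoid_scheme \<Rightarrow> ('h, 'd) monoid_scheme \<Rightarrow> 'x set \<Rightarrow> ('h \<Rightarrow> 'x \<Rightarrow> 'x) \<Rightarrow>
    ('x \<Rightarrow> ('g \<Rightarrow> 'g) + ('g \<Rightarrow> 'h)) \<Rightarrow> ('x list \<Rightarrow> 'x list) set" where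
  "multispinal_gens G H \<X> act \<Phi> =
     (\<lambda>g. restrict (G_word_act act \<Phi> g) (lists \<X>)) ` carrier G \<union>
     (\<lambda>h. restrict (H_word_act act h) (lists \<X>)) ` carrier H"

definition multispinal_group ::
  "('g, 'c) monoid_scheme \<Rightarrow> ('h, 'd) monoid_scheme \<Rightarrow> 'x set \<Rightarrow> ('h \<Rightarrow> 'x \<Rightarrow> 'x) \<Rightarrow>
    ('x \<Rightarrow> ('g \<Rightarrow> 'g) + ('g \<Rightarrow> 'h)) \<Rightarrow> ('x list \<Rightarrow> 'x list) monoid" where
  "multispinal_group G H \<X> act \<Phi> =
     BijGroup (lists \<X>)
       \<lparr>carrier := generate (BijGroup (lists \<X>)) (multispinal_gens G H \<X> act \<Phi>)\<rparr>"


section \<open>Irreducible representations\<close>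

text \<open>
  Irreducible representations of a finite group are finite-dimensional, hence up to isomorphism
  matrix representations.
\<close>

definition GL :: "'l::field itself \<Rightarrow> nat \<Rightarrow> 'l mat monoid" where
  "GL L n = units_of (ring_mat L n ())"

definition irreducible_rep ::
  "('g, 'c) monoid_scheme \<Rightarrow> nat \<Rightarrow> ('g \<Rightarrow> 'l::field mat) \<Rightarrow> bool" where
  "irreducible_rep G n \<rho> \<longleftrightarrow>
     n > 0 \<and> \<rho> \<in> hom G (GL TYPE('l) n) \<and>
     (\<forall>W. VectorSpace.subspace class_ring W (module_vec TYPE('l) n) \<and>
          (\<forall>g \<in> carrier G. \<forall>v \<in> W. \<rho> g *\<^sub>v v \<in> W) \<longrightarrow>
          W = {0\<^sub>v n} \<or> W = carrier_vec n)"

end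

theory Submission
  imports Defs "HOL-Library.Function_Algebras"
begin

text \<open>
  Modulo the relations, a group element \<open>g\<close> followed by a word \<open>q\<close> equals \<open>q' k\<close> as soon as
  \<open>g(q w) = q' k(w)\<close> for all \<open>w\<close> (\<open>gr_lt_word\<close>), so that calculating in the Nekrashevych algebra means
  looking at the action on words. Every \<open>\<lambda> \<in> B\<close> occurs in this action: there is a word \<open>q\<close> with
  \<open>g q = q \<lambda>(g)\<close> for all \<open>g \<in> G\<close> (\<open>spinal_B_path\<close>). Let \<open>D\<close> be the intersection of the kernels of the maps
  \<open>KG \<rightarrow> KH\<close> induced by the \<open>\<lambda> \<in> B\<close>.

  Suppose that \<open>D = 0\<close>, and let \<open>a\<close> be nonzero in the algebra. As \<open>1\<close> is the sum of the \<open>v v\<^sup>*\<close> over the words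
  \<open>v\<close> of any given length, \<open>a v\<close> is nonzero for some long \<open>v\<close> (\<open>in_J_if_translates\<close>). Long words cancel all
  starred letters and contract group elements to the nucleus, the union of \<open>G\<close> and \<open>H\<close>
  (\<open>eventually_reduces\<close>); so \<open>a v\<close> is a combination of products \<open>u s\<close> with \<open>s\<close> in the nucleus, and one more
  letter moves all the \<open>s\<close> into \<open>G\<close>, or all of them into \<open>H\<close> (\<open>descend_one_letter\<close>). In the first case the
  coefficients belonging to one \<open>u\<close> form a nonzero element of \<open>KG\<close>; some \<open>\<lambda> \<in> B\<close> does not annihilate it, and
  the word \<open>q\<close> of \<open>\<lambda>\<close> leads to the second case. There \<open>H\<close> acts freely on letters, so a last letter gives a
  nonzero combination of words, and the ideal generated by such a combination contains \<open>1\<close> for the same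
  reason for which Leavitt algebras are simple (\<open>lt_combination_in_J\<close>).

  Conversely, choose a letter \<open>x0\<close> with \<open>\<Phi>(x0)\<close> an automorphism. The algebra acts on the functions on germs
  at the infinite word \<open>x0 x0 \<dots>\<close>, and the functions that only depend on the value of the germ at this point are
  a submodule. On all functions \<open>KG\<close> acts faithfully (\<open>group_element_nonzero\<close>). On the submodule the action
  of \<open>G\<close> factors at each point through some \<open>\<lambda> \<in> B\<close> (\<open>point_action_factors\<close>), so \<open>D\<close> acts as \<open>0\<close>. Hence the
  annihilator of the submodule is a proper ideal, and it is nonzero unless \<open>D = 0\<close>.

  The rest is about \<open>D\<close> alone. If an irreducible representation \<open>\<rho>\<close> is nontrivial on \<open>ker \<lambda>\<close> for all
  \<open>\<lambda> \<in> B\<close>, then \<open>\<rho>\<close> sums to \<open>0\<close> over each of these normal subgroups, and \<open>g \<mapsto> \<rho>(g\<^sup>-\<^sup>1)\<^sub>0\<^sub>0\<close> is a nonzero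
  element of \<open>D\<close> over the algebraic closure, which a functional carries to \<open>K\<close> (\<open>coefficient_killed\<close>). If
  on the other hand \<open>ker \<lambda> \<le> ker \<rho>\<close> for some \<open>\<lambda> \<in> B\<close>, then \<open>\<rho>\<close> annihilates \<open>D\<close>; and if the
  characteristic does not divide \<open>|G|\<close>, no nonzero element is annihilated by all \<open>\<rho>\<close>, by Maschke's theorem
  (\<open>irreducible_rep_detecting\<close>). Finally, the sum of all elements of
  \<open>G\<close> has multiples of \<open>|ker \<lambda>|\<close> as coefficients of its image under \<open>\<lambda>\<close> (\<open>sum_of_group_killed\<close>).
\<close>

section \<open>Monoid algebras\<close>

lemma supp_delta: "supp (delta a :: 'a \<Rightarrow> 'k::field) = {a}"
  by (auto simp: supp_def delta_def)

lemma delta_self [simp]: "delta a a = (1 :: 'k::zero_neq_one)"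
  by (simp add: delta_def)

lemma supp_zero [simp]: "supp (\<lambda>_. 0 :: 'k::zero) = {}"
  by (simp add: supp_def)

lemma supp_add: "supp (\<lambda>a. f a + g a :: 'k::field) \<subseteq> supp f \<union> supp g"
  by (auto simp: supp_def)

lemma supp_scale: "supp (\<lambda>a. c * f a :: 'k::field) \<subseteq> supp f"
  by (auto simp: supp_def)

lemma not_in_supp: "a \<notin> supp f \<longleftrightarrow> f a = 0"
  by (simp add: supp_def)

subsection \<open>Linear extension of maps\<close>

lemma lin_ext_eq_sum:
  fixes f :: "'a \<Rightarrow> 'k::field"
  assumes "finite A" "supp f \<subseteq> A"
  shows "lin_ext l f b = (\<Sum>a\<in>A. f a * delta (l a) b)"
proof -
  have "(\<Sum>a\<in>A. f a * delta (l a) b) = (\<Sum>a \<in> {a \<in> supp f. l a = b}. f a * delta (l a) b)"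
    using assms by (intro sum.mono_neutral_right) (auto simp: delta_def supp_def)
  also have "\<dots> = (\<Sum>a \<in> {a \<in> supp f. l a = b}. f a)"
    by (intro sum.cong) (auto simp: delta_def)
  finally show ?thesis by (simp add: lin_ext_def)
qed

lemma supp_lin_ext: "supp (lin_ext l f) \<subseteq> l ` supp (f :: 'a \<Rightarrow> 'k::field)"
proof
  fix b assume "b \<in> supp (lin_ext l f)"
  then have "lin_ext l f b \<noteq> 0" by (simp add: supp_def)
  then have "(\<Sum>a \<in> {a \<in> supp f. l a = b}. f a) \<noteq> 0" by (simp add: lin_ext_def)
  then have "{a \<in> supp f. l a = b} \<noteq> {}" by (metis sum.empty)
  then show "b \<in> l ` supp f" by auto
qed

lemma finite_supp_lin_ext:
  "finite (supp f) \<Longrightarrow> finite (supp (lin_ext l (f :: 'a \<Rightarrow> 'k::field)))"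
  using supp_lin_ext finite_surj by metis

lemma sum_lin_ext:
  fixes f :: "'a \<Rightarrow> 'k::field"
  assumes "finite (supp f)"
  shows "(\<Sum>b \<in> supp (lin_ext l f). lin_ext l f b * h b) = (\<Sum>a \<in> supp f. f a * h (l a))"
proof -
  have "(\<Sum>b \<in> supp (lin_ext l f). lin_ext l f b * h b) = (\<Sum>b \<in> l ` supp f. lin_ext l f b * h b)"
    using assms supp_lin_ext[of l f] by (intro sum.mono_neutral_left) (auto simp: not_in_supp)
  also have "\<dots> = (\<Sum>b \<in> l ` supp f. \<Sum>a\<in>{a \<in> supp f. l a = b}. f a * h (l a))"
    by (auto simp: lin_ext_def sum_distrib_right intro!: sum.cong)
  also have "\<dots> = (\<Sum>a \<in> supp f. f a * h (l a))"
    using assms by (rule sum.image_gen[symmetric])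
  finally show ?thesis .
qed

lemma lin_ext_comp:
  fixes f :: "'a \<Rightarrow> 'k::field"
  assumes "finite (supp f)"
  shows "lin_ext m (lin_ext l f) = lin_ext (\<lambda>a. m (l a)) f"
proof
  fix c
  show "lin_ext m (lin_ext l f) c = lin_ext (\<lambda>a. m (l a)) f c"
    using sum_lin_ext[OF assms, of l "\<lambda>b. delta (m b) c"]
    unfolding lin_ext_eq_sum[OF assms order.refl, symmetric]
      lin_ext_eq_sum[OF finite_supp_lin_ext[OF assms] order.refl, symmetric] .
qed

lemma lin_ext_cong:
  "(\<And>a. a \<in> supp f \<Longrightarrow> l a = m a) \<Longrightarrow> lin_ext l f = lin_ext m f"
  unfolding lin_ext_def by (intro ext sum.cong) auto

lemma lin_ext_ident: "lin_ext (\<lambda>a. a) (f :: 'a \<Rightarrow> 'k::field) = f"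
proof
  fix b
  have "{a \<in> supp f. a = b} = (if f b = 0 then {} else {b})" by (auto simp: supp_def)
  then show "lin_ext (\<lambda>a. a) f b = f b" by (simp add: lin_ext_def)
qed

lemma lin_ext_delta: "lin_ext l (delta a) = (delta (l a) :: _ \<Rightarrow> 'k::field)"
  by (rule ext) (subst lin_ext_eq_sum[of "{a}"], auto simp: supp_delta)

lemma lin_ext_inj:
  fixes f :: "'a \<Rightarrow> 'k::field"
  assumes "inj_on l (supp f)" "a \<in> supp f"
  shows "lin_ext l f (l a) = f a"
proof -
  have "{a' \<in> supp f. l a' = l a} = {a}" using assms by (auto dest: inj_onD)
  then show ?thesis by (simp add: lin_ext_def)
qed

lemma lin_ext_add:
  fixes f g :: "'a \<Rightarrow> 'k::field"
  assumes "finite (supp f)" "finite (supp g)"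
  shows "lin_ext l (\<lambda>a. f a + g a) b = lin_ext l f b + lin_ext l g b"
proof -
  obtain A where A: "finite A" "supp f \<subseteq> A" "supp g \<subseteq> A" "supp (\<lambda>a. f a + g a) \<subseteq> A"
    using assms supp_add[of f g] by (metis Un_upper1 Un_upper2 finite_UnI)
  show ?thesis
    unfolding lin_ext_eq_sum[OF A(1,2)] lin_ext_eq_sum[OF A(1,3)] lin_ext_eq_sum[OF A(1,4)]
    by (simp add: distrib_right sum.distrib)
qed

lemma lin_ext_scale:
  fixes f :: "'a \<Rightarrow> 'k::field"
  assumes "finite (supp f)"
  shows "lin_ext l (\<lambda>a. c * f a) b = c * lin_ext l f b"
  using assms supp_scale[of c f]
  by (simp add: lin_ext_eq_sum[of "supp f"] sum_distrib_left mult.assoc)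

subsection \<open>The ring structure\<close>

lemma monoid_algebra_simps:
  "carrier (monoid_algebra K M) = {f. finite (supp f) \<and> supp f \<subseteq> carrier M}"
  "\<one>\<^bsub>monoid_algebra K M\<^esub> = delta \<one>\<^bsub>M\<^esub>"
  "\<zero>\<^bsub>monoid_algebra K M\<^esub> = (\<lambda>_. 0)"
  "f \<oplus>\<^bsub>monoid_algebra K M\<^esub> g = (\<lambda>a. f a + g a)"
  by (simp_all add: monoid_algebra_def)

lemma monoid_algebra_mult:
  assumes "finite A" "supp f \<subseteq> A" "finite B" "supp g \<subseteq> B"
  shows "(f \<otimes>\<^bsub>monoid_algebra K M\<^esub> g) m
    = (\<Sum>a\<in>A. \<Sum>b\<in>B. f a * g b * delta (a \<otimes>\<^bsub>M\<^esub> b) m)"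
proof -
  have "(\<Sum>a\<in>A. \<Sum>b\<in>B. f a * g b * delta (a \<otimes>\<^bsub>M\<^esub> b) m)
      = (\<Sum>(a, b)\<in>A \<times> B. f a * g b * delta (a \<otimes>\<^bsub>M\<^esub> b) m)"
    by (rule sum.cartesian_product)
  also have "\<dots> = (\<Sum>(a, b) \<in> {(a, b). a \<in> supp f \<and> b \<in> supp g \<and> a \<otimes>\<^bsub>M\<^esub> b = m}.
      f a * g b * delta (a \<otimes>\<^bsub>M\<^esub> b) m)"
    using assms by (intro sum.mono_neutral_right) (auto simp: supp_def delta_def split: if_splits)
  also have "\<dots> = (\<Sum>(a, b) \<in> {(a, b). a \<in> supp f \<and> b \<in> supp g \<and> a \<otimes>\<^bsub>M\<^esub> b = m}. f a * g b)"
    by (intro sum.cong) (auto simp: delta_def)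
  finally show ?thesis by (simp add: monoid_algebra_def)
qed

lemma supp_monoid_algebra_mult:
  "supp (f \<otimes>\<^bsub>monoid_algebra K M\<^esub> g) \<subseteq> (\<lambda>(a, b). a \<otimes>\<^bsub>M\<^esub> b) ` (supp f \<times> supp g)"
proof
  fix m assume "m \<in> supp (f \<otimes>\<^bsub>monoid_algebra K M\<^esub> g)"
  then have "(f \<otimes>\<^bsub>monoid_algebra K M\<^esub> g) m \<noteq> 0" by (simp add: supp_def)
  then have "(\<Sum>(a, b) \<in> {(a, b). a \<in> supp f \<and> b \<in> supp g \<and> a \<otimes>\<^bsub>M\<^esub> b = m}. f a * g b) \<noteq> 0"
    by (simp add: monoid_algebra_def)
  then have "{(a, b). a \<in> supp f \<and> b \<in> supp g \<and> a \<otimes>\<^bsub>M\<^esub> b = m} \<noteq> {}" by (metis sum.empty)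
  then show "m \<in> (\<lambda>(a, b). a \<otimes>\<^bsub>M\<^esub> b) ` (supp f \<times> supp g)" by auto
qed

lemma delta_mult:
  assumes "finite (supp f)"
  shows "delta a \<otimes>\<^bsub>monoid_algebra K M\<^esub> f = lin_ext (\<lambda>b. a \<otimes>\<^bsub>M\<^esub> b) f"
  by (rule ext) (simp add: monoid_algebra_mult[of "{a}" _ "supp f"] assms supp_delta
      lin_ext_eq_sum[OF assms order.refl])

lemma mult_delta:
  assumes "finite (supp f)"
  shows "f \<otimes>\<^bsub>monoid_algebra K M\<^esub> delta b = lin_ext (\<lambda>a. a \<otimes>\<^bsub>M\<^esub> b) f"
  by (rule ext) (simp add: monoid_algebra_mult[of "supp f" _ "{b}"] assms supp_delta
      lin_ext_eq_sum[OF assms order.refl])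

lemma (in monoid) monoid_algebra_ring: "ring (monoid_algebra K G)"
proof (rule ringI)
  let ?R = "monoid_algebra K G"
  have fin: "finite (supp f)" if "f \<in> carrier ?R" for f
    using that by (simp add: monoid_algebra_simps)
  show "abelian_group ?R"
  proof (rule abelian_groupI)
    fix x y assume "x \<in> carrier ?R" "y \<in> carrier ?R"
    then show "x \<oplus>\<^bsub>?R\<^esub> y \<in> carrier ?R"
      using supp_add[of x y] finite_subset[OF supp_add[of x y]]
      by (fastforce simp: monoid_algebra_simps)
  next
    fix x assume "x \<in> carrier ?R"
    then have "(\<lambda>a. - x a) \<in> carrier ?R" "(\<lambda>a. - x a) \<oplus>\<^bsub>?R\<^esub> x = \<zero>\<^bsub>?R\<^esub>"
      by (auto simp: monoid_algebra_simps supp_def)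
    then show "\<exists>y\<in>carrier ?R. y \<oplus>\<^bsub>?R\<^esub> x = \<zero>\<^bsub>?R\<^esub>" by blast
  qed (auto simp: monoid_algebra_simps algebra_simps)
  have closed: "x \<otimes>\<^bsub>?R\<^esub> y \<in> carrier ?R" if "x \<in> carrier ?R" "y \<in> carrier ?R" for x y
  proof -
    have "finite ((\<lambda>(a, b). a \<otimes> b) ` (supp x \<times> supp y))"
      "(\<lambda>(a, b). a \<otimes> b) ` (supp x \<times> supp y) \<subseteq> carrier G"
      using that by (auto simp: monoid_algebra_simps)
    with supp_monoid_algebra_mult[of K G x y]
    have "finite (supp (x \<otimes>\<^bsub>?R\<^esub> y))" "supp (x \<otimes>\<^bsub>?R\<^esub> y) \<subseteq> carrier G"
      by (metis finite_subset, metis subset_trans)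
    then show ?thesis by (simp add: monoid_algebra_simps)
  qed
  \<comment> \<open>Both bracketings are the sum of the same function over triples.\<close>
  have assoc: "(x \<otimes>\<^bsub>?R\<^esub> y) \<otimes>\<^bsub>?R\<^esub> z = x \<otimes>\<^bsub>?R\<^esub> (y \<otimes>\<^bsub>?R\<^esub> z)"
    if xyz: "x \<in> carrier ?R" "y \<in> carrier ?R" "z \<in> carrier ?R" for x y z
  proof
    fix m
    let ?A = "supp x" and ?B = "supp y" and ?C = "supp z"
    let ?AB = "(\<lambda>(a, b). a \<otimes> b) ` (?A \<times> ?B)" and ?BC = "(\<lambda>(a, b). a \<otimes> b) ` (?B \<times> ?C)"
    note f = fin[OF xyz(1)] fin[OF xyz(2)] fin[OF xyz(3)]
    have sub: "?A \<subseteq> carrier G" "?B \<subseteq> carrier G" "?C \<subseteq> carrier G"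
      using xyz by (auto simp: monoid_algebra_simps)
    have "((x \<otimes>\<^bsub>?R\<^esub> y) \<otimes>\<^bsub>?R\<^esub> z) m
        = (\<Sum>d\<in>?AB. \<Sum>c\<in>?C. (x \<otimes>\<^bsub>?R\<^esub> y) d * z c * delta (d \<otimes> c) m)"
      using f by (intro monoid_algebra_mult supp_monoid_algebra_mult) auto
    also have "\<dots> = (\<Sum>d\<in>?AB. \<Sum>c\<in>?C. \<Sum>a\<in>?A. \<Sum>b\<in>?B.
        x a * y b * delta (a \<otimes> b) d * z c * delta (d \<otimes> c) m)"
      using f by (simp add: monoid_algebra_mult[of ?A _ ?B] sum_distrib_right)
    also have "\<dots> = (\<Sum>c\<in>?C. \<Sum>d\<in>?AB. \<Sum>a\<in>?A. \<Sum>b\<in>?B.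
        x a * y b * delta (a \<otimes> b) d * z c * delta (d \<otimes> c) m)"
      by (rule sum.swap)
    also have "\<dots> = (\<Sum>c\<in>?C. \<Sum>a\<in>?A. \<Sum>d\<in>?AB. \<Sum>b\<in>?B.
        x a * y b * delta (a \<otimes> b) d * z c * delta (d \<otimes> c) m)"
      by (rule sum.cong[OF refl sum.swap])
    also have "\<dots> = (\<Sum>c\<in>?C. \<Sum>a\<in>?A. \<Sum>b\<in>?B. \<Sum>d\<in>?AB.
        x a * y b * delta (a \<otimes> b) d * z c * delta (d \<otimes> c) m)"
      by (rule sum.cong[OF refl sum.cong[OF refl sum.swap]])
    also have "\<dots> = (\<Sum>c\<in>?C. \<Sum>a\<in>?A. \<Sum>b\<in>?B. x a * y b * z c * delta (a \<otimes> b \<otimes> c) m)"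
    proof (intro sum.cong refl)
      fix c a b assume "c \<in> ?C" "a \<in> ?A" "b \<in> ?B"
      then have "a \<otimes> b \<in> ?AB" by auto
      have "(\<Sum>d\<in>?AB. x a * y b * delta (a \<otimes> b) d * z c * delta (d \<otimes> c) m)
          = (\<Sum>d\<in>?AB. if d = a \<otimes> b then x a * y b * z c * delta (a \<otimes> b \<otimes> c) m else 0)"
        by (intro sum.cong) (auto simp: delta_def)
      also have "\<dots> = x a * y b * z c * delta (a \<otimes> b \<otimes> c) m"
        using \<open>a \<otimes> b \<in> ?AB\<close> f by (simp only: sum.delta finite_cartesian_product finite_imageI if_True)
      finally show "(\<Sum>d\<in>?AB. x a * y b * delta (a \<otimes> b) d * z c * delta (d \<otimes> c) m)
          = x a * y b * z c * delta (a \<otimes> b \<otimes> c) m" .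
    qed
    also have "\<dots> = (\<Sum>a\<in>?A. \<Sum>b\<in>?B. \<Sum>c\<in>?C. x a * y b * z c * delta (a \<otimes> b \<otimes> c) m)"
      by (rule trans[OF sum.swap sum.cong[OF refl sum.swap]])
    also have "\<dots> = (\<Sum>a\<in>?A. \<Sum>b\<in>?B. \<Sum>c\<in>?C. \<Sum>d\<in>?BC.
        x a * (y b * z c * delta (b \<otimes> c) d) * delta (a \<otimes> d) m)"
    proof (intro sum.cong refl)
      fix a b c assume abc: "a \<in> ?A" "b \<in> ?B" "c \<in> ?C"
      then have bc: "b \<otimes> c \<in> ?BC" by auto
      have as: "a \<otimes> b \<otimes> c = a \<otimes> (b \<otimes> c)" using abc sub by (intro m_assoc) auto
      have "(\<Sum>d\<in>?BC. x a * (y b * z c * delta (b \<otimes> c) d) * delta (a \<otimes> d) m)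
          = (\<Sum>d\<in>?BC. if d = b \<otimes> c then x a * y b * z c * delta (a \<otimes> b \<otimes> c) m else 0)"
        unfolding as by (intro sum.cong) (auto simp: delta_def)
      also have "\<dots> = x a * y b * z c * delta (a \<otimes> b \<otimes> c) m"
        using bc f by (simp only: sum.delta finite_cartesian_product finite_imageI if_True)
      finally show "x a * y b * z c * delta (a \<otimes> b \<otimes> c) m
          = (\<Sum>d\<in>?BC. x a * (y b * z c * delta (b \<otimes> c) d) * delta (a \<otimes> d) m)"
        by (rule sym)
    qed
    also have "\<dots> = (\<Sum>a\<in>?A. \<Sum>d\<in>?BC. \<Sum>b\<in>?B. \<Sum>c\<in>?C.
        x a * (y b * z c * delta (b \<otimes> c) d) * delta (a \<otimes> d) m)"
    proof (rule sum.cong[OF refl])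
      fix a assume "a \<in> ?A"
      let ?t = "\<lambda>b c d. x a * (y b * z c * delta (b \<otimes> c) d) * delta (a \<otimes> d) m"
      have "(\<Sum>b\<in>?B. \<Sum>c\<in>?C. \<Sum>d\<in>?BC. ?t b c d) = (\<Sum>b\<in>?B. \<Sum>d\<in>?BC. \<Sum>c\<in>?C. ?t b c d)"
        by (rule sum.cong[OF refl sum.swap])
      also have "\<dots> = (\<Sum>d\<in>?BC. \<Sum>b\<in>?B. \<Sum>c\<in>?C. ?t b c d)" by (rule sum.swap)
      finally show "(\<Sum>b\<in>?B. \<Sum>c\<in>?C. \<Sum>d\<in>?BC. ?t b c d) = (\<Sum>d\<in>?BC. \<Sum>b\<in>?B. \<Sum>c\<in>?C. ?t b c d)" .
    qed
    also have "\<dots> = (\<Sum>a\<in>?A. \<Sum>d\<in>?BC. x a * (y \<otimes>\<^bsub>?R\<^esub> z) d * delta (a \<otimes> d) m)"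
      using f by (simp add: monoid_algebra_mult[of ?B _ ?C] sum_distrib_right sum_distrib_left)
    also have "\<dots> = (x \<otimes>\<^bsub>?R\<^esub> (y \<otimes>\<^bsub>?R\<^esub> z)) m"
      using f by (intro monoid_algebra_mult[symmetric] supp_monoid_algebra_mult) auto
    finally show "((x \<otimes>\<^bsub>?R\<^esub> y) \<otimes>\<^bsub>?R\<^esub> z) m = (x \<otimes>\<^bsub>?R\<^esub> (y \<otimes>\<^bsub>?R\<^esub> z)) m" .
  qed
  have one: "lin_ext l f = f" if "f \<in> carrier ?R" "\<And>a. a \<in> carrier G \<Longrightarrow> l a = a" for l f
  proof -
    have "lin_ext l f = lin_ext (\<lambda>a. a) f"
      using that by (intro lin_ext_cong) (auto simp: monoid_algebra_simps)
    then show ?thesis by (simp add: lin_ext_ident)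
  qed
  show "Group.monoid ?R"
  proof (rule monoidI)
    show "\<one>\<^bsub>?R\<^esub> \<in> carrier ?R" by (simp add: monoid_algebra_simps supp_delta)
    show "\<one>\<^bsub>?R\<^esub> \<otimes>\<^bsub>?R\<^esub> x = x" if "x \<in> carrier ?R" for x
      using one[OF that, of "\<lambda>b. \<one> \<otimes> b"] fin[OF that] by (simp add: monoid_algebra_simps(2) delta_mult)
    show "x \<otimes>\<^bsub>?R\<^esub> \<one>\<^bsub>?R\<^esub> = x" if "x \<in> carrier ?R" for x
      using one[OF that, of "\<lambda>b. b \<otimes> \<one>"] fin[OF that] by (simp add: monoid_algebra_simps(2) mult_delta)
  qed (use closed assoc in auto)
  fix x y z assume xyz: "x \<in> carrier ?R" "y \<in> carrier ?R" "z \<in> carrier ?R"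
  obtain S where S: "finite S" "supp x \<subseteq> S" "supp y \<subseteq> S" "supp (\<lambda>a. x a + y a) \<subseteq> S"
    "finite (supp z)"
    using xyz fin supp_add[of x y] by (metis Un_upper1 Un_upper2 finite_UnI)
  show "(x \<oplus>\<^bsub>?R\<^esub> y) \<otimes>\<^bsub>?R\<^esub> z = x \<otimes>\<^bsub>?R\<^esub> z \<oplus>\<^bsub>?R\<^esub> y \<otimes>\<^bsub>?R\<^esub> z"
    by (rule ext) (simp add: monoid_algebra_simps(4) S
        monoid_algebra_mult[of S _ "supp z"] distrib_right sum.distrib)
  show "z \<otimes>\<^bsub>?R\<^esub> (x \<oplus>\<^bsub>?R\<^esub> y) = z \<otimes>\<^bsub>?R\<^esub> x \<oplus>\<^bsub>?R\<^esub> z \<otimes>\<^bsub>?R\<^esub> y"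
    by (rule ext) (simp add: monoid_algebra_simps(4) S
        monoid_algebra_mult[of "supp z" _ S] distrib_right distrib_left sum.distrib)
qed

lemma (in monoid) monoid_algebra_minus:
  assumes "f \<in> carrier (monoid_algebra K G)" "g \<in> carrier (monoid_algebra K G)"
  shows "f \<ominus>\<^bsub>monoid_algebra K G\<^esub> g = (\<lambda>a. f a - g a)"
proof -
  interpret R: ring "monoid_algebra K G" by (rule monoid_algebra_ring)
  have "(\<lambda>a. - g a) \<in> carrier (monoid_algebra K G)"
    using assms by (auto simp: monoid_algebra_simps supp_def)
  then have "\<ominus>\<^bsub>monoid_algebra K G\<^esub> g = (\<lambda>a. - g a)"
    using assms by (intro R.minus_equality) (auto simp: monoid_algebra_simps)
  then show ?thesis by (simp add: a_minus_def monoid_algebra_simps)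
qed

lemma (in monoid) monoid_algebra_finsum:
  assumes "finite A" "f \<in> A \<rightarrow> carrier (monoid_algebra K G)"
  shows "(\<Oplus>\<^bsub>monoid_algebra K G\<^esub>x\<in>A. f x) = (\<lambda>a. \<Sum>x\<in>A. f x a)"
proof -
  interpret R: ring "monoid_algebra K G" by (rule monoid_algebra_ring)
  show ?thesis
    using assms by (induction A) (simp_all add: monoid_algebra_simps Pi_iff)
qed

section \<open>Ideals of quotients and of monoid algebras\<close>

text \<open>
  By the correspondence of ideals, all work can be done in \<open>R\<close>, with ideals that contain \<open>I\<close>.
\<close>

lemma simple_quotient_iff:
  assumes "ring R" and I: "ideal I R"
  shows "simple_ring (R Quot I) \<longleftrightarrow>
    I \<noteq> carrier R \<and> (\<forall>J. ideal J R \<and> I \<subseteq> J \<longrightarrow> J = I \<or> J = carrier R)"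
proof -
  interpret R: ring R by fact
  interpret I: ideal I R by fact
  let ?f = "\<lambda>J. (+>\<^bsub>R\<^esub>) I ` J"
  have bij: "bij_betw ?f {J. ideal J R \<and> I \<subseteq> J} {J. ideal J (R Quot I)}"
    by (rule R.quot_ideal_correspondence[OF I])
  have zero: "\<zero>\<^bsub>R Quot I\<^esub> = I" by (simp add: FactRing_def)
  have carr: "carrier (R Quot I) = ?f (carrier R)"
    unfolding FactRing_def partial_object.select_convs A_RCOSETS_def' by blast
  have fI: "?f I = {I}"
  proof
    show "?f I \<subseteq> {I}" using I.a_rcos_const by blast
    show "{I} \<subseteq> ?f I" using I.a_rcos_const[OF I.zero_closed] I.zero_closed by (metis empty_subsetI imageI insert_subset)
  qed
  have top: "ideal (carrier R) R" by (rule R.oneideal)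
  have I_sub: "I \<subseteq> carrier R" by (rule I.a_subset)
  have inj: "J = J'" if "ideal J R" "I \<subseteq> J" "ideal J' R" "I \<subseteq> J'" "?f J = ?f J'" for J J'
    using bij_betw_imp_inj_on[OF bij] that by (simp add: inj_on_def)
  have f_eq: "?f J = ?f J' \<longleftrightarrow> J = J'" if "ideal J R" "I \<subseteq> J" "ideal J' R" "I \<subseteq> J'" for J J'
    using inj[OF that] by blast
  have "carrier (R Quot I) = {I} \<longleftrightarrow> carrier R = I"
    unfolding carr fI[symmetric] using top I_sub I by (intro f_eq) auto
  moreover have "(\<forall>L. ideal L (R Quot I) \<longrightarrow> L = {I} \<or> L = carrier (R Quot I))
      \<longleftrightarrow> (\<forall>L \<in> ?f ` {J. ideal J R \<and> I \<subseteq> J}. L = ?f I \<or> L = ?f (carrier R))"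
    unfolding bij_betw_imp_surj_on[OF bij] carr fI by blast
  moreover have "\<dots> \<longleftrightarrow> (\<forall>J \<in> {J. ideal J R \<and> I \<subseteq> J}. J = I \<or> J = carrier R)"
    unfolding ball_simps(9) using top I_sub I f_eq by (intro ball_cong refl) auto
  ultimately show ?thesis unfolding simple_ring_def zero by auto
qed

locale monoid_algebra_ideal =
  M: monoid M + J: ideal J "monoid_algebra TYPE('k::field) M"
  for M (structure) and J :: "('a \<Rightarrow> 'k::field) set"
begin

abbreviation "F \<equiv> monoid_algebra TYPE('k) M"

lemma ring_F: "ring F" by (rule M.monoid_algebra_ring)

sublocale F: ring F by (rule ring_F)

lemma J_sub: "f \<in> J \<Longrightarrow> finite (supp f) \<and> supp f \<subseteq> carrier M"
  using J.a_subset by (auto simp: monoid_algebra_simps)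

lemma delta_closed: "a \<in> carrier M \<Longrightarrow> delta a \<in> carrier F"
  by (simp add: monoid_algebra_simps supp_delta)

lemma J_zero: "(\<lambda>_. 0) \<in> J"
  using additive_subgroup.zero_closed[OF J.additive_subgroup_axioms] by (simp add: monoid_algebra_simps)

lemma J_add: "f \<in> J \<Longrightarrow> g \<in> J \<Longrightarrow> (\<lambda>a. f a + g a) \<in> J"
  using additive_subgroup.a_closed[OF J.additive_subgroup_axioms] by (simp add: monoid_algebra_simps)

lemma J_scale:
  assumes "f \<in> J"
  shows "(\<lambda>a. c * f a) \<in> J"
proof -
  let ?c = "\<lambda>a. c * delta \<one> a"
  have c: "?c \<in> carrier F" "supp ?c \<subseteq> {\<one>}"
    using supp_scale[of c "delta \<one>"] by (auto simp: monoid_algebra_simps supp_delta finite_subset)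
  have f: "finite (supp f)" "supp f \<subseteq> carrier M" using J_sub[OF assms] by auto
  have "?c \<otimes>\<^bsub>F\<^esub> f = (\<lambda>a. c * f a)"
  proof
    fix a
    have "(?c \<otimes>\<^bsub>F\<^esub> f) a = c * (\<Sum>b\<in>supp f. f b * delta (\<one> \<otimes> b) a)"
      by (subst monoid_algebra_mult[of "{\<one>}" _ "supp f"])
        (use c f in \<open>simp_all add: sum_distrib_left mult.assoc\<close>)
    also have "\<dots> = c * lin_ext (\<lambda>b. \<one> \<otimes> b) f a"
      using f by (simp add: lin_ext_eq_sum)
    also have "lin_ext (\<lambda>b. \<one> \<otimes> b) f = lin_ext (\<lambda>b. b) f"
      using f by (intro lin_ext_cong) auto
    finally show "(?c \<otimes>\<^bsub>F\<^esub> f) a = c * f a" by (simp add: lin_ext_ident)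
  qed
  then show ?thesis using J.I_l_closed[OF assms c(1)] by simp
qed

lemma J_diff: "f \<in> J \<Longrightarrow> g \<in> J \<Longrightarrow> (\<lambda>a. f a - g a) \<in> J"
  using J_add[OF _ J_scale[of g "-1"]] by simp

lemma J_lincomb:
  assumes "finite A" "\<And>i. i \<in> A \<Longrightarrow> m i \<in> J"
  shows "(\<lambda>a. \<Sum>i\<in>A. c i * m i a) \<in> J"
  using assms
proof (induction A)
  case (insert x A)
  have "(\<lambda>a. c x * m x a + (\<Sum>i\<in>A. c i * m i a)) \<in> J"
    using insert by (intro J_add J_scale) auto
  then show ?case using insert.hyps by simp
qed (simp add: J_zero)

lemma J_translate_left:
  assumes "f \<in> J" "a \<in> carrier M"
  shows "lin_ext (\<lambda>b. a \<otimes> b) f \<in> J"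
  using J.I_l_closed[OF assms(1) delta_closed[OF assms(2)]] J_sub[OF assms(1)]
  by (simp add: delta_mult)

lemma J_translate_right:
  assumes "f \<in> J" "b \<in> carrier M"
  shows "lin_ext (\<lambda>a. a \<otimes> b) f \<in> J"
  using J.I_r_closed[OF assms(1) delta_closed[OF assms(2)]] J_sub[OF assms(1)]
  by (simp add: mult_delta)

lemma J_delta_mult:
  "delta a \<in> J \<Longrightarrow> b \<in> carrier M \<Longrightarrow> delta (b \<otimes> a) \<in> J"
  "delta a \<in> J \<Longrightarrow> b \<in> carrier M \<Longrightarrow> delta (a \<otimes> b) \<in> J"
  using J_translate_left[of "delta a" b] J_translate_right[of "delta a" b]
  by (simp_all add: lin_ext_delta)

lemma J_one: "delta \<one> \<in> J \<Longrightarrow> J = carrier F"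
  using J.one_imp_carrier by (simp add: monoid_algebra_simps)

definition weq :: "'a \<Rightarrow> 'a \<Rightarrow> bool" (infix "\<asymp>" 50) where
  "a \<asymp> b \<longleftrightarrow> a \<in> carrier M \<and> b \<in> carrier M \<and> (\<lambda>m. delta a m - delta b m) \<in> J"

lemma weq_refl: "a \<in> carrier M \<Longrightarrow> a \<asymp> a"
  by (simp add: weq_def J_zero)

lemma weq_sym: "a \<asymp> b \<Longrightarrow> b \<asymp> a"
  unfolding weq_def using J_scale[of "\<lambda>m. delta a m - delta b m" "-1"] by simp

lemma weq_trans [trans]: "a \<asymp> b \<Longrightarrow> b \<asymp> c \<Longrightarrow> a \<asymp> c"
  unfolding weq_def using J_add[of "\<lambda>m. delta a m - delta b m" "\<lambda>m. delta b m - delta c m"] by simp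

lemma lin_ext_diff_delta:
  "lin_ext l (\<lambda>m. delta a m - delta b m) = (\<lambda>m. delta (l a) m - delta (l b) m :: 'k)"
proof
  fix m
  have "supp (\<lambda>m. - 1 * delta b m :: 'k) \<subseteq> {b}" using supp_scale[of "-1" "delta b"] by (simp add: supp_delta)
  then have "finite (supp (\<lambda>m. - 1 * delta b m :: 'k))" by (rule finite_subset) simp
  then have "lin_ext l (\<lambda>m. delta a m + (- 1 * delta b m)) m = delta (l a) m + (- 1 * delta (l b) m :: 'k)"
    by (subst lin_ext_add, simp add: supp_delta, assumption, subst lin_ext_scale)
      (simp_all add: supp_delta lin_ext_delta)
  then show "lin_ext l (\<lambda>m. delta a m - delta b m) m = (delta (l a) m - delta (l b) m :: 'k)" by simp
qed

lemma weq_mult_left: "a \<asymp> b \<Longrightarrow> c \<in> carrier M \<Longrightarrow> c \<otimes> a \<asymp> c \<otimes> b"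
  unfolding weq_def
  using J_translate_left[of "\<lambda>m. delta a m - delta b m" c] by (simp add: lin_ext_diff_delta)

lemma weq_mult_right: "a \<asymp> b \<Longrightarrow> c \<in> carrier M \<Longrightarrow> a \<otimes> c \<asymp> b \<otimes> c"
  unfolding weq_def
  using J_translate_right[of "\<lambda>m. delta a m - delta b m" c] by (simp add: lin_ext_diff_delta)

lemma weq_J: "a \<asymp> b \<Longrightarrow> delta a \<in> J \<longleftrightarrow> delta b \<in> J"
  using J_add[of "\<lambda>m. delta a m - delta b m" "delta b"] J_diff[of "delta a" "\<lambda>m. delta a m - delta b m"]
  by (auto simp: weq_def)

text \<open>
  This carries every rewriting rule for words to elements of the algebra.
\<close>

lemma weq_lin_ext:
  fixes c :: "'i \<Rightarrow> 'k"
  assumes "finite (supp c)" "\<And>i. i \<in> supp c \<Longrightarrow> l i \<asymp> m i"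
  shows "(\<lambda>a. lin_ext l c a - lin_ext m c a) \<in> J"
proof -
  have "(\<lambda>a. \<Sum>i\<in>supp c. c i * (delta (l i) a - delta (m i) a)) \<in> J"
    using assms by (intro J_lincomb) (auto simp: weq_def)
  then show ?thesis
    using assms(1) by (simp add: lin_ext_eq_sum right_diff_distrib sum_subtractf)
qed

lemma J_cong: "(\<lambda>a. f a - g a) \<in> J \<Longrightarrow> f \<in> J \<longleftrightarrow> g \<in> J"
  using J_add[of "\<lambda>m. f m - g m" g] J_diff[of f "\<lambda>m. f m - g m"] by auto

end

section \<open>Self-similar groups\<close>

context self_similar_group
begin

lemma act_closed: "g \<in> carrier \<Gamma> \<Longrightarrow> w \<in> lists \<X> \<Longrightarrow> act g w \<in> lists \<X>"
  by (rule element_image) auto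

lemma act_one: "w \<in> lists \<X> \<Longrightarrow> act \<one> w = w"
  using id_eq_one by (metis restrict_apply')

lemma act_mult:
  "g \<in> carrier \<Gamma> \<Longrightarrow> h \<in> carrier \<Gamma> \<Longrightarrow> w \<in> lists \<X> \<Longrightarrow> act (g \<otimes> h) w = act g (act h w)"
  by (rule composition_rule)

lemma group_\<Gamma>: "group \<Gamma>"
  using group_hom by (simp add: group_hom_def)

lemma act_inv:
  assumes "g \<in> carrier \<Gamma>" "w \<in> lists \<X>"
  shows "act (inv g) (act g w) = w" "act g (act (inv g) w) = w"
proof -
  interpret \<Gamma>: group \<Gamma> by (rule group_\<Gamma>)
  show "act (inv g) (act g w) = w"
    using act_mult[of "inv g" g w] assms act_one by simp
  show "act g (act (inv g) w) = w"
    using act_mult[of g "inv g" w] assms act_one by simp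
qed

lemma act_eqI:
  assumes "g \<in> carrier \<Gamma>" "h \<in> carrier \<Gamma>" "\<And>w. w \<in> lists \<X> \<Longrightarrow> act g w = act h w"
  shows "g = h"
proof -
  have "act g \<in> extensional (lists \<X>)" "act h \<in> extensional (lists \<X>)"
    using assms bij_prop0 by (auto simp: Bij_def)
  then have "act g = act h" using assms(3) by (metis extensionalityI)
  then show ?thesis using faithful assms by (auto dest: inj_onD)
qed

lemma word_section:
  assumes "g \<in> carrier \<Gamma>" "x \<in> \<X>"
  shows "word_section \<Gamma> \<X> act g x \<in> carrier \<Gamma>"
    and "w \<in> lists \<X> \<Longrightarrow> act g (x # w) = act g [x] @ act (word_section \<Gamma> \<X> act g x) w"
proof -
  have "\<exists>!k. k \<in> carrier \<Gamma> \<and> (\<forall>w \<in> lists \<X>. act g (x # w) = act g [x] @ act k w)"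
    using section_exists[OF assms] act_eqI by (metis same_append_eq)
  from theI'[OF this] show "word_section \<Gamma> \<X> act g x \<in> carrier \<Gamma>"
    and "w \<in> lists \<X> \<Longrightarrow> act g (x # w) = act g [x] @ act (word_section \<Gamma> \<X> act g x) w"
    unfolding word_section_def by blast+
qed

lemma act_letter:
  assumes "g \<in> carrier \<Gamma>" "x \<in> \<X>"
  shows "act g [x] = [hd (act g [x])]" "hd (act g [x]) \<in> \<X>"
proof -
  have "length (act g [x]) = 1" "act g [x] \<in> lists \<X>"
    using assms length_preserving[of g "[x]"] act_closed[of g "[x]"] by auto
  then show "act g [x] = [hd (act g [x])]" "hd (act g [x]) \<in> \<X>"
    by (cases "act g [x]"; simp)+
qed

lemma act_Cons:
  assumes "g \<in> carrier \<Gamma>" "x \<in> \<X>" "w \<in> lists \<X>"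
  shows "act g (x # w) = hd (act g [x]) # act (word_section \<Gamma> \<X> act g x) w"
  using word_section(2)[OF assms] act_letter(1)[OF assms(1,2)] by (metis append_Cons append_Nil)

text \<open>
  Self-similar actions preserve prefixes, hence extend to infinite words.
\<close>

lemma take_act:
  assumes "g \<in> carrier \<Gamma>" "w \<in> lists \<X>"
  shows "take m (act g w) = act g (take m w)"
  using assms
proof (induction w arbitrary: g m)
  case Nil
  then show ?case using length_preserving[of g "[]"] by simp
next
  case (Cons x w)
  have nil: "act g [] = []" using length_preserving[of g "[]"] Cons.prems by simp
  show ?case
  proof (cases m)
    case (Suc n)
    have x: "x \<in> \<X>" "w \<in> lists \<X>" using Cons.prems by simp_all
    then have t: "take n w \<in> lists \<X>" by (metis append_in_lists_conv append_take_drop_id)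
    note s = word_section(1)[OF Cons.prems(1) x(1)]
    show ?thesis
      using Cons.IH[OF s x(2), of n]
      by (simp add: Suc act_Cons[OF Cons.prems(1) x(1,2)] act_Cons[OF Cons.prems(1) x(1) t])
  qed (simp add: nil)
qed

end

lemma (in self_similar_group) word_section_eqI:
  assumes "g \<in> carrier \<Gamma>" "x \<in> \<X>" "k \<in> carrier \<Gamma>" "\<And>w. w \<in> lists \<X> \<Longrightarrow> act g (x # w) = u @ act k w" "length u = 1"
  shows "word_section \<Gamma> \<X> act g x = k"
proof (rule act_eqI)
  show "word_section \<Gamma> \<X> act g x \<in> carrier \<Gamma>" using word_section(1) assms by blast
  fix w assume w: "w \<in> lists \<X>"
  obtain y where y: "u = [y]" using assms(5) by (cases u) auto
  have "hd (act g [x]) # act (word_section \<Gamma> \<X> act g x) w = y # act k w"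
    using act_Cons[OF assms(1,2) w] assms(4)[OF w] y by simp
  then show "act (word_section \<Gamma> \<X> act g x) w = act k w" by simp
qed fact

section \<open>Rewriting in a Nekrashevych algebra\<close>

lemma star_words_simps:
  "carrier (star_words S) = lists (S \<times> UNIV)" "v \<otimes>\<^bsub>star_words S\<^esub> w = v @ w" "\<one>\<^bsub>star_words S\<^esub> = []"
  by (simp_all add: star_words_def)

lemma mem_Plus [simp]: "Inl x \<in> A <+> B \<longleftrightarrow> x \<in> A" "Inr y \<in> A <+> B \<longleftrightarrow> y \<in> B"
  by auto

lemma star_words_monoid: "monoid (star_words S)"
  by (rule monoidI) (simp_all add: star_words_simps)

definition lt_word :: "'x list \<Rightarrow> (('x + 'a) \<times> bool) list" where
  "lt_word = map (\<lambda>x. (Inl x, False))"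

definition lt_star_word :: "'x list \<Rightarrow> (('x + 'a) \<times> bool) list" where
  "lt_star_word w = rev (map (\<lambda>x. (Inl x, True)) w)"

lemma lt_word_simps [simp]:
  "lt_word [] = []" "lt_word (x # w) = (Inl x, False) # lt_word w" "lt_word (v @ w) = lt_word v @ lt_word w"
  "lt_star_word [] = []" "lt_star_word (x # w) = lt_star_word w @ [(Inl x, True)]"
  by (simp_all add: lt_word_def lt_star_word_def)

lemma lt_word_in_lists [simp]:
  "lt_word w \<in> lists ((\<X> <+> A) \<times> UNIV) \<longleftrightarrow> w \<in> lists \<X>"
  "lt_star_word w \<in> lists ((\<X> <+> A) \<times> UNIV) \<longleftrightarrow> w \<in> lists \<X>"
  by (induction w) auto

locale nekrashevych_ideal =
  self_similar_group \<Gamma> \<X> act +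
  ideal J "free_star_algebra TYPE('k::field) (Sum_Type.Plus \<X> (carrier \<Gamma>))"
  for \<Gamma> (structure) and \<X> :: "'x set" and act :: "'a \<Rightarrow> 'x list \<Rightarrow> 'x list"
    and J :: "((('x + 'a) \<times> bool) list \<Rightarrow> 'k::field) set" +
  assumes relators: "nekrashevych_relators TYPE('k) \<Gamma> \<X> act \<subseteq> J"
begin

abbreviation "W \<equiv> star_words (Sum_Type.Plus \<X> (carrier \<Gamma>)) :: (('x + 'a) \<times> bool) list monoid"

sublocale W: monoid_algebra_ideal W J
  by (intro monoid_algebra_ideal.intro star_words_monoid ideal_axioms)

sublocale \<Gamma>: group \<Gamma> by (rule group_\<Gamma>)

notation W.weq (infix "\<asymp>" 50)

lemma delta_times: "delta v \<otimes>\<^bsub>W.F\<^esub> delta w = delta (v @ w)"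
  by (simp add: delta_mult supp_delta lin_ext_delta star_words_simps)

lemma delta_minus:
  "v \<in> carrier W \<Longrightarrow> w \<in> carrier W \<Longrightarrow> delta v \<ominus>\<^bsub>W.F\<^esub> delta w = (\<lambda>u. delta v u - delta w u)"
  by (intro W.M.monoid_algebra_minus W.delta_closed)

lemmas W_simps = star_words_simps

lemma gr_one: "[(Inr \<one>, False)] \<asymp> []"
proof -
  have "delta [(Inr \<one>, False)] \<ominus>\<^bsub>W.F\<^esub> \<one>\<^bsub>W.F\<^esub> \<in> J"
    using relators by (auto simp: nekrashevych_relators_def Let_def)
  then show ?thesis
    by (simp add: W.weq_def delta_minus monoid_algebra_simps W_simps)
qed

lemma gr_star: "g \<in> carrier \<Gamma> \<Longrightarrow> [(Inr g, True)] \<asymp> [(Inr (inv g), False)]"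
proof -
  assume g: "g \<in> carrier \<Gamma>"
  then have "delta [(Inr g, True)] \<ominus>\<^bsub>W.F\<^esub> delta [(Inr (inv g), False)] \<in> J"
    using relators by (auto simp: nekrashevych_relators_def Let_def)
  then show ?thesis using g
    by (simp add: W.weq_def delta_minus monoid_algebra_simps W_simps)
qed

lemma gr_mult:
  assumes "g \<in> carrier \<Gamma>" "h \<in> carrier \<Gamma>"
  shows "[(Inr g, False), (Inr h, False)] \<asymp> [(Inr (g \<otimes> h), False)]"
proof -
  have "delta [(Inr g, False)] \<otimes>\<^bsub>W.F\<^esub> delta [(Inr h, False)] \<ominus>\<^bsub>W.F\<^esub> delta [(Inr (g \<otimes> h), False)] \<in> J"
    using relators assms unfolding nekrashevych_relators_def Let_def by blast
  then show ?thesis using assms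
    by (simp add: W.weq_def delta_minus delta_times monoid_algebra_simps W_simps)
qed

lemma gr_lt:
  assumes "g \<in> carrier \<Gamma>" "x \<in> \<X>"
  shows "[(Inr g, False), (Inl x, False)] \<asymp>
    [(Inl (hd (act g [x])), False), (Inr (word_section \<Gamma> \<X> act g x), False)]"
proof -
  have "delta [(Inr g, False)] \<otimes>\<^bsub>W.F\<^esub> delta [(Inl x, False)] \<ominus>\<^bsub>W.F\<^esub>
    delta [(Inl (hd (act g [x])), False)] \<otimes>\<^bsub>W.F\<^esub> delta [(Inr (word_section \<Gamma> \<X> act g x), False)] \<in> J"
    using relators assms unfolding nekrashevych_relators_def Let_def by blast
  then show ?thesis using assms act_letter(2)[OF assms] word_section(1)[OF assms]
    by (simp add: W.weq_def delta_minus delta_times monoid_algebra_simps W_simps)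
qed

lemma lt_star_lt:
  assumes "y \<in> \<X>" "x \<in> \<X>"
  shows "x = y \<Longrightarrow> [(Inl y, True), (Inl x, False)] \<asymp> []"
    and "x \<noteq> y \<Longrightarrow> delta [(Inl y, True), (Inl x, False)] \<in> J"
proof -
  have *: "delta [(Inl y, True)] \<otimes>\<^bsub>W.F\<^esub> delta [(Inl x, False)] \<ominus>\<^bsub>W.F\<^esub>
      (if x = y then \<one>\<^bsub>W.F\<^esub> else \<zero>\<^bsub>W.F\<^esub>) \<in> J"
    using relators assms unfolding nekrashevych_relators_def Let_def by blast
  show "[(Inl y, True), (Inl x, False)] \<asymp> []" if "x = y"
    using * that assms
    by (simp add: W.weq_def delta_minus delta_times monoid_algebra_simps W_simps)
  have "delta [(Inl y, True), (Inl x, False)] \<ominus>\<^bsub>W.F\<^esub> \<zero>\<^bsub>W.F\<^esub>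
      = (delta [(Inl y, True), (Inl x, False)] :: _ \<Rightarrow> 'k)"
    using assms ring.ring_simprules(2)[OF W.ring_F] by (subst W.M.monoid_algebra_minus) (auto simp: monoid_algebra_simps W_simps supp_delta)
  then show "delta [(Inl y, True), (Inl x, False)] \<in> J" if "x \<noteq> y"
    using * that by (simp add: delta_times)
qed

lemma sum_lt_lt_star:
  "(\<Oplus>\<^bsub>W.F\<^esub>x\<in>\<X>. delta [(Inl x, False), (Inl x, True)]) \<ominus>\<^bsub>W.F\<^esub> \<one>\<^bsub>W.F\<^esub> \<in> J"
proof -
  have "(\<Oplus>\<^bsub>W.F\<^esub>x\<in>\<X>. delta [(Inl x, False)] \<otimes>\<^bsub>W.F\<^esub> delta [(Inl x, True)]) \<ominus>\<^bsub>W.F\<^esub> \<one>\<^bsub>W.F\<^esub> \<in> J"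
    using relators unfolding nekrashevych_relators_def Let_def by blast
  then show ?thesis by (simp add: delta_times)
qed

lemma weq_append: "v \<asymp> v' \<Longrightarrow> w \<asymp> w' \<Longrightarrow> v @ w \<asymp> v' @ w'"
  using W.weq_mult_left[of w w' v] W.weq_mult_right[of v v' w'] W.weq_trans
  by (auto simp: W.weq_def[of v] W.weq_def[of w] W_simps)

lemma weq_prefix: "w \<asymp> w' \<Longrightarrow> v \<in> carrier W \<Longrightarrow> v @ w \<asymp> v @ w'"
  by (rule weq_append[OF W.weq_refl])

lemma weq_suffix: "w \<asymp> w' \<Longrightarrow> v \<in> carrier W \<Longrightarrow> w @ v \<asymp> w' @ v"
  by (rule weq_append[OF _ W.weq_refl])

text \<open>All commutation rules between group elements and letters come from the action on words.\<close>

lemma gr_lt_word: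
  assumes "g \<in> carrier \<Gamma>" "k \<in> carrier \<Gamma>" "u \<in> lists \<X>" "u' \<in> lists \<X>" "length u' = length u"
    and "\<And>w. w \<in> lists \<X> \<Longrightarrow> act g (u @ w) = u' @ act k w"
  shows "(Inr g, False) # lt_word u \<asymp> lt_word u' @ [(Inr k, False)]"
  using assms
proof (induction u arbitrary: g u')
  case Nil
  then have "g = k" by (intro act_eqI) auto
  then show ?case using Nil by (simp add: W.weq_refl W_simps)
next
  case (Cons x u)
  then obtain y v where u': "u' = y # v" by (cases u') auto
  have x: "x \<in> \<X>" "u \<in> lists \<X>" "y \<in> \<X>" "v \<in> lists \<X>" using Cons.prems u' by auto
  let ?s = "word_section \<Gamma> \<X> act g x"
  have s: "?s \<in> carrier \<Gamma>" using word_section(1) Cons.prems(1) x(1) .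
  have eq: "hd (act g [x]) # act ?s (u @ w) = y # v @ act k w" if "w \<in> lists \<X>" for w
    using Cons.prems(6)[OF that] act_Cons[OF Cons.prems(1) x(1), of "u @ w"] that x(2) u' by simp
  have y: "hd (act g [x]) = y" using eq[of "[]"] by simp
  have "[(Inr g, False), (Inl x, False)] @ lt_word u \<asymp> [(Inl y, False), (Inr ?s, False)] @ lt_word u"
    using gr_lt[OF Cons.prems(1) x(1)] x y by (intro weq_suffix) (auto simp: W_simps)
  moreover have "[(Inl y, False)] @ ((Inr ?s, False) # lt_word u) \<asymp> [(Inl y, False)] @ lt_word v @ [(Inr k, False)]"
    using Cons x u' s eq by (intro weq_prefix Cons.IH) (auto simp: W_simps)
  ultimately show ?case using W.weq_trans by (simp add: u')
qed

lemma lt_star_word_lt_word: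
  assumes "u \<in> lists \<X>"
  shows "lt_star_word u @ lt_word u \<asymp> []"
  using assms
proof (induction u)
  case (Cons x u)
  then have "lt_star_word u @ ([(Inl x, True), (Inl x, False)] @ lt_word u) \<asymp> lt_star_word u @ ([] @ lt_word u)"
    by (intro weq_prefix weq_suffix lt_star_lt(1)) (auto simp: W_simps)
  then show ?case using Cons W.weq_trans by fastforce
qed (simp add: W.weq_refl W_simps)

text \<open>As \<open>1\<close> is the sum of the \<open>x x\<^sup>*\<close>, an element is detected by its products with long words.\<close>

lemma in_J_if_translates:
  assumes "a \<in> carrier W.F" "\<And>v. v \<in> lists \<X> \<Longrightarrow> length v = n \<Longrightarrow> lin_ext (\<lambda>w. w @ lt_word v) a \<in> J"
  shows "a \<in> J"
  using assms
proof (induction n arbitrary: a)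
  case 0
  then show ?case using "0.prems"(2)[of "[]"] by (simp add: lin_ext_ident)
next
  case (Suc n)
  have fin: "finite (supp a)" and sub: "supp a \<subseteq> carrier W"
    using Suc.prems by (auto simp: monoid_algebra_simps)
  have letter: "lin_ext (\<lambda>w. w @ [(Inl x, False)]) a \<in> J" if x: "x \<in> \<X>" for x
  proof (rule Suc.IH)
    have "a \<otimes>\<^bsub>W.F\<^esub> delta [(Inl x, False)] \<in> carrier W.F"
      using Suc.prems(1) x by (intro m_closed W.delta_closed) (auto simp: W_simps)
    then show "lin_ext (\<lambda>w. w @ [(Inl x, False)]) a \<in> carrier W.F"
      using fin by (simp add: mult_delta W_simps)
    show "lin_ext (\<lambda>w. w @ lt_word v) (lin_ext (\<lambda>w. w @ [(Inl x, False)]) a) \<in> J"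
      if "v \<in> lists \<X>" "length v = n" for v
      using Suc.prems(2)[of "x # v"] x that fin by (simp add: lin_ext_comp)
  qed
  have xx: "lin_ext (\<lambda>w. w @ [(Inl x, False), (Inl x, True)]) a \<in> J" if x: "x \<in> \<X>" for x
    using W.J_translate_right[OF letter[OF x], of "[(Inl x, True)]"] x fin
    by (simp add: W_simps lin_ext_comp)
  let ?d = "\<lambda>x. delta [(Inl x, False), (Inl x, True)]"
  let ?S = "\<Oplus>\<^bsub>W.F\<^esub>x\<in>\<X>. ?d x"
  have d: "?d \<in> \<X> \<rightarrow> carrier W.F"
    by (intro Pi_I W.delta_closed) (auto simp: W_simps)
  have S: "?S \<in> carrier W.F" using d by simp
  have "a \<otimes>\<^bsub>W.F\<^esub> ?S = (\<Oplus>\<^bsub>W.F\<^esub>x\<in>\<X>. a \<otimes>\<^bsub>W.F\<^esub> ?d x)"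
    using finite_X Suc.prems(1) d by (rule finsum_rdistr)
  also have "\<dots> = (\<lambda>w. \<Sum>x\<in>\<X>. 1 * (a \<otimes>\<^bsub>W.F\<^esub> ?d x) w)"
    using Suc.prems(1) d by (subst W.M.monoid_algebra_finsum[OF finite_X]) auto
  also have "\<dots> \<in> J"
    using xx fin by (intro W.J_lincomb finite_X) (simp add: mult_delta W_simps)
  finally have "a \<otimes>\<^bsub>W.F\<^esub> ?S \<in> J" .
  moreover have "a \<otimes>\<^bsub>W.F\<^esub> (?S \<ominus>\<^bsub>W.F\<^esub> \<one>\<^bsub>W.F\<^esub>) \<in> J"
    by (rule I_l_closed[OF sum_lt_lt_star Suc.prems(1)])
  moreover have "a \<otimes>\<^bsub>W.F\<^esub> (?S \<ominus>\<^bsub>W.F\<^esub> \<one>\<^bsub>W.F\<^esub>) = (\<lambda>w. (a \<otimes>\<^bsub>W.F\<^esub> ?S) w - a w)"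
  proof -
    have "a \<otimes>\<^bsub>W.F\<^esub> (?S \<ominus>\<^bsub>W.F\<^esub> \<one>\<^bsub>W.F\<^esub>) = a \<otimes>\<^bsub>W.F\<^esub> ?S \<ominus>\<^bsub>W.F\<^esub> a"
      using Suc.prems(1) S by (simp add: a_minus_def r_distr r_minus)
    then show ?thesis
      using Suc.prems(1) S W.M.monoid_algebra_minus[of "a \<otimes>\<^bsub>W.F\<^esub> ?S" "TYPE('k)" a] by simp
  qed
  ultimately show ?case
    using W.J_diff[of "a \<otimes>\<^bsub>W.F\<^esub> ?S" "\<lambda>w. (a \<otimes>\<^bsub>W.F\<^esub> ?S) w - a w"] by simp
qed

end

section \<open>Ideals of a Nekrashevych algebra\<close>

definition normal_word :: "'x list \<times> 'a \<Rightarrow> (('x + 'a) \<times> bool) list" where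
  "normal_word = (\<lambda>(u, g). lt_word u @ [(Inr g, False)])"

context nekrashevych_ideal
begin

text \<open>
  If neither of two words is a prefix of the other, the first pair of distinct letters gives \<open>y\<^sup>* x = 0\<close>.
\<close>

lemma lt_star_word_lt_word_zero:
  assumes "u \<in> lists \<X>" "v \<in> lists \<X>"
    and "take (min (length u) (length v)) u \<noteq> take (min (length u) (length v)) v"
  shows "delta (lt_star_word v @ lt_word u) \<in> J"
  using assms
proof (induction v arbitrary: u)
  case (Cons y v)
  then obtain x t where u: "u = x # t" by (cases u) auto
  have mem: "lt_star_word v \<in> carrier W" "lt_word t \<in> carrier W" "x \<in> \<X>" "y \<in> \<X>" "t \<in> lists \<X>" "v \<in> lists \<X>"
    using Cons.prems u by (auto simp: W_simps)
  show ?case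
  proof (cases "x = y")
    case True
    have "lt_star_word v @ ([(Inl y, True), (Inl x, False)] @ lt_word t) \<asymp> lt_star_word v @ ([] @ lt_word t)"
      using True mem by (intro weq_prefix weq_suffix lt_star_lt(1)) auto
    moreover have "delta (lt_star_word v @ lt_word t) \<in> J"
      using Cons.IH[of t] Cons.prems(3) mem u True by simp
    ultimately show ?thesis using W.weq_J u by fastforce
  next
    case False
    then have "delta [(Inl y, True), (Inl x, False)] \<in> J"
      using mem by (intro lt_star_lt(2)) auto
    then have "delta (lt_star_word v @ ([(Inl y, True), (Inl x, False)] @ lt_word t)) \<in> J"
      using W.J_delta_mult mem(1,2) by (metis W_simps(2))
    then show ?thesis by (simp add: u)
  qed
qed simp

text \<open>
  The argument that proves the simplicity of Leavitt algebras. Among the words that occur, let \<open>u\<^sub>1\<close> be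
  of maximal length; with \<open>q = y z z \<dots> z\<close>, no proper extension \<open>r q\<close> of the relevant length has \<open>q\<close> as
  a prefix, so that \<open>q\<^sup>* u\<^sub>1\<^sup>*\<close> on the left and \<open>q\<close> on the right single out the coefficient of \<open>u\<^sub>1\<close>.
\<close>

lemma lt_combination_in_J:
  assumes fin: "finite (supp s)" and sub: "supp s \<subseteq> lists \<X>" and ne: "supp s \<noteq> {}"
    and sJ: "lin_ext lt_word s \<in> J"
  shows "J = carrier W.F"
proof -
  have "Max (length ` supp s) \<in> length ` supp s" using fin ne by (intro Max_in) auto
  then obtain u1 where "u1 \<in> supp s" "length u1 = Max (length ` supp s)" by auto
  then have u1: "u1 \<in> supp s" "\<And>u. u \<in> supp s \<Longrightarrow> length u \<le> length u1"
    using fin by auto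
  obtain y z where yz: "y \<in> \<X>" "z \<in> \<X>" "y \<noteq> z"
    using card_X finite_X card_le_Suc0_iff_eq[of \<X>] by force
  define q where "q = y # replicate (length u1) z"
  have q: "q \<in> lists \<X>" using yz by (auto simp: q_def)
  have u1X: "u1 \<in> lists \<X>" using u1(1) sub by blast
  define v :: "(('x + 'a) \<times> bool) list" where "v = lt_star_word (u1 @ q)"
  define m where "m = (\<lambda>u. v @ lt_word (u @ q))"
  have vW: "v \<in> carrier W" "lt_word q \<in> carrier W"
    using q u1X by (simp_all add: W_simps v_def)
  have other: "delta (m u) \<in> J" if u: "u \<in> supp s - {u1}" for u
  unfolding m_def v_def
  proof (rule lt_star_word_lt_word_zero)
    show "u @ q \<in> lists \<X>" "u1 @ q \<in> lists \<X>" using u sub q u1X by auto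
    have le: "length u \<le> length u1" using u1(2) u by blast
    show "take (min (length (u @ q)) (length (u1 @ q))) (u @ q)
      \<noteq> take (min (length (u @ q)) (length (u1 @ q))) (u1 @ q)"
    proof
      assume "take (min (length (u @ q)) (length (u1 @ q))) (u @ q)
        = take (min (length (u @ q)) (length (u1 @ q))) (u1 @ q)"
      then have *: "u @ q = take (length u + length q) (u1 @ q)"
        using le by simp
      then have "u = take (length u) u1"
      proof -
        have "u = take (length u) (u @ q)" by simp
        also have "\<dots> = take (length u) (u1 @ q)" unfolding * take_take by (simp add: min_def)
        finally show ?thesis using le by simp
      qed
      then obtain r where r: "u1 = u @ r" by (metis append_take_drop_id)
      then have "r \<noteq> []" using u by auto
      have "q = take (length q) (r @ q)" using * by (simp add: r)
      then have "q ! length r = take (length q) (r @ q) ! length r" by (rule arg_cong)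
      also have "\<dots> = (r @ q) ! length r" by (rule nth_take) (simp add: q_def r)
      also have "\<dots> = y" by (simp add: nth_append q_def)
      finally have "q ! length r = y" .
      moreover obtain j where j: "length r = Suc j" using \<open>r \<noteq> []\<close> by (cases r) auto
      moreover have "q ! Suc j = z"
      proof -
        have "j < length u1" using j r by simp
        then show ?thesis by (simp add: q_def)
      qed
      ultimately show False using yz(3) by simp
    qed
  qed
  have "lin_ext (\<lambda>w. v @ w) (lin_ext (\<lambda>w. w @ lt_word q) (lin_ext lt_word s)) \<in> J"
    using W.J_translate_left[OF W.J_translate_right[OF sJ vW(2)] vW(1)] by (simp add: W_simps)
  then have "lin_ext m s \<in> J"
    using fin by (simp add: lin_ext_comp finite_supp_lin_ext m_def)
  moreover have "(\<lambda>w. \<Sum>u\<in>supp s - {u1}. s u * delta (m u) w) \<in> J"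
    using fin other by (intro W.J_lincomb) auto
  ultimately have "(\<lambda>w. lin_ext m s w - (\<Sum>u\<in>supp s - {u1}. s u * delta (m u) w)) \<in> J"
    by (rule W.J_diff)
  also have "(\<lambda>w. lin_ext m s w - (\<Sum>u\<in>supp s - {u1}. s u * delta (m u) w))
      = (\<lambda>w. s u1 * delta (m u1) w)"
    using fin u1(1) by (simp add: lin_ext_eq_sum[OF fin order.refl] sum.remove[OF fin u1(1)])
  finally have "(\<lambda>w. inverse (s u1) * (s u1 * delta (m u1) w)) \<in> J" by (rule W.J_scale)
  moreover have "(\<lambda>w. inverse (s u1) * (s u1 * delta (m u1) w)) = delta (m u1)"
    using u1(1) by (simp add: supp_def mult.assoc[symmetric])
  ultimately have "delta (m u1) \<in> J" by (simp only:)
  then have "delta [] \<in> J"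
    using W.weq_J[OF lt_star_word_lt_word[of "u1 @ q"]] u1X q by (simp add: m_def v_def)
  then show ?thesis using W.J_one by (simp add: W_simps)
qed

text \<open>
  Multiplication of a combination by a word on the right, followed by rewriting of each of its terms.
\<close>

lemma lin_ext_translate:
  fixes c :: "'i \<Rightarrow> 'k"
  assumes "finite (supp c)"
    and "\<And>i. i \<in> supp c \<Longrightarrow> m i @ lt_word q \<asymp> n (r i)"
  shows "lin_ext (\<lambda>w. w @ lt_word q) (lin_ext m c) \<in> J \<longleftrightarrow> lin_ext n (lin_ext r c) \<in> J"
proof -
  have "(\<lambda>w. lin_ext (\<lambda>i. m i @ lt_word q) c w - lin_ext (\<lambda>i. n (r i)) c w) \<in> J"
    using assms by (intro W.weq_lin_ext)
  then show ?thesis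
    using W.J_cong assms(1) by (simp add: lin_ext_comp)
qed

lemma lt_translate: "f \<in> J \<Longrightarrow> q \<in> lists \<X> \<Longrightarrow> lin_ext (\<lambda>w. w @ lt_word q) f \<in> J"
  using W.J_translate_right[of f "lt_word q"] by (simp add: W_simps)

text \<open>
  The rule \<open>gr_lt_word\<close> for the last factor of a product \<open>u g\<close>.
\<close>

lemma normal_word_lt_word:
  assumes "g \<in> carrier \<Gamma>" "k \<in> carrier \<Gamma>" "u \<in> lists \<X>" "q \<in> lists \<X>" "q' \<in> lists \<X>" "length q' = length q"
    and "\<And>w. w \<in> lists \<X> \<Longrightarrow> act g (q @ w) = q' @ act k w"
  shows "normal_word (u, g) @ lt_word q \<asymp> normal_word (u @ q', k)"
proof -
  have "lt_word u @ ((Inr g, False) # lt_word q) \<asymp> lt_word u @ (lt_word q' @ [(Inr k, False)])"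
    using assms by (intro weq_prefix gr_lt_word) (auto simp: W_simps)
  then show ?thesis by (simp add: normal_word_def)
qed

end

text \<open>
  One letter turns a product of \<open>2 n\<close> elements of \<open>S\<close> into one of \<open>n\<close> elements, so the sections of any group
  element along sufficiently long words lie in \<open>S\<close>: the group is contracting and its nucleus is contained in \<open>S\<close>.
\<close>

locale contracting_nekrashevych_ideal = nekrashevych_ideal \<Gamma> \<X> act J
  for \<Gamma> (structure) and \<X> :: "'x set" and act :: "'a \<Rightarrow> 'x list \<Rightarrow> 'x list"
    and J :: "((('x + 'a) \<times> bool) list \<Rightarrow> 'k::field) set" +
  fixes S :: "'a set"
  assumes S_sub: "S \<subseteq> carrier \<Gamma>" and S_gen: "carrier \<Gamma> = generate \<Gamma> S"
    and S_one: "\<one> \<in> S" and S_inv: "s \<in> S \<Longrightarrow> inv s \<in> S"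
    and S_section: "s \<in> S \<Longrightarrow> x \<in> \<X> \<Longrightarrow> word_section \<Gamma> \<X> act s x \<in> S"
    and S_mult_section: "s \<in> S \<Longrightarrow> t \<in> S \<Longrightarrow> x \<in> \<X> \<Longrightarrow> word_section \<Gamma> \<X> act (s \<otimes> t) x \<in> S"
begin

definition reduces :: "(('x + 'a) \<times> bool) list \<Rightarrow> bool" where
  "reduces v \<longleftrightarrow> v \<in> carrier W \<and>
     (delta v \<in> J \<or> (\<exists>u \<in> lists \<X>. \<exists>s \<in> S. v \<asymp> normal_word (u, s)))"

definition eventually_reduces :: "(('x + 'a) \<times> bool) list \<Rightarrow> bool" where
  "eventually_reduces w \<longleftrightarrow> (\<exists>k. \<forall>v \<in> lists \<X>. length v \<ge> k \<longrightarrow> reduces (w @ lt_word v))"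

lemma reduces_weq: "v \<asymp> w \<Longrightarrow> reduces w \<Longrightarrow> reduces v"
  unfolding reduces_def using W.weq_J W.weq_trans by (metis W.weq_def)

lemma normal_word_carrier: "u \<in> lists \<X> \<Longrightarrow> s \<in> carrier \<Gamma> \<Longrightarrow> normal_word (u, s) \<in> carrier W"
  by (simp add: normal_word_def W_simps)

lemma reduces_normal: "u \<in> lists \<X> \<Longrightarrow> s \<in> S \<Longrightarrow> reduces (normal_word (u, s))"
  unfolding reduces_def using normal_word_carrier S_sub W.weq_refl by blast

lemma reduces_zero: "v \<in> carrier W \<Longrightarrow> delta v \<in> J \<Longrightarrow> reduces v"
  by (simp add: reduces_def)

lemma normal_word_Cons: "normal_word (x # u, s) = (Inl x, False) # normal_word (u, s)"
  by (simp add: normal_word_def)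

lemma normal_word_letter:
  assumes "u \<in> lists \<X>" "s \<in> carrier \<Gamma>" "z \<in> \<X>"
  shows "normal_word (u, s) @ lt_word [z]
    \<asymp> normal_word (u @ [hd (act s [z])], word_section \<Gamma> \<X> act s z)"
proof -
  have "lt_word u @ [(Inr s, False), (Inl z, False)] \<asymp>
    lt_word u @ [(Inl (hd (act s [z])), False), (Inr (word_section \<Gamma> \<X> act s z), False)]"
    using assms by (intro weq_prefix gr_lt) (auto simp: W_simps)
  then show ?thesis by (simp add: normal_word_def)
qed

lemma S_lt_word:
  assumes "s \<in> S" "u \<in> lists \<X>"
  shows "\<exists>u' \<in> lists \<X>. \<exists>s' \<in> S. (Inr s, False) # lt_word u \<asymp> normal_word (u', s')"
  using assms
proof (induction u arbitrary: s)
  case Nil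
  then have "normal_word ([], s) \<asymp> normal_word ([], s)"
    using S_sub by (intro W.weq_refl normal_word_carrier) auto
  then show ?case using Nil by (intro bexI[of _ "[]"] bexI[of _ s]) (auto simp: normal_word_def)
next
  case (Cons x u)
  then have x: "x \<in> \<X>" "u \<in> lists \<X>" and s: "s \<in> carrier \<Gamma>" using S_sub by auto
  let ?s = "word_section \<Gamma> \<X> act s x" and ?y = "hd (act s [x])"
  have y: "?y \<in> \<X>" using act_letter s x by blast
  obtain u' s' where us: "u' \<in> lists \<X>" "s' \<in> S" "(Inr ?s, False) # lt_word u \<asymp> normal_word (u', s')"
    using Cons.IH S_section Cons.prems(1) x by metis
  have "[(Inr s, False), (Inl x, False)] @ lt_word u \<asymp> [(Inl ?y, False), (Inr ?s, False)] @ lt_word u"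
    using s x by (intro weq_suffix gr_lt) (auto simp: W_simps)
  moreover have "[(Inl ?y, False)] @ ((Inr ?s, False) # lt_word u) \<asymp> [(Inl ?y, False)] @ normal_word (u', s')"
    using us y by (intro weq_prefix) (auto simp: W_simps)
  ultimately have "(Inr s, False) # lt_word (x # u) \<asymp> normal_word (?y # u', s')"
    using W.weq_trans by (simp add: normal_word_Cons)
  then show ?case using us y by (intro bexI[of _ "?y # u'"] bexI[of _ s']) auto
qed

text \<open>
  A starred letter or an element of \<open>S\<close> on the left is absorbed at the cost of one more letter on the right.
\<close>

lemma eventually_reduces_letter:
  assumes w: "eventually_reduces w" and a: "[a] \<in> carrier W"
    and step: "\<And>u s z. u \<in> lists \<X> \<Longrightarrow> s \<in> S \<Longrightarrow> z \<in> \<X> \<Longrightarrow> reduces (a # normal_word (u, s) @ lt_word [z])"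
  shows "eventually_reduces (a # w)"
proof -
  obtain k where k: "\<And>v. v \<in> lists \<X> \<Longrightarrow> length v \<ge> k \<Longrightarrow> reduces (w @ lt_word v)"
    using w by (auto simp: eventually_reduces_def)
  have "reduces ((a # w) @ lt_word v)" if v: "v \<in> lists \<X>" "length v \<ge> Suc k" for v
  proof -
    obtain v0 z where vz: "v = v0 @ [z]" using v(2) by (cases v rule: rev_cases) auto
    have z: "v0 \<in> lists \<X>" "z \<in> \<X>" using v(1) vz by auto
    have zW: "lt_word [z] \<in> carrier W" using z by (simp add: W_simps)
    from k[OF z(1)] v(2) vz have red: "reduces (w @ lt_word v0)" by simp
    then have wv: "w @ lt_word v0 \<in> carrier W" by (simp add: reduces_def)
    have eq: "(a # w) @ lt_word v = [a] @ ((w @ lt_word v0) @ lt_word [z])" by (simp add: vz)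
    from red consider "delta (w @ lt_word v0) \<in> J"
      | u s where "u \<in> lists \<X>" "s \<in> S" "w @ lt_word v0 \<asymp> normal_word (u, s)"
      unfolding reduces_def by blast
    then show ?thesis
    proof cases
      case 1
      have "delta ([a] @ ((w @ lt_word v0) @ lt_word [z])) \<in> J"
        using W.J_delta_mult(1)[OF W.J_delta_mult(2)[OF 1 zW] a] by (simp add: W_simps)
      moreover have "[a] @ ((w @ lt_word v0) @ lt_word [z]) \<in> carrier W"
        using a wv zW by (simp add: W_simps)
      ultimately show ?thesis unfolding eq by (rule reduces_zero[rotated])
    next
      case 2
      have "[a] @ ((w @ lt_word v0) @ lt_word [z]) \<asymp> [a] @ (normal_word (u, s) @ lt_word [z])"
        by (intro weq_prefix weq_suffix 2 zW a)
      moreover have "reduces ([a] @ (normal_word (u, s) @ lt_word [z]))"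
        using step[OF 2(1,2) z(2)] by simp
      ultimately show ?thesis unfolding eq by (rule reduces_weq)
    qed
  qed
  then show ?thesis by (auto simp: eventually_reduces_def)
qed

text \<open>
  The product of two elements of \<open>S\<close> returns to \<open>S\<close> after the letter \<open>z\<close>.
\<close>

lemma reduces_S:
  assumes "t \<in> S" "u \<in> lists \<X>" "s \<in> S" "z \<in> \<X>"
  shows "reduces ((Inr t, False) # normal_word (u, s) @ lt_word [z])"
proof -
  obtain u' s' where us: "u' \<in> lists \<X>" "s' \<in> S" "(Inr t, False) # lt_word u \<asymp> normal_word (u', s')"
    using S_lt_word assms by blast
  have c: "s \<in> carrier \<Gamma>" "s' \<in> carrier \<Gamma>" "s' \<otimes> s \<in> carrier \<Gamma>" using us assms S_sub by auto
  have "((Inr t, False) # lt_word u) @ ([(Inr s, False)] @ lt_word [z])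
      \<asymp> normal_word (u', s') @ ([(Inr s, False)] @ lt_word [z])"
    using c assms by (intro weq_suffix us) (auto simp: W_simps)
  then have "(Inr t, False) # normal_word (u, s) @ lt_word [z]
      \<asymp> lt_word u' @ ([(Inr s', False), (Inr s, False)] @ lt_word [z])"
    by (simp add: normal_word_def)
  also have "lt_word u' @ ([(Inr s', False), (Inr s, False)] @ lt_word [z])
      \<asymp> lt_word u' @ ([(Inr (s' \<otimes> s), False)] @ lt_word [z])"
    using c us assms by (intro weq_prefix weq_suffix gr_mult) (auto simp: W_simps)
  also have "lt_word u' @ ([(Inr (s' \<otimes> s), False)] @ lt_word [z]) = normal_word (u', s' \<otimes> s) @ lt_word [z]"
    by (simp add: normal_word_def)
  also have "\<dots> \<asymp> normal_word (u' @ [hd (act (s' \<otimes> s) [z])], word_section \<Gamma> \<X> act (s' \<otimes> s) z)"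
    using us c assms by (intro normal_word_letter)
  finally have "(Inr t, False) # normal_word (u, s) @ lt_word [z]
      \<asymp> normal_word (u' @ [hd (act (s' \<otimes> s) [z])], word_section \<Gamma> \<X> act (s' \<otimes> s) z)" .
  moreover have "reduces (normal_word (u' @ [hd (act (s' \<otimes> s) [z])], word_section \<Gamma> \<X> act (s' \<otimes> s) z))"
    using us c assms act_letter(2)[of "s' \<otimes> s" z] by (intro reduces_normal S_mult_section) auto
  ultimately show ?thesis by (rule reduces_weq)
qed

lemma eventually_reduces_weq:
  assumes "w \<asymp> w'" "eventually_reduces w'"
  shows "eventually_reduces w"
proof -
  have "reduces (w @ lt_word v)" if "v \<in> lists \<X>" "reduces (w' @ lt_word v)" for v
    using that(1) by (intro reduces_weq[OF weq_suffix[OF assms(1)] that(2)]) (simp add: W_simps)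
  then show ?thesis using assms(2) unfolding eventually_reduces_def by blast
qed

lemma eventually_reduces_group:
  assumes "g \<in> carrier \<Gamma>" "eventually_reduces w" "w \<in> carrier W"
  shows "eventually_reduces ((Inr g, False) # w)"
proof -
  have S: "eventually_reduces ((Inr s, False) # w)" if "s \<in> S" "eventually_reduces w" for s w
    using that S_sub by (intro eventually_reduces_letter reduces_S) (auto simp: W_simps)
  from assms(1) have "g \<in> generate \<Gamma> S" by (simp add: S_gen)
  then show ?thesis using assms(2,3)
  proof (induction arbitrary: w)
    case one
    then show ?case using S S_one by blast
  next
    case (incl s)
    then show ?case using S by blast
  next
    case (inv s)
    then show ?case using S S_inv by blast
  next
    case (eng g h)
    have c: "g \<in> carrier \<Gamma>" "h \<in> carrier \<Gamma>" using eng.hyps S_gen by auto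
    have "[(Inr (g \<otimes> h), False)] @ w \<asymp> [(Inr g, False), (Inr h, False)] @ w"
      using c eng.prems by (intro weq_suffix W.weq_sym[OF gr_mult])
    moreover have "eventually_reduces ((Inr g, False) # (Inr h, False) # w)"
      using eng c by (auto simp: W_simps)
    ultimately show ?case using eventually_reduces_weq by simp
  qed
qed

text \<open>
  The letters of \<open>w\<close> are absorbed one by one, the last one first, each at the cost of
  finitely many letters of the long word on the right.
\<close>

lemma eventually_reduces:
  assumes "w \<in> carrier W"
  shows "eventually_reduces w"
  using assms
proof (induction w)
  case Nil
  have "reduces (lt_word v)" if "v \<in> lists \<X>" for v
  proof -
    have "lt_word v @ [] \<asymp> lt_word v @ [(Inr \<one>, False)]"
      using that by (intro weq_prefix W.weq_sym[OF gr_one]) (simp add: W_simps)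
    then show ?thesis
      using reduces_weq[OF _ reduces_normal[OF that S_one]] by (simp add: normal_word_def)
  qed
  then show ?case by (auto simp: eventually_reduces_def)
next
  case (Cons a w)
  have a: "[a] \<in> carrier W" and w: "w \<in> carrier W" "eventually_reduces w"
    using Cons by (auto simp: W_simps)
  consider x where "a = (Inl x, False)" "x \<in> \<X>" | x where "a = (Inl x, True)" "x \<in> \<X>"
    | g where "a = (Inr g, False)" "g \<in> carrier \<Gamma>" | g where "a = (Inr g, True)" "g \<in> carrier \<Gamma>"
    using a by (cases a; cases "fst a"; cases "snd a") (auto simp: W_simps)
  then show ?case
  proof cases
    case (1 x)
    show ?thesis
    proof (intro eventually_reduces_letter w(2) a)
      fix u s z assume usz: "u \<in> lists \<X>" "s \<in> S" "z \<in> \<X>"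
      then have s: "s \<in> carrier \<Gamma>" using S_sub by blast
      have "normal_word (x # u, s) @ lt_word [z]
        \<asymp> normal_word ((x # u) @ [hd (act s [z])], word_section \<Gamma> \<X> act s z)"
        using usz s 1 by (intro normal_word_letter) auto
      moreover have "reduces (normal_word ((x # u) @ [hd (act s [z])], word_section \<Gamma> \<X> act s z))"
        using usz 1 act_letter(2)[OF s usz(3)] S_section[OF usz(2,3)] by (intro reduces_normal) auto
      ultimately have "reduces (normal_word (x # u, s) @ lt_word [z])" by (rule reduces_weq)
      then show "reduces (a # normal_word (u, s) @ lt_word [z])"
        by (simp add: normal_word_def 1)
    qed
  next
    case (2 x)
    show ?thesis
    proof (intro eventually_reduces_letter w(2) a)
      fix u s z assume usz: "u \<in> lists \<X>" "s \<in> S" "z \<in> \<X>"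
      then have s: "s \<in> carrier \<Gamma>" using S_sub by blast
      let ?u = "u @ [hd (act s [z])]" and ?s = "word_section \<Gamma> \<X> act s z"
      have "[a] @ (normal_word (u, s) @ lt_word [z]) \<asymp> [a] @ normal_word (?u, ?s)"
        using usz s a by (intro weq_prefix normal_word_letter) auto
      moreover have "reduces ([a] @ normal_word (?u, ?s))"
      proof -
        obtain y v where yv: "?u = y # v" by (cases ?u) auto
        have "?u \<in> lists \<X>" using usz(1) act_letter(2)[OF s usz(3)] by simp
        then have y: "y \<in> \<X>" "v \<in> lists \<X>" unfolding yv by auto
        have sS: "?s \<in> S" using S_section usz by blast
        then have nv: "normal_word (v, ?s) \<in> carrier W" using normal_word_carrier y S_sub by blast
        have eq: "[a] @ normal_word (?u, ?s) = [(Inl x, True), (Inl y, False)] @ normal_word (v, ?s)"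
          unfolding yv by (simp add: normal_word_def 2)
        show ?thesis
        proof (cases "x = y")
          case True
          then have "[(Inl x, True), (Inl y, False)] @ normal_word (v, ?s) \<asymp> [] @ normal_word (v, ?s)"
            using 2 y nv by (intro weq_suffix lt_star_lt(1)) auto
          then show ?thesis unfolding eq using reduces_weq reduces_normal[OF y(2) sS] by simp
        next
          case False
          then have "delta [(Inl x, True), (Inl y, False)] \<in> J" using 2 y lt_star_lt(2) by metis
          then have "delta ([(Inl x, True), (Inl y, False)] @ normal_word (v, ?s)) \<in> J"
            using W.J_delta_mult(2)[OF _ nv] by (metis W_simps(2))
          moreover have "[(Inl x, True), (Inl y, False)] @ normal_word (v, ?s) \<in> carrier W"
            using 2 y nv by (simp add: W_simps)
          ultimately show ?thesis unfolding eq by (intro reduces_zero)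
        qed
      qed
      ultimately show "reduces (a # normal_word (u, s) @ lt_word [z])"
        using reduces_weq by simp
    qed
  next
    case (3 g)
    then show ?thesis using eventually_reduces_group w by simp
  next
    case (4 g)
    have "[(Inr g, True)] @ w \<asymp> [(Inr (inv g), False)] @ w"
      using 4 w by (intro weq_suffix gr_star)
    moreover have "eventually_reduces ([(Inr (inv g), False)] @ w)"
      using 4 w eventually_reduces_group by simp
    ultimately show ?thesis using 4 eventually_reduces_weq by simp
  qed
qed

text \<open>Hence an element outside \<open>J\<close> has a right translate outside \<open>J\<close> of the form \<open>\<Sum> c\<^sub>u\<^sub>,\<^sub>s u s\<close>.\<close>

lemma normal_form_outside_J:
  assumes a: "a \<in> carrier W.F" "a \<notin> J"
  obtains v c where "v \<in> lists \<X>" "finite (supp c)" "supp c \<subseteq> lists \<X> \<times> S"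
    "lin_ext (\<lambda>w. w @ lt_word v) a \<notin> J"
    "(\<lambda>w. lin_ext (\<lambda>w. w @ lt_word v) a w - lin_ext normal_word c w) \<in> J"
proof -
  have fin: "finite (supp a)" and sub: "supp a \<subseteq> carrier W"
    using a by (auto simp: monoid_algebra_simps)
  have "\<forall>w \<in> supp a. \<exists>k. \<forall>v \<in> lists \<X>. length v \<ge> k \<longrightarrow> reduces (w @ lt_word v)"
    using eventually_reduces sub by (auto simp: eventually_reduces_def)
  then obtain k where k: "\<And>w v. w \<in> supp a \<Longrightarrow> v \<in> lists \<X> \<Longrightarrow> length v \<ge> k w \<Longrightarrow> reduces (w @ lt_word v)"
    by metis
  define n where "n = Max (insert 0 (k ` supp a))"
  have n: "k w \<le> n" if "w \<in> supp a" for w using fin that by (auto simp: n_def)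
  obtain v where v: "v \<in> lists \<X>" "length v = n" "lin_ext (\<lambda>w. w @ lt_word v) a \<notin> J"
    using in_J_if_translates[of a n] a by blast
  define Z where "Z = {w \<in> supp a. delta (w @ lt_word v) \<in> J}"
  have "\<forall>w \<in> supp a - Z. \<exists>p \<in> lists \<X> \<times> S. w @ lt_word v \<asymp> normal_word p"
    using k v n unfolding Z_def reduces_def by blast
  then obtain r where r: "\<And>w. w \<in> supp a - Z \<Longrightarrow> r w \<in> lists \<X> \<times> S"
    "\<And>w. w \<in> supp a - Z \<Longrightarrow> w @ lt_word v \<asymp> normal_word (r w)" by metis
  define a1 where "a1 = (\<lambda>w. if w \<in> Z then 0 else a w)"
  have a1: "supp a1 = supp a - Z" by (auto simp: a1_def supp_def)
  with fin have a1: "supp a1 = supp a - Z" "finite (supp a1)" by auto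
  have "(\<lambda>w. \<Sum>u\<in>Z. a u * delta (u @ lt_word v) w) \<in> J"
    using fin by (intro W.J_lincomb) (auto simp: Z_def)
  moreover have "(\<lambda>w. lin_ext (\<lambda>w. w @ lt_word v) a1 w - lin_ext (\<lambda>w. normal_word (r w)) a1 w) \<in> J"
    using a1 r by (intro W.weq_lin_ext) auto
  ultimately have "(\<lambda>w. (\<Sum>u\<in>Z. a u * delta (u @ lt_word v) w) +
      (lin_ext (\<lambda>w. w @ lt_word v) a1 w - lin_ext (\<lambda>w. normal_word (r w)) a1 w)) \<in> J"
    by (rule W.J_add)
  moreover have "(\<Sum>u\<in>Z. a u * delta (u @ lt_word v) w) + lin_ext (\<lambda>w. w @ lt_word v) a1 w
    = lin_ext (\<lambda>w. w @ lt_word v) a w" for w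
  proof -
    have "lin_ext (\<lambda>w. w @ lt_word v) a1 w = (\<Sum>u\<in>supp a - Z. a u * delta (u @ lt_word v) w)"
      using a1(2) unfolding lin_ext_eq_sum[OF a1(2) order.refl] unfolding a1(1)
      by (intro sum.cong) (auto simp: a1_def)
    then show ?thesis
      using sum.subset_diff[of Z "supp a" "\<lambda>u. a u * delta (u @ lt_word v) w"] fin
      by (simp add: lin_ext_eq_sum[OF fin order.refl] Z_def add.commute)
  qed
  ultimately have "(\<lambda>w. lin_ext (\<lambda>w. w @ lt_word v) a w - lin_ext normal_word (lin_ext r a1) w) \<in> J"
    using a1(2) by (simp add: lin_ext_comp add_diff_eq)
  moreover have "supp (lin_ext r a1) \<subseteq> lists \<X> \<times> S"
    using supp_lin_ext[of r a1] r(1) a1(1) by blast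
  ultimately show ?thesis
    using that[OF v(1) finite_supp_lin_ext[OF a1(2)] _ v(3)] by blast
qed

end

section \<open>A representation on functions of germs\<close>

text \<open>
  The linear functional with given values on the basis elements.
\<close>

definition evaluate :: "('a \<Rightarrow> 'k) \<Rightarrow> ('a \<Rightarrow> 'k) \<Rightarrow> 'k::field" where
  "evaluate h a = (\<Sum>w\<in>supp a. a w * h w)"

lemma evaluate_eq_sum:
  "finite A \<Longrightarrow> supp a \<subseteq> A \<Longrightarrow> evaluate h a = (\<Sum>w\<in>A. a w * h w)"
  unfolding evaluate_def by (rule sum.mono_neutral_left) (auto simp: supp_def)

lemma evaluate_delta: "evaluate h (delta v) = h v"
  by (simp add: evaluate_def supp_delta)

lemma evaluate_lin_ext: "finite (supp a) \<Longrightarrow> evaluate h (lin_ext l a) = evaluate (\<lambda>i. h (l i)) a"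
  unfolding evaluate_def by (rule sum_lin_ext)

lemma evaluate_diff:
  assumes "finite (supp a)" "finite (supp b)"
  shows "evaluate h (\<lambda>w. a w - b w) = evaluate h a - evaluate h b"
proof -
  obtain A where A: "finite A" "supp a \<subseteq> A" "supp b \<subseteq> A" "supp (\<lambda>w. a w - b w) \<subseteq> A"
  proof
    show "finite (supp a \<union> supp b)" using assms by simp
  qed (auto simp: supp_def)
  then show ?thesis by (simp add: evaluate_eq_sum[of A] left_diff_distrib sum_subtractf)
qed

lemma evaluate_add:
  assumes "finite (supp a)" "finite (supp b)"
  shows "evaluate h (\<lambda>w. a w + b w) = evaluate h a + evaluate h b"
proof -
  obtain A where A: "finite A" "supp a \<subseteq> A" "supp b \<subseteq> A" "supp (\<lambda>w. a w + b w) \<subseteq> A"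
    using assms supp_add[of a b] by (metis Un_upper1 Un_upper2 finite_UnI)
  then show ?thesis by (simp add: evaluate_eq_sum[of A] distrib_right sum.distrib)
qed

lemma finite_supp_sum_delta: "finite A \<Longrightarrow> finite (supp (\<lambda>w. \<Sum>x\<in>A. delta (l x) w :: 'k::field))"
  by (rule finite_subset[of _ "l ` A"]) (auto simp: supp_def delta_def intro!: sum.neutral)

lemma evaluate_sum_delta:
  assumes "finite A"
  shows "evaluate h (\<lambda>w. \<Sum>x\<in>A. delta (l x) w) = (\<Sum>x\<in>A. h (l x))"
proof -
  have sub: "supp (\<lambda>w. \<Sum>x\<in>A. delta (l x) w :: 'b) \<subseteq> l ` A"
    by (auto simp: supp_def delta_def intro!: sum.neutral)
  have "evaluate h (\<lambda>w. \<Sum>x\<in>A. delta (l x) w) = (\<Sum>w\<in>l ` A. \<Sum>x\<in>A. delta (l x) w * h w)"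
    using assms sub by (simp add: evaluate_eq_sum[of "l ` A"] sum_distrib_right)
  also have "\<dots> = (\<Sum>x\<in>A. \<Sum>w\<in>l ` A. delta (l x) w * h w)" by (rule sum.swap)
  also have "\<dots> = (\<Sum>x\<in>A. h (l x))"
  proof (intro sum.cong refl)
    fix x assume x: "x \<in> A"
    have "(\<Sum>w\<in>l ` A. delta (l x) w * h w) = (\<Sum>w\<in>l ` A. if w = l x then h w else 0)"
      by (intro sum.cong) (auto simp: delta_def)
    then show "(\<Sum>w\<in>l ` A. delta (l x) w * h w) = h (l x)" using assms x by simp
  qed
  finally show ?thesis .
qed

lemma evaluate_mult:
  assumes "finite (supp a)" "finite (supp b)"
  shows "evaluate h (a \<otimes>\<^bsub>monoid_algebra K M\<^esub> b) = evaluate (\<lambda>u. evaluate (\<lambda>v. h (u \<otimes>\<^bsub>M\<^esub> v)) b) a"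
proof -
  let ?A = "supp a" and ?B = "supp b" and ?C = "(\<lambda>(u, v). u \<otimes>\<^bsub>M\<^esub> v) ` (supp a \<times> supp b)"
  have "evaluate h (a \<otimes>\<^bsub>monoid_algebra K M\<^esub> b)
      = (\<Sum>w\<in>?C. (\<Sum>u\<in>?A. \<Sum>v\<in>?B. a u * b v * delta (u \<otimes>\<^bsub>M\<^esub> v) w) * h w)"
    using assms
    by (subst evaluate_eq_sum[OF _ supp_monoid_algebra_mult]) (simp_all add: monoid_algebra_mult[of ?A a ?B])
  also have "\<dots> = (\<Sum>w\<in>?C. \<Sum>u\<in>?A. \<Sum>v\<in>?B. a u * b v * (delta (u \<otimes>\<^bsub>M\<^esub> v) w * h w))"
    by (simp add: sum_distrib_right mult.assoc)
  also have "\<dots> = (\<Sum>u\<in>?A. \<Sum>w\<in>?C. \<Sum>v\<in>?B. a u * b v * (delta (u \<otimes>\<^bsub>M\<^esub> v) w * h w))"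
    by (rule sum.swap)
  also have "\<dots> = (\<Sum>u\<in>?A. \<Sum>v\<in>?B. \<Sum>w\<in>?C. a u * b v * (delta (u \<otimes>\<^bsub>M\<^esub> v) w * h w))"
    by (rule sum.cong[OF refl sum.swap])
  also have "\<dots> = (\<Sum>u\<in>?A. \<Sum>v\<in>?B. a u * b v * h (u \<otimes>\<^bsub>M\<^esub> v))"
  proof (rule sum.cong[OF refl sum.cong[OF refl]])
    fix u v assume "u \<in> ?A" "v \<in> ?B"
    then have uv: "u \<otimes>\<^bsub>M\<^esub> v \<in> ?C" by blast
    have "(\<Sum>w\<in>?C. a u * b v * (delta (u \<otimes>\<^bsub>M\<^esub> v) w * h w))
      = (\<Sum>w\<in>?C. if w = u \<otimes>\<^bsub>M\<^esub> v then a u * b v * h (u \<otimes>\<^bsub>M\<^esub> v) else 0)"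
      by (intro sum.cong) (auto simp: delta_def)
    also have "\<dots> = a u * b v * h (u \<otimes>\<^bsub>M\<^esub> v)"
      using uv assms by (simp only: sum.delta finite_cartesian_product finite_imageI if_True)
    finally show "(\<Sum>w\<in>?C. a u * b v * (delta (u \<otimes>\<^bsub>M\<^esub> v) w * h w)) = a u * b v * h (u \<otimes>\<^bsub>M\<^esub> v)" .
  qed
  finally show ?thesis by (simp add: evaluate_def sum_distrib_left mult.assoc)
qed

lemma word_star_word_star [simp]: "word_star (word_star w) = w"
  by (auto simp: word_star_def rev_map comp_def case_prod_beta)

lemma free_star_delta: "free_star (delta v) = (delta (word_star v) :: _ \<Rightarrow> 'k::field)"
  unfolding free_star_def delta_def by (metis word_star_word_star)

locale pointed_self_similar_group = self_similar_group \<Gamma> \<X> act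
  for \<Gamma> (structure) and \<X> :: "'x set" and act :: "'a \<Rightarrow> 'x list \<Rightarrow> 'x list" +
  fixes x0 :: 'x
  assumes x0: "x0 \<in> \<X>"
begin

interpretation \<Gamma>: group \<Gamma> by (rule group_\<Gamma>)

text \<open>
  \<open>P\<close> holds on all finite words that extend some fixed prefix of \<open>x0 x0 \<dots>\<close>: a neighbourhood of this point.
\<close>

definition ev :: "('x list \<Rightarrow> bool) \<Rightarrow> bool" where
  "ev P \<longleftrightarrow> (\<exists>n. \<forall>z \<in> lists \<X>. P (replicate n x0 @ z))"

lemma ev_mono: "ev P \<Longrightarrow> (\<And>i. P i \<Longrightarrow> Q i) \<Longrightarrow> ev Q"
  unfolding ev_def by blast

lemma ev_const [simp]: "ev (\<lambda>_. c) \<longleftrightarrow> c"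
  unfolding ev_def by (metis lists.Nil)

lemma ev_conj:
  assumes "ev P" "ev Q"
  shows "ev (\<lambda>i. P i \<and> Q i)"
proof -
  obtain m n where m: "\<And>z. z \<in> lists \<X> \<Longrightarrow> P (replicate m x0 @ z)"
    and n: "\<And>z. z \<in> lists \<X> \<Longrightarrow> Q (replicate n x0 @ z)"
    using assms unfolding ev_def by blast
  have r: "replicate k x0 @ z \<in> lists \<X>" if "z \<in> lists \<X>" for k z using that x0 by auto
  have "P (replicate (m + n) x0 @ z) \<and> Q (replicate (m + n) x0 @ z)" if "z \<in> lists \<X>" for z
    using m[OF r[OF that], of n] n[OF r[OF that], of m]
    by (metis append_assoc replicate_add add.commute)
  then show ?thesis by (auto simp: ev_def)
qed

lemma ev_mono2: "ev P \<Longrightarrow> ev Q \<Longrightarrow> (\<And>i. P i \<Longrightarrow> Q i \<Longrightarrow> S i) \<Longrightarrow> ev S"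
  using ev_mono[OF ev_conj] by blast

text \<open>
  Maps with a limit at the point \<open>x0 x0 \<dots>\<close>: every finite prefix of the value is eventually constant.
\<close>

definition germ :: "('x list \<Rightarrow> 'x list) \<Rightarrow> bool" where
  "germ F \<longleftrightarrow> (\<forall>m. \<exists>p \<in> lists \<X>. length p = m \<and> ev (\<lambda>i. F i \<in> lists \<X> \<and> take m (F i) = p))"

definition same_germ :: "('x list \<Rightarrow> 'x list) \<Rightarrow> ('x list \<Rightarrow> 'x list) \<Rightarrow> bool" where
  "same_germ F F' \<longleftrightarrow> ev (\<lambda>i. F i = F' i)"

definition same_point :: "('x list \<Rightarrow> 'x list) \<Rightarrow> ('x list \<Rightarrow> 'x list) \<Rightarrow> bool" where
  "same_point F F' \<longleftrightarrow> (\<forall>m. ev (\<lambda>i. take m (F i) = take m (F' i)))"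

definition starts_with :: "('x list \<Rightarrow> 'x list) \<Rightarrow> 'x \<Rightarrow> bool" where
  "starts_with F x \<longleftrightarrow> ev (\<lambda>i. take 1 (F i) = [x])"

lemma germ_lists: "germ F \<Longrightarrow> ev (\<lambda>i. F i \<in> lists \<X>)"
  unfolding germ_def using ev_mono by (metis (no_types, lifting))

lemma germ_Cons:
  assumes "germ F" "x \<in> \<X>"
  shows "germ (\<lambda>i. x # F i)"
  unfolding germ_def
proof
  fix m
  show "\<exists>p\<in>lists \<X>. length p = m \<and> ev (\<lambda>i. x # F i \<in> lists \<X> \<and> take m (x # F i) = p)"
  proof (cases m)
    case 0
    then show ?thesis using ev_mono[OF germ_lists[OF assms(1)]] assms(2) by auto
  next
    case (Suc n)
    obtain p where p: "p \<in> lists \<X>" "length p = n" "ev (\<lambda>i. F i \<in> lists \<X> \<and> take n (F i) = p)"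
      using assms(1) by (auto simp: germ_def)
    show ?thesis
      using p(1,2) assms(2) by (intro bexI[of _ "x # p"] conjI ev_mono[OF p(3)]) (auto simp: Suc)
  qed
qed

lemma germ_tl:
  assumes "germ F"
  shows "germ (\<lambda>i. tl (F i))"
  unfolding germ_def
proof
  fix m
  obtain p where p: "p \<in> lists \<X>" "length p = Suc m" "ev (\<lambda>i. F i \<in> lists \<X> \<and> take (Suc m) (F i) = p)"
    using assms by (auto simp: germ_def)
  have "tl v \<in> lists \<X> \<and> take m (tl v) = tl p" if "v \<in> lists \<X> \<and> take (Suc m) v = p" for v
    using that by (cases v) auto
  moreover have "tl p \<in> lists \<X>" "length (tl p) = m" using p by (cases p; simp)+
  ultimately show "\<exists>p\<in>lists \<X>. length p = m \<and> ev (\<lambda>i. tl (F i) \<in> lists \<X> \<and> take m (tl (F i)) = p)"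
    by (intro bexI[of _ "tl p"] conjI ev_mono[OF p(3)]) auto
qed

lemma germ_act:
  assumes "germ F" "g \<in> carrier \<Gamma>"
  shows "germ (\<lambda>i. act g (F i))"
  unfolding germ_def
proof
  fix m
  obtain p where p: "p \<in> lists \<X>" "length p = m" "ev (\<lambda>i. F i \<in> lists \<X> \<and> take m (F i) = p)"
    using assms by (auto simp: germ_def)
  show "\<exists>p\<in>lists \<X>. length p = m \<and> ev (\<lambda>i. act g (F i) \<in> lists \<X> \<and> take m (act g (F i)) = p)"
  proof (intro bexI[of _ "act g p"] conjI)
    show "ev (\<lambda>i. act g (F i) \<in> lists \<X> \<and> take m (act g (F i)) = act g p)"
      by (rule ev_mono[OF p(3)]) (use assms(2) act_closed take_act in metis)
  qed (use p assms(2) length_preserving act_closed in auto)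
qed

lemma germ_starts_with:
  assumes "germ F"
  obtains x where "x \<in> \<X>" "starts_with F x" "same_germ F (\<lambda>i. x # tl (F i))"
proof -
  obtain p where p: "p \<in> lists \<X>" "length p = 1" "ev (\<lambda>i. F i \<in> lists \<X> \<and> take 1 (F i) = p)"
    using assms by (metis germ_def)
  obtain x where x: "p = [x]" using p(2) by (cases p) auto
  have "v = x # tl v" if "take 1 v = [x]" for v using that by (cases v) auto
  then have "same_germ F (\<lambda>i. x # tl (F i))"
    unfolding same_germ_def using x by (intro ev_mono[OF p(3)]) auto
  moreover have "starts_with F x"
    unfolding starts_with_def using x by (intro ev_mono[OF p(3)]) auto
  ultimately show ?thesis using that p(1) x by auto
qed

lemma starts_with_unique: "starts_with F x \<Longrightarrow> starts_with F y \<Longrightarrow> x = y"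
proof -
  assume "starts_with F x" "starts_with F y"
  then have "ev (\<lambda>_. x = y)" unfolding starts_with_def by (rule ev_mono2) simp
  then show "x = y" by simp
qed

lemma starts_with_Cons [simp]: "starts_with (\<lambda>i. x # F i) y \<longleftrightarrow> x = y"
  by (simp add: starts_with_def)

text \<open>
  The points of the representation are germs at \<open>x0 x0 x0 \<dots>\<close> up to a relation that all operators respect:
  equality of germs, or equality of their values at the point.
\<close>

definition germ_congruence :: "(('x list \<Rightarrow> 'x list) \<Rightarrow> ('x list \<Rightarrow> 'x list) \<Rightarrow> bool) \<Rightarrow> bool" where
  "germ_congruence R \<longleftrightarrow>
     (\<forall>F F'. same_germ F F' \<longrightarrow> R F F') \<and>
     (\<forall>F F' x. R F F' \<longrightarrow> R (\<lambda>i. x # F i) (\<lambda>i. x # F' i)) \<and>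
     (\<forall>F F'. R F F' \<longrightarrow> R (\<lambda>i. tl (F i)) (\<lambda>i. tl (F' i))) \<and>
     (\<forall>F F' g. germ F \<and> germ F' \<and> g \<in> carrier \<Gamma> \<and> R F F' \<longrightarrow> R (\<lambda>i. act g (F i)) (\<lambda>i. act g (F' i))) \<and>
     (\<forall>F F' x. R F F' \<longrightarrow> starts_with F x = starts_with F' x)"

lemma same_germ_congruence: "germ_congruence same_germ"
  unfolding germ_congruence_def
proof (intro conjI allI impI)
  fix F F' :: "'x list \<Rightarrow> 'x list" and x
  assume "same_germ F F'"
  then have eq: "ev (\<lambda>i. F i = F' i)" by (simp add: same_germ_def)
  show "same_germ (\<lambda>i. x # F i) (\<lambda>i. x # F' i)" "same_germ (\<lambda>i. tl (F i)) (\<lambda>i. tl (F' i))"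
    unfolding same_germ_def by (rule ev_mono[OF eq], simp)+
  have "starts_with F x" if "ev (\<lambda>i. F i = F' i)" "starts_with F' x" for F F' :: "'x list \<Rightarrow> 'x list"
    using that unfolding starts_with_def by (rule ev_mono2) simp
  from this[OF eq] this[of F' F] eq show "starts_with F x = starts_with F' x"
    by (auto simp: eq_commute)
next
  fix F F' g assume "germ F \<and> germ F' \<and> g \<in> carrier \<Gamma> \<and> same_germ F F'"
  then have eq: "ev (\<lambda>i. F i = F' i)" by (simp add: same_germ_def)
  show "same_germ (\<lambda>i. act g (F i)) (\<lambda>i. act g (F' i))"
    unfolding same_germ_def by (rule ev_mono[OF eq]) simp
qed

lemma same_point_congruence: "germ_congruence same_point"
  unfolding germ_congruence_def
proof (intro conjI allI impI)
  fix F F' :: "'x list \<Rightarrow> 'x list" and x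
  show "same_point F F'" if "same_germ F F'"
    using that unfolding same_germ_def same_point_def by (auto intro: ev_mono)
  assume FF': "same_point F F'"
  show "same_point (\<lambda>i. x # F i) (\<lambda>i. x # F' i)"
    unfolding same_point_def
  proof
    fix m
    show "ev (\<lambda>i. take m (x # F i) = take m (x # F' i))"
      using FF' by (cases m) (auto simp: same_point_def)
  qed
  have "take m (tl u) = take m (tl v)" if "take (Suc m) u = take (Suc m) v" for m and u v :: "'x list"
    using that by (cases u; cases v) auto
  then show "same_point (\<lambda>i. tl (F i)) (\<lambda>i. tl (F' i))"
    using FF' unfolding same_point_def by (meson ev_mono)
  have "ev (\<lambda>i. take 1 (F i) = take 1 (F' i))" using FF' by (auto simp: same_point_def)
  then show "starts_with F x = starts_with F' x"
    unfolding starts_with_def by (intro iffI) (erule ev_mono2, assumption, simp)+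
next
  fix F F' g assume *: "germ F \<and> germ F' \<and> g \<in> carrier \<Gamma> \<and> same_point F F'"
  show "same_point (\<lambda>i. act g (F i)) (\<lambda>i. act g (F' i))"
    unfolding same_point_def
  proof
    fix m
    have "ev (\<lambda>i. F i \<in> lists \<X> \<and> F' i \<in> lists \<X>)" using * germ_lists ev_conj by blast
    moreover have "ev (\<lambda>i. take m (F i) = take m (F' i))" using * by (auto simp: same_point_def)
    ultimately show "ev (\<lambda>i. take m (act g (F i)) = take m (act g (F' i)))"
      by (rule ev_mono2) (use * take_act in metis)
  qed
qed

text \<open>
  A letter \<open>x\<close> acts on functions of germs by push-forward along \<open>F \<mapsto> x F\<close>, its adjoint by pull-back, and a group
  element \<open>g\<close> by push-forward along \<open>F \<mapsto> g F\<close>. The relations hold because every germ is \<open>x F\<close> for exactly one \<open>x\<close>.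
\<close>

fun letter_op :: "('x + 'a) \<times> bool \<Rightarrow> (('x list \<Rightarrow> 'x list) \<Rightarrow> 'k) \<Rightarrow> ('x list \<Rightarrow> 'x list) \<Rightarrow> 'k::field" where
  "letter_op (Inl x, False) f F = (if starts_with F x then f (\<lambda>i. tl (F i)) else 0)"
| "letter_op (Inl x, True) f F = f (\<lambda>i. x # F i)"
| "letter_op (Inr g, False) f F = f (\<lambda>i. act (inv g) (F i))"
| "letter_op (Inr g, True) f F = f (\<lambda>i. act g (F i))"

definition word_op where "word_op w f = foldr letter_op w f"

lemma word_op_simps [simp]: "word_op [] f = f" "word_op (a # w) f = letter_op a (word_op w f)"
  by (simp_all add: word_op_def)

lemma word_op_append: "word_op (v @ w) f = word_op v (word_op w f)"
  by (simp add: word_op_def)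

definition germ_invariant :: "(('x list \<Rightarrow> 'x list) \<Rightarrow> ('x list \<Rightarrow> 'x list) \<Rightarrow> bool) \<Rightarrow>
    (('x list \<Rightarrow> 'x list) \<Rightarrow> 'k::field) \<Rightarrow> bool" where
  "germ_invariant R f \<longleftrightarrow> (\<forall>F F'. germ F \<longrightarrow> germ F' \<longrightarrow> R F F' \<longrightarrow> f F = f F')"

abbreviation "W\<Gamma> \<equiv> star_words (Sum_Type.Plus \<X> (carrier \<Gamma>)) :: (('x + 'a) \<times> bool) list monoid"

lemma letter_cases:
  assumes "[a] \<in> carrier W\<Gamma>"
  obtains x where "a = (Inl x, False)" "x \<in> \<X>" | x where "a = (Inl x, True)" "x \<in> \<X>"
    | g where "a = (Inr g, False)" "g \<in> carrier \<Gamma>" | g where "a = (Inr g, True)" "g \<in> carrier \<Gamma>"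
  using assms by (cases a; cases "fst a"; cases "snd a") (auto simp: star_words_simps)

lemma germ_invariant_letter_op:
  assumes R: "germ_congruence R" and f: "germ_invariant R f" and a: "[a] \<in> carrier W\<Gamma>"
  shows "germ_invariant R (letter_op a f)"
  unfolding germ_invariant_def
proof (intro allI impI)
  fix F F' assume F: "germ F" "germ F'" "R F F'"
  have fD: "f F1 = f F2" if "germ F1" "germ F2" "R F1 F2" for F1 F2
    using f that by (simp add: germ_invariant_def)
  show "letter_op a f F = letter_op a f F'"
    using a
  proof (cases rule: letter_cases)
    case (1 x)
    have "starts_with F x = starts_with F' x" using R F(3) unfolding germ_congruence_def by blast
    moreover have "f (\<lambda>i. tl (F i)) = f (\<lambda>i. tl (F' i))"
      by (intro fD germ_tl F) (use R F(3) in \<open>unfold germ_congruence_def, blast\<close>)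
    ultimately show ?thesis by (simp add: 1)
  next
    case (2 x)
    have "f (\<lambda>i. x # F i) = f (\<lambda>i. x # F' i)"
      by (intro fD germ_Cons F 2) (use R F(3) in \<open>unfold germ_congruence_def, blast\<close>)
    then show ?thesis by (simp add: 2)
  next
    case (3 g)
    have g: "inv g \<in> carrier \<Gamma>" using 3 by simp
    have "f (\<lambda>i. act (inv g) (F i)) = f (\<lambda>i. act (inv g) (F' i))"
      by (intro fD germ_act F g) (use R F g in \<open>unfold germ_congruence_def, blast\<close>)
    then show ?thesis by (simp add: 3)
  next
    case (4 g)
    have "f (\<lambda>i. act g (F i)) = f (\<lambda>i. act g (F' i))"
      by (intro fD germ_act F 4) (use R F 4 in \<open>unfold germ_congruence_def, blast\<close>)
    then show ?thesis by (simp add: 4)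
  qed
qed

lemma germ_invariant_word_op:
  "germ_congruence R \<Longrightarrow> germ_invariant R f \<Longrightarrow> w \<in> carrier W\<Gamma> \<Longrightarrow> germ_invariant R (word_op w f)"
  by (induction w) (auto intro: germ_invariant_letter_op simp: star_words_simps)

lemma word_op_linear:
  "word_op w (\<lambda>F. \<Sum>i\<in>A. c i * h i F) F = (\<Sum>i\<in>A. c i * word_op w (h i) F)"
proof (induction w arbitrary: F)
  case (Cons a w)
  then have "word_op w (\<lambda>F. \<Sum>i\<in>A. c i * h i F) = (\<lambda>F. \<Sum>i\<in>A. c i * word_op w (h i) F)" by blast
  then show ?case by (cases a; cases "fst a"; cases "snd a") auto
qed simp

text \<open>
  The functions are defined on all maps, but only their values on germs matter.
\<close>

lemma word_op_vanishing:
  assumes "\<And>F. germ F \<Longrightarrow> f F = 0" "germ F" "w \<in> carrier W\<Gamma>"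
  shows "word_op w f F = 0"
  using assms(2,3)
proof (induction w arbitrary: F)
  case (Cons a w)
  then have a: "[a] \<in> carrier W\<Gamma>" and IH: "\<And>F. germ F \<Longrightarrow> word_op w f F = 0"
    by (auto simp: star_words_simps)
  from a show ?case
    by (cases rule: letter_cases) (use Cons.prems IH in \<open>simp_all add: germ_tl germ_Cons germ_act\<close>)
qed (simp add: assms)

definition germ_annihilator ::
  "(('x list \<Rightarrow> 'x list) \<Rightarrow> ('x list \<Rightarrow> 'x list) \<Rightarrow> bool) \<Rightarrow> ((('x + 'a) \<times> bool) list \<Rightarrow> 'k::field) set" where
  "germ_annihilator R = {a \<in> carrier (monoid_algebra TYPE('k) W\<Gamma>).
     \<forall>f F. germ_invariant R f \<longrightarrow> germ F \<longrightarrow> evaluate (\<lambda>w. word_op w f F) a = 0}"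

lemma germ_annihilator_ideal:
  assumes R: "germ_congruence R"
  shows "ideal (germ_annihilator R) (monoid_algebra TYPE('k::field) W\<Gamma>)"
proof -
  let ?F = "monoid_algebra TYPE('k) W\<Gamma>"
  interpret W: monoid W\<Gamma> by (rule star_words_monoid)
  interpret F: ring ?F by (rule W.monoid_algebra_ring)
  let ?A = "germ_annihilator R :: ((('x + 'a) \<times> bool) list \<Rightarrow> 'k) set"
  have sub: "?A \<subseteq> carrier ?F" by (auto simp: germ_annihilator_def)
  have fin: "finite (supp a)" "supp a \<subseteq> carrier W\<Gamma>" if "a \<in> carrier ?F" for a :: "_ \<Rightarrow> 'k"
    using that by (auto simp: monoid_algebra_simps)
  have AD: "evaluate (\<lambda>w. word_op w f F) a = 0" if "a \<in> ?A" "germ_invariant R f" "germ F" for a f F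
    using that by (simp add: germ_annihilator_def)
  have resp: "germ_invariant R (\<lambda>F. evaluate (\<lambda>w. word_op w f F) a)"
    if "a \<in> carrier ?F" "germ_invariant R f" for a :: "_ \<Rightarrow> 'k" and f
    unfolding germ_invariant_def
  proof (intro allI impI)
    fix F F' assume "germ F" "germ F'" "R F F'"
    then have "word_op w f F = word_op w f F'" if "w \<in> supp a" for w
      using germ_invariant_word_op[OF R \<open>germ_invariant R f\<close>, of w] fin(2)[OF \<open>a \<in> carrier ?F\<close>] that
      unfolding germ_invariant_def by blast
    then show "evaluate (\<lambda>w. word_op w f F) a = evaluate (\<lambda>w. word_op w f F') a"
      by (simp add: evaluate_def)
  qed
  have comp: "evaluate (\<lambda>w. word_op w f F) (a \<otimes>\<^bsub>?F\<^esub> b)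
      = evaluate (\<lambda>u. word_op u (\<lambda>F. evaluate (\<lambda>v. word_op v f F) b) F) a"
    if "a \<in> carrier ?F" "b \<in> carrier ?F" for a b :: "_ \<Rightarrow> 'k" and f F
    using fin that by (simp add: evaluate_mult star_words_simps word_op_append)
      (simp add: evaluate_def word_op_linear)
  show ?thesis
  proof (rule idealI)
    show "subgroup ?A (add_monoid ?F)"
    proof (rule F.add.subgroupI)
      show "?A \<subseteq> carrier ?F" by (rule sub)
      have "(\<lambda>_. 0) \<in> ?A" by (auto simp: germ_annihilator_def monoid_algebra_simps evaluate_def)
      then show "?A \<noteq> {}" by blast
      fix a b assume a: "a \<in> ?A" and b: "b \<in> ?A"
      then have c: "a \<in> carrier ?F" "b \<in> carrier ?F" using sub by auto
      have "\<ominus>\<^bsub>?F\<^esub> a = (\<lambda>w. 0 - a w)"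
        using W.monoid_algebra_minus[of "\<zero>\<^bsub>?F\<^esub>" "TYPE('k)" a] c
        by (simp add: monoid_algebra_simps a_minus_def)
      moreover have "\<dots> \<in> ?A"
        using a F.a_inv_closed[OF c(1)] AD[OF a] c fin calculation
        by (auto simp: germ_annihilator_def evaluate_diff[of "\<lambda>_. 0", simplified] evaluate_def[of _ "\<lambda>_. 0"])
      ultimately show "\<ominus>\<^bsub>?F\<^esub> a \<in> ?A" by simp
      show "a \<oplus>\<^bsub>?F\<^esub> b \<in> ?A"
        using F.a_closed[OF c] AD[OF a] AD[OF b] c fin
        by (auto simp: germ_annihilator_def monoid_algebra_simps(4) evaluate_add)
    qed
  next
    fix a x assume a: "a \<in> ?A" and x: "x \<in> carrier ?F"
    then have c: "a \<in> carrier ?F" using sub by auto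
    have "evaluate (\<lambda>w. word_op w f F) (x \<otimes>\<^bsub>?F\<^esub> a) = 0" if "germ_invariant R f" "germ F" for f F
    proof -
      have "word_op u (\<lambda>F. evaluate (\<lambda>v. word_op v f F) a) F = 0" if "u \<in> supp x" for u
        using AD[OF a \<open>germ_invariant R f\<close>] \<open>germ F\<close> fin(2)[OF x] that by (intro word_op_vanishing) auto
      then show ?thesis unfolding comp[OF x c] by (simp add: evaluate_def)
    qed
    then show "x \<otimes>\<^bsub>?F\<^esub> a \<in> ?A" using F.m_closed[OF x c] by (simp add: germ_annihilator_def)
    have "evaluate (\<lambda>w. word_op w f F) (a \<otimes>\<^bsub>?F\<^esub> x) = 0" if "germ_invariant R f" "germ F" for f F
      unfolding comp[OF c x] using AD[OF a resp[OF x that(1)] that(2)] .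
    then show "a \<otimes>\<^bsub>?F\<^esub> x \<in> ?A" using F.m_closed[OF c x] by (simp add: germ_annihilator_def)
  qed (rule F.ring_axioms)
qed

end

lemma delta_append: "delta v \<otimes>\<^bsub>free_star_algebra K S\<^esub> delta w = delta (v @ w)"
  by (simp add: delta_mult supp_delta lin_ext_delta star_words_simps)

lemma free_star_algebra_minus:
  assumes "finite (supp a)" "supp a \<subseteq> lists (S \<times> UNIV)" "finite (supp b)" "supp b \<subseteq> lists (S \<times> UNIV)"
  shows "a \<ominus>\<^bsub>free_star_algebra K S\<^esub> b = (\<lambda>w. a w - b w)"
  using assms by (intro monoid.monoid_algebra_minus star_words_monoid) (auto simp: monoid_algebra_simps star_words_simps)

lemma free_star_algebra_delta_minus:
  "v \<in> lists (S \<times> UNIV) \<Longrightarrow> w \<in> lists (S \<times> UNIV) \<Longrightarrow>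
    delta v \<ominus>\<^bsub>free_star_algebra K S\<^esub> delta w = (\<lambda>u. delta v u - delta w u)"
  by (intro free_star_algebra_minus) (auto simp: supp_delta)

context self_similar_group
begin

text \<open>
  The defining relations between words; the others are \<open>y\<^sup>* x = 0\<close> for \<open>x \<noteq> y\<close> and \<open>\<Sum> x x\<^sup>* = 1\<close>.
\<close>

inductive word_relation :: "(('x + 'a) \<times> bool) list \<Rightarrow> (('x + 'a) \<times> bool) list \<Rightarrow> bool" where
  one: "word_relation [(Inr \<one>, False)] []"
| star: "g \<in> carrier \<Gamma> \<Longrightarrow> word_relation [(Inr g, True)] [(Inr (inv g), False)]"
| mult: "g \<in> carrier \<Gamma> \<Longrightarrow> h \<in> carrier \<Gamma> \<Longrightarrow>
    word_relation [(Inr g, False), (Inr h, False)] [(Inr (g \<otimes> h), False)]"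
| letter: "g \<in> carrier \<Gamma> \<Longrightarrow> x \<in> \<X> \<Longrightarrow> word_relation [(Inr g, False), (Inl x, False)]
    [(Inl (hd (act g [x])), False), (Inr (word_section \<Gamma> \<X> act g x), False)]"
| cancel: "x \<in> \<X> \<Longrightarrow> word_relation [(Inl x, True), (Inl x, False)] []"

lemma word_relation_carrier:
  assumes "word_relation v w"
  shows "v \<in> lists (Sum_Type.Plus \<X> (carrier \<Gamma>) \<times> UNIV)" "w \<in> lists (Sum_Type.Plus \<X> (carrier \<Gamma>) \<times> UNIV)"
proof -
  interpret \<Gamma>: group \<Gamma> by (rule group_\<Gamma>)
  show "v \<in> lists (Sum_Type.Plus \<X> (carrier \<Gamma>) \<times> UNIV)" "w \<in> lists (Sum_Type.Plus \<X> (carrier \<Gamma>) \<times> UNIV)"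
    using assms by (cases; auto simp: act_letter(2) word_section(1))+
qed

lemma nekrashevych_relator_cases:
  assumes "r \<in> nekrashevych_relators TYPE('k::field) \<Gamma> \<X> act"
  obtains v w where "word_relation v w" "r = (\<lambda>u. delta v u - delta w u)"
  | x y where "x \<in> \<X>" "y \<in> \<X>" "x \<noteq> y" "r = delta [(Inl y, True), (Inl x, False)]"
  | "r = (\<lambda>u. (\<Sum>x\<in>\<X>. delta [(Inl x, False), (Inl x, True)] u) - delta [] u)"
proof -
  note goal_cases = that
  let ?S = "Sum_Type.Plus \<X> (carrier \<Gamma>)"
  let ?F = "free_star_algebra TYPE('k) ?S"
  have one: "\<one>\<^bsub>?F\<^esub> = delta []" "\<zero>\<^bsub>?F\<^esub> = (\<lambda>_. 0)" by (simp_all add: monoid_algebra_simps star_words_simps)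
  have rel: thesis if "r = delta v \<ominus>\<^bsub>?F\<^esub> delta w" "word_relation v w" for v w
    using that(2) by (rule goal_cases(1)) (use that word_relation_carrier[OF that(2)] in \<open>simp add: free_star_algebra_delta_minus\<close>)
  let ?s = "\<Oplus>\<^bsub>?F\<^esub>x\<in>\<X>. delta [(Inl x, False), (Inl x, True)]"
  from assms consider "r = delta [(Inr \<one>, False)] \<ominus>\<^bsub>?F\<^esub> delta []"
    | g where "g \<in> carrier \<Gamma>" "r = delta [(Inr g, True)] \<ominus>\<^bsub>?F\<^esub> delta [(Inr (inv g), False)]"
    | g h where "g \<in> carrier \<Gamma>" "h \<in> carrier \<Gamma>"
        "r = delta [(Inr g, False), (Inr h, False)] \<ominus>\<^bsub>?F\<^esub> delta [(Inr (g \<otimes> h), False)]"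
    | g x where "g \<in> carrier \<Gamma>" "x \<in> \<X>" "r = delta [(Inr g, False), (Inl x, False)] \<ominus>\<^bsub>?F\<^esub>
        delta [(Inl (hd (act g [x])), False), (Inr (word_section \<Gamma> \<X> act g x), False)]"
    | x y where "x \<in> \<X>" "y \<in> \<X>"
        "r = delta [(Inl y, True), (Inl x, False)] \<ominus>\<^bsub>?F\<^esub> (if x = y then delta [] else (\<lambda>_. 0))"
    | "r = ?s \<ominus>\<^bsub>?F\<^esub> delta []"
    unfolding nekrashevych_relators_def Let_def delta_append append.simps one by blast
  then show thesis
  proof cases
    case 1 then show ?thesis by (rule rel) (rule word_relation.one)
  next
    case 2 then show ?thesis using rel word_relation.star by blast
  next
    case 3 then show ?thesis using rel word_relation.mult by blast
  next
    case 4 then show ?thesis using rel word_relation.letter by blast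
  next
    case (5 x y)
    show ?thesis
    proof (cases "x = y")
      case True
      then show ?thesis using rel 5 word_relation.cancel by simp
    next
      case False
      moreover have "r = delta [(Inl y, True), (Inl x, False)]"
        using 5 False by (simp add: free_star_algebra_minus supp_delta)
      ultimately show ?thesis using goal_cases(2) 5 by blast
    qed
  next
    case 6
    have "?s = (\<lambda>u. \<Sum>x\<in>\<X>. delta [(Inl x, False), (Inl x, True)] u)"
      by (intro monoid.monoid_algebra_finsum star_words_monoid finite_X)
        (auto simp: monoid_algebra_simps star_words_simps supp_delta)
    moreover have "supp (\<lambda>u. \<Sum>x\<in>\<X>. delta [(Inl x, False), (Inl x, True)] u :: 'k) \<subseteq> lists (?S \<times> UNIV)"
    proof
      fix u :: "(('x + 'a) \<times> bool) list"
      assume "u \<in> supp (\<lambda>u. \<Sum>x\<in>\<X>. delta [(Inl x, False), (Inl x, True)] u :: 'k)"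
      then obtain x where "x \<in> \<X>" "delta [(Inl x, False), (Inl x, True)] u \<noteq> (0 :: 'k)"
        unfolding supp_def by (metis (mono_tags, lifting) mem_Collect_eq sum.neutral)
      then show "u \<in> lists (?S \<times> UNIV)" by (auto simp: delta_def split: if_splits)
    qed
    ultimately have "r = (\<lambda>u. (\<Sum>x\<in>\<X>. delta [(Inl x, False), (Inl x, True)] u) - delta [] u)"
      unfolding 6 by (simp only:, intro free_star_algebra_minus finite_supp_sum_delta finite_X)
        (simp_all add: supp_delta)
    then show ?thesis by (rule goal_cases(3))
  qed
qed

end

context pointed_self_similar_group
begin

interpretation \<Gamma>: group \<Gamma> by (rule group_\<Gamma>)

text \<open>
  The function only depends on germs, so each relation may be checked near the point, where \<open>F\<close> has a fixed
  first letter. The adjoint relations are needed because the algebra is presented as a \<open>*\<close>-algebra.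
\<close>

lemma word_op_relation:
  assumes R: "germ_congruence R" and f: "germ_invariant R f" and F: "germ F" and vw: "word_relation v w"
  shows "word_op v f F = word_op w f F \<and> word_op (word_star v) f F = word_op (word_star w) f F"
proof -
  have fD: "f F1 = f F2" if "germ F1" "germ F2" "same_germ F1 F2" for F1 F2
    using f R that by (simp add: germ_invariant_def germ_congruence_def)
  have eq: "f F1 = f F2" if "germ F1" "germ F2" "\<And>i. F i \<in> lists \<X> \<Longrightarrow> F1 i = F2 i" for F1 F2
  proof (rule fD[OF that(1,2)])
    show "same_germ F1 F2"
      unfolding same_germ_def by (rule ev_mono[OF germ_lists[OF F] that(3)])
  qed
  from vw show ?thesis
  proof cases
    case one
    have "f (\<lambda>i. act \<one> (F i)) = f F" by (intro eq germ_act F act_one) auto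
    then show ?thesis by (simp add: one word_star_def)
  next
    case (star g)
    then show ?thesis by (simp add: word_star_def)
  next
    case (mult g h)
    have "f (\<lambda>i. act (inv h) (act (inv g) (F i))) = f (\<lambda>i. act (inv (g \<otimes> h)) (F i))"
      using mult by (intro eq germ_act F) (auto simp: \<Gamma>.inv_mult_group act_mult)
    moreover have "f (\<lambda>i. act g (act h (F i))) = f (\<lambda>i. act (g \<otimes> h) (F i))"
      using mult by (intro eq germ_act F) (auto simp: act_mult)
    ultimately show ?thesis by (simp add: mult word_star_def)
  next
    case (letter g x)
    let ?y = "hd (act g [x])" and ?s = "word_section \<Gamma> \<X> act g x"
    have y: "?y \<in> \<X>" and s: "?s \<in> carrier \<Gamma>"
      using letter act_letter(2) word_section(1) by auto
    have gx: "act g (x # u) = ?y # act ?s u" if "u \<in> lists \<X>" for u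
      using act_Cons letter that by blast
    \<comment> \<open>The inverse of \<open>g\<close> undoes the previous step.\<close>
    have gy: "act (inv g) (?y # u) = x # act (inv ?s) u" if u: "u \<in> lists \<X>" for u
    proof -
      have u': "act (inv ?s) u \<in> lists \<X>" using act_closed s u by simp
      have "act g (x # act (inv ?s) u) = ?y # u"
        unfolding gx[OF u'] using act_inv(2)[OF s u] by simp
      then show ?thesis
        using act_inv(1)[of g "x # act (inv ?s) u"] letter u' by simp
    qed
    have "f (\<lambda>i. act g (x # F i)) = f (\<lambda>i. ?y # act ?s (F i))"
      using letter y s by (intro eq germ_act germ_Cons F gx)
    then have 2: "word_op (word_star v) f F = word_op (word_star w) f F"
      by (simp add: letter word_star_def)
    let ?F' = "\<lambda>i. act (inv g) (F i)"
    have F': "germ ?F'" using letter by (intro germ_act F) auto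
    obtain z where z: "z \<in> \<X>" "starts_with F z" "same_germ F (\<lambda>i. z # tl (F i))"
      using germ_starts_with[OF F] .
    have evF: "ev (\<lambda>i. F i = z # tl (F i) \<and> tl (F i) \<in> lists \<X>)"
      using ev_conj[OF z(3)[unfolded same_germ_def] germ_lists[OF germ_tl[OF F]]] .
    have 1: "word_op v f F = word_op w f F"
    proof (cases "z = ?y")
      case True
      have ev': "ev (\<lambda>i. ?F' i = x # act (inv ?s) (tl (F i)))"
        by (rule ev_mono[OF evF]) (use gy True in metis)
      have "starts_with ?F' x"
        unfolding starts_with_def by (rule ev_mono[OF ev']) simp
      moreover have "f (\<lambda>i. tl (?F' i)) = f (\<lambda>i. act (inv ?s) (tl (F i)))"
        using s by (intro fD germ_tl F' germ_act F)
          (auto simp: same_germ_def intro: ev_mono[OF ev'])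
      ultimately show ?thesis using z True by (simp add: letter)
    next
      case False
      have "\<not> starts_with ?F' x"
      proof
        assume "starts_with ?F' x"
        moreover have "ev (\<lambda>i. ?F' i \<in> lists \<X> \<and> F i \<in> lists \<X>)"
          using ev_conj germ_lists F F' by blast
        ultimately have "ev (\<lambda>i. take 1 (F i) = [?y])"
          unfolding starts_with_def
        proof (rule ev_mono2)
          fix i assume i: "take 1 (?F' i) = [x]" "?F' i \<in> lists \<X> \<and> F i \<in> lists \<X>"
          then obtain t where t: "?F' i = x # t" by (cases "?F' i") auto
          then have "F i = act g (x # t)" using act_inv(2)[of g "F i"] i(2) letter by simp
          then show "take 1 (F i) = [?y]" using gx[of t] t i by simp
        qed
        then show False using starts_with_unique z(2) False by (auto simp: starts_with_def)
      qed
      moreover have "\<not> starts_with F ?y" using starts_with_unique z(2) False by blast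
      ultimately show ?thesis by (simp add: letter)
    qed
    from 1 2 show ?thesis by simp
  next
    case (cancel x)
    then show ?thesis by (simp add: word_star_def)
  qed
qed

lemma germ_annihilator_relators:
  assumes R: "germ_congruence R"
  shows "nekrashevych_relators TYPE('k::field) \<Gamma> \<X> act \<union> free_star ` nekrashevych_relators TYPE('k) \<Gamma> \<X> act
    \<subseteq> germ_annihilator R"
proof -
  let ?A = "germ_annihilator R :: ((('x + 'a) \<times> bool) list \<Rightarrow> 'k) set"
  have diff: "(\<lambda>u. delta v u - delta w u) \<in> ?A"
    if "v \<in> carrier W\<Gamma>" "w \<in> carrier W\<Gamma>"
      "\<And>f F. germ_invariant R f \<Longrightarrow> germ F \<Longrightarrow> word_op v f F = (word_op w f F :: 'k)" for v w
  proof -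
    have "supp (\<lambda>u. delta v u - delta w u :: 'k) \<subseteq> {v, w}" by (auto simp: supp_def delta_def)
    then have "(\<lambda>u. delta v u - delta w u :: 'k) \<in> carrier (monoid_algebra TYPE('k) W\<Gamma>)"
      using that(1,2) by (auto simp: monoid_algebra_simps intro: finite_subset)
    then show ?thesis
      using that(3) by (simp add: germ_annihilator_def evaluate_diff supp_delta evaluate_delta)
  qed
  have zero: "delta v \<in> ?A"
    if "v \<in> carrier W\<Gamma>" "\<And>f F. germ_invariant R f \<Longrightarrow> germ F \<Longrightarrow> word_op v f F = (0 :: 'k)" for v
    using that by (simp add: germ_annihilator_def monoid_algebra_simps supp_delta evaluate_delta)
  have star_carrier: "word_star v \<in> carrier W\<Gamma>" if "v \<in> carrier W\<Gamma>" for v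
    using that by (fastforce simp: word_star_def star_words_simps)
  let ?s = "\<lambda>u :: (('x + 'a) \<times> bool) list. (\<Sum>x\<in>\<X>. delta [(Inl x, False), (Inl x, True)] u) - delta [] u :: 'k"
  have s_star: "free_star ?s = ?s"
  proof
    fix u :: "(('x + 'a) \<times> bool) list"
    have d: "delta v (word_star u) = (delta (word_star v) u :: 'k)" for v :: "(('x + 'a) \<times> bool) list"
      using free_star_delta[of v, where ?'k = 'k] by (metis free_star_def)
    show "free_star ?s u = ?s u" by (simp add: free_star_def d) (simp add: word_star_def)
  qed
  have s: "?s \<in> ?A"
  proof -
    let ?B = "insert [] ((\<lambda>x. [(Inl x, False), (Inl x, True)]) ` \<X>)"
    have B: "supp ?s \<subseteq> ?B"
      by (auto simp: supp_def delta_def split: if_splits intro!: sum.neutral)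
    have "finite ?B" "?B \<subseteq> carrier W\<Gamma>" using finite_X by (auto simp: star_words_simps)
    then have "?s \<in> carrier (monoid_algebra TYPE('k) W\<Gamma>)"
      unfolding monoid_algebra_simps mem_Collect_eq
      by (intro conjI finite_subset[OF B] subset_trans[OF B])
    moreover have "evaluate (\<lambda>w. word_op w f F) ?s = 0" if f: "germ_invariant R f" and F: "germ F" for f F
    proof -
      obtain z where z: "z \<in> \<X>" "starts_with F z" "same_germ F (\<lambda>i. z # tl (F i))"
        using germ_starts_with[OF F] .
      have "(\<Sum>x\<in>\<X>. word_op [(Inl x, False), (Inl x, True)] f F)
          = (\<Sum>x\<in>\<X>. if x = z then f (\<lambda>i. z # tl (F i)) else 0)"
        using z(2) starts_with_unique by (intro sum.cong) auto
      also have "\<dots> = f (\<lambda>i. z # tl (F i))" using z(1) finite_X by simp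
      also have "\<dots> = f F"
      proof -
        have "R F (\<lambda>i. z # tl (F i))" using R z(3) unfolding germ_congruence_def by blast
        moreover have "germ (\<lambda>i. z # tl (F i))" by (intro germ_Cons germ_tl F z(1))
        ultimately show ?thesis using f F unfolding germ_invariant_def by metis
      qed
      finally show ?thesis
        by (simp add: evaluate_diff finite_supp_sum_delta finite_X supp_delta evaluate_sum_delta evaluate_delta)
    qed
    ultimately show ?thesis by (simp add: germ_annihilator_def)
  qed
  have "r \<in> ?A \<and> free_star r \<in> ?A" if "r \<in> nekrashevych_relators TYPE('k) \<Gamma> \<X> act" for r
    using that
  proof (cases rule: nekrashevych_relator_cases)
    case (1 v w)
    have c: "v \<in> carrier W\<Gamma>" "w \<in> carrier W\<Gamma>"
      using word_relation_carrier[OF 1(1)] by (simp_all add: star_words_simps)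
    have "free_star r = (\<lambda>u. delta (word_star v) u - delta (word_star w) u)"
      using free_star_delta[of v, where ?'k = 'k] free_star_delta[of w, where ?'k = 'k]
      unfolding 1(2) free_star_def by metis
    then show ?thesis
      using word_op_relation[OF R _ _ 1(1)] c by (auto simp: 1(2) intro!: diff star_carrier)
  next
    case (2 x y)
    have "free_star r = delta [(Inl x, True), (Inl y, False)]"
      unfolding 2(4) by (simp add: free_star_delta word_star_def)
    then show ?thesis using 2 by (auto intro!: zero simp: star_words_simps)
  next
    case 3
    then show ?thesis using s s_star by simp
  qed
  then show ?thesis by blast
qed

end

section \<open>Multispinal groups\<close>

context multispinal_data
begin

lemma group_H: "group H"
  using H.group_hom by (simp add: group_hom_def)

interpretation H': group H by (rule group_H)

lemma act_H:
  "h \<in> carrier H \<Longrightarrow> x \<in> \<X> \<Longrightarrow> act h x \<in> \<X>"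
  "x \<in> \<X> \<Longrightarrow> act \<one>\<^bsub>H\<^esub> x = x"
  "h \<in> carrier H \<Longrightarrow> k \<in> carrier H \<Longrightarrow> x \<in> \<X> \<Longrightarrow> act (h \<otimes>\<^bsub>H\<^esub> k) x = act h (act k x)"
  subgoal by (rule H.element_image) auto
  subgoal using H.id_eq_one by (metis restrict_apply')
  subgoal by (rule H.composition_rule)
  done

lemma act_H_fixed: "h \<in> carrier H \<Longrightarrow> x \<in> \<X> \<Longrightarrow> act h x = x \<Longrightarrow> h = \<one>\<^bsub>H\<^esub>"
  using free[of x] by (auto simp: stabilizer_def)

lemma act_H_inj:
  assumes "h \<in> carrier H" "k \<in> carrier H" "x \<in> \<X>" "act h x = act k x"
  shows "h = k"
proof -
  have "act (inv\<^bsub>H\<^esub> k \<otimes>\<^bsub>H\<^esub> h) x = act (inv\<^bsub>H\<^esub> k \<otimes>\<^bsub>H\<^esub> k) x"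
    using assms act_H(3)[of "inv\<^bsub>H\<^esub> k" h x] act_H(3)[of "inv\<^bsub>H\<^esub> k" k x] by simp
  then have "inv\<^bsub>H\<^esub> k \<otimes>\<^bsub>H\<^esub> h = \<one>\<^bsub>H\<^esub>"
    using assms by (intro act_H_fixed[of _ x]) (simp_all add: act_H)
  then have "inv\<^bsub>H\<^esub> h = inv\<^bsub>H\<^esub> k" using assms by (intro H'.inv_equality) auto
  then show ?thesis using assms by (metis H'.inv_inv)
qed

lemma letter_type_cases:
  assumes "x \<in> \<X>"
  obtains \<alpha> where "\<Phi> x = Inl \<alpha>" "\<alpha> \<in> spinal_aut \<X> \<Phi>" "\<alpha> \<in> auto G"
    | l where "\<Phi> x = Inr l" "l \<in> spinal_hom \<X> \<Phi>" "l \<in> hom G H"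
proof -
  have "\<Phi> x \<in> auto G <+> hom G H" using \<Phi>_type assms by blast
  then show ?thesis
    using that assms by (force simp: spinal_aut_def spinal_hom_def)
qed

lemma spinal_aut_auto: "spinal_aut \<X> \<Phi> \<subseteq> auto G"
  using \<Phi>_type by (auto simp: spinal_aut_def Pi_iff image_iff)

lemma spinal_hom_hom: "spinal_hom \<X> \<Phi> \<subseteq> hom G H"
  using \<Phi>_type by (auto simp: spinal_hom_def Pi_iff image_iff)

lemma X_nonempty: "\<X> \<noteq> {}"
  using S1 by (auto simp: spinal_aut_def)

lemma card_X: "card \<X> \<ge> 2"
proof -
  obtain \<alpha> where "Inl \<alpha> \<in> \<Phi> ` \<X>" using S1 unfolding spinal_aut_def by blast
  then obtain x where x: "x \<in> \<X>" "\<Phi> x = Inl \<alpha>" by (metis imageE)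
  obtain l where "Inr l \<in> \<Phi> ` \<X>" using S2 unfolding spinal_hom_def by blast
  then obtain y where y: "y \<in> \<X>" "\<Phi> y = Inr l" by (metis imageE)
  have "card {x, y} \<le> card \<X>" using x y finite_X by (intro card_mono) auto
  moreover have "x \<noteq> y" using x y by auto
  ultimately show ?thesis by simp
qed

lemma auto_hom:
  assumes "\<alpha> \<in> auto G"
  shows "g \<in> carrier G \<Longrightarrow> \<alpha> g \<in> carrier G"
    "g \<in> carrier G \<Longrightarrow> h \<in> carrier G \<Longrightarrow> \<alpha> (g \<otimes>\<^bsub>G\<^esub> h) = \<alpha> g \<otimes>\<^bsub>G\<^esub> \<alpha> h"
    "\<alpha> \<one>\<^bsub>G\<^esub> = \<one>\<^bsub>G\<^esub>" "inj_on \<alpha> (carrier G)"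
proof -
  have "\<alpha> \<in> hom G G" "bij_betw \<alpha> (carrier G) (carrier G)" using assms by (auto simp: auto_def Bij_def)
  then show "g \<in> carrier G \<Longrightarrow> \<alpha> g \<in> carrier G"
    "g \<in> carrier G \<Longrightarrow> h \<in> carrier G \<Longrightarrow> \<alpha> (g \<otimes>\<^bsub>G\<^esub> h) = \<alpha> g \<otimes>\<^bsub>G\<^esub> \<alpha> h"
    "inj_on \<alpha> (carrier G)"
    by (auto simp: hom_in_carrier hom_mult bij_betw_def)
  show "\<alpha> \<one>\<^bsub>G\<^esub> = \<one>\<^bsub>G\<^esub>" using \<open>\<alpha> \<in> hom G G\<close> by (simp add: hom_one G.is_group)
qed

lemma hom_GH:
  assumes "l \<in> hom G H"
  shows "g \<in> carrier G \<Longrightarrow> l g \<in> carrier H"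
    "g \<in> carrier G \<Longrightarrow> h \<in> carrier G \<Longrightarrow> l (g \<otimes>\<^bsub>G\<^esub> h) = l g \<otimes>\<^bsub>H\<^esub> l h"
    "l \<one>\<^bsub>G\<^esub> = \<one>\<^bsub>H\<^esub>"
  using assms by (auto simp: hom_in_carrier hom_mult hom_one G.is_group group_H)

subsection \<open>The action on words\<close>

abbreviation "gact \<equiv> G_word_act act \<Phi>"
abbreviation "hact \<equiv> H_word_act act"

lemma hact_closed: "h \<in> carrier H \<Longrightarrow> w \<in> lists \<X> \<Longrightarrow> hact h w \<in> lists \<X>"
  by (cases w) (auto simp: act_H)

lemma hact_one: "w \<in> lists \<X> \<Longrightarrow> hact \<one>\<^bsub>H\<^esub> w = w"
  by (cases w) (auto simp: act_H)

lemma hact_mult: "h \<in> carrier H \<Longrightarrow> k \<in> carrier H \<Longrightarrow> w \<in> lists \<X> \<Longrightarrow> hact (h \<otimes>\<^bsub>H\<^esub> k) w = hact h (hact k w)"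
  by (cases w) (auto simp: act_H)

lemma length_hact: "length (hact h w) = length w"
  by (cases w) auto

lemma gact_closed: "g \<in> carrier G \<Longrightarrow> w \<in> lists \<X> \<Longrightarrow> gact g w \<in> lists \<X>"
proof (induction w arbitrary: g)
  case (Cons x w)
  then have x: "x \<in> \<X>" "w \<in> lists \<X>" by auto
  show ?case using x Cons
    by (cases rule: letter_type_cases[OF x(1)]) (auto simp: auto_hom hom_GH hact_closed simp del: in_lists_conv_set)
qed simp

lemma gact_one: "w \<in> lists \<X> \<Longrightarrow> gact \<one>\<^bsub>G\<^esub> w = w"
proof (induction w)
  case (Cons x w)
  then have x: "x \<in> \<X>" "w \<in> lists \<X>" by auto
  show ?case using x Cons
    by (cases rule: letter_type_cases[OF x(1)]) (auto simp: auto_hom hom_GH hact_one simp del: in_lists_conv_set)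
qed simp

lemma gact_mult:
  "g \<in> carrier G \<Longrightarrow> h \<in> carrier G \<Longrightarrow> w \<in> lists \<X> \<Longrightarrow> gact (g \<otimes>\<^bsub>G\<^esub> h) w = gact g (gact h w)"
proof (induction w arbitrary: g h)
  case (Cons x w)
  then have x: "x \<in> \<X>" "w \<in> lists \<X>" by auto
  show ?case using x Cons
    by (cases rule: letter_type_cases[OF x(1)]) (auto simp: auto_hom hom_GH hact_mult simp del: in_lists_conv_set)
qed simp

lemma length_gact: "length (gact g w) = length w"
  by (induction w arbitrary: g) (auto simp: length_hact split: sum.splits)

definition Gperm :: "'g \<Rightarrow> 'x list \<Rightarrow> 'x list" where
  "Gperm g = restrict (gact g) (lists \<X>)"

definition Hperm :: "'h \<Rightarrow> 'x list \<Rightarrow> 'x list" where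
  "Hperm h = restrict (hact h) (lists \<X>)"

lemma Gperm_apply: "w \<in> lists \<X> \<Longrightarrow> Gperm g w = gact g w"
  and Hperm_apply: "w \<in> lists \<X> \<Longrightarrow> Hperm h w = hact h w"
  by (simp_all add: Gperm_def Hperm_def)

lemma restrict_Bij:
  assumes "\<And>w. w \<in> S \<Longrightarrow> f w \<in> S" "\<And>w. w \<in> S \<Longrightarrow> f' w \<in> S"
    "\<And>w. w \<in> S \<Longrightarrow> f (f' w) = w" "\<And>w. w \<in> S \<Longrightarrow> f' (f w) = w"
  shows "restrict f S \<in> Bij S"
  unfolding Bij_def
proof (intro IntI CollectI restrict_extensional)
  have "bij_betw f S S" using assms by (intro bij_betw_byWitness[of S f' f S]) auto
  then show "bij_betw (restrict f S) S S" by (simp cong: bij_betw_cong)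
qed

lemma Gperm_Bij: "g \<in> carrier G \<Longrightarrow> Gperm g \<in> Bij (lists \<X>)"
  unfolding Gperm_def
  by (rule restrict_Bij[of _ _ "gact (inv\<^bsub>G\<^esub> g)"])
    (simp_all add: gact_closed gact_mult[symmetric] gact_one del: in_lists_conv_set)

lemma Hperm_Bij: "h \<in> carrier H \<Longrightarrow> Hperm h \<in> Bij (lists \<X>)"
  unfolding Hperm_def
  by (rule restrict_Bij[of _ _ "hact (inv\<^bsub>H\<^esub> h)"])
    (simp_all add: hact_closed hact_mult[symmetric] hact_one del: in_lists_conv_set)

lemma BijGroup_mult_apply:
  "f \<in> Bij S \<Longrightarrow> g \<in> Bij S \<Longrightarrow> w \<in> S \<Longrightarrow> (f \<otimes>\<^bsub>BijGroup S\<^esub> g) w = f (g w)"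
  by (simp add: BijGroup_def compose_def)

lemma Bij_eqI: "f \<in> Bij S \<Longrightarrow> g \<in> Bij S \<Longrightarrow> (\<And>w. w \<in> S \<Longrightarrow> f w = g w) \<Longrightarrow> f = g"
  by (metis Bij_imp_extensional extensionalityI)

lemma BijGroup_carrier: "carrier (BijGroup S) = Bij S"
  by (simp add: BijGroup_def)

lemma Gperm_hom: "Gperm \<in> hom G (BijGroup (lists \<X>))"
proof (rule homI)
  fix g h assume gh: "g \<in> carrier G" "h \<in> carrier G"
  then have B: "Gperm g \<otimes>\<^bsub>BijGroup (lists \<X>)\<^esub> Gperm h \<in> Bij (lists \<X>)"
    by (simp add: BijGroup_def Gperm_Bij compose_Bij)
  show "Gperm (g \<otimes>\<^bsub>G\<^esub> h) = Gperm g \<otimes>\<^bsub>BijGroup (lists \<X>)\<^esub> Gperm h"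
    using gh by (intro Bij_eqI[OF Gperm_Bij B])
      (simp_all add: BijGroup_mult_apply Gperm_Bij Gperm_apply gact_mult gact_closed del: in_lists_conv_set)
qed (simp add: BijGroup_carrier Gperm_Bij)

lemma Hperm_hom: "Hperm \<in> hom H (BijGroup (lists \<X>))"
proof (rule homI)
  fix g h assume gh: "g \<in> carrier H" "h \<in> carrier H"
  then have B: "Hperm g \<otimes>\<^bsub>BijGroup (lists \<X>)\<^esub> Hperm h \<in> Bij (lists \<X>)"
    by (simp add: BijGroup_def Hperm_Bij compose_Bij)
  show "Hperm (g \<otimes>\<^bsub>H\<^esub> h) = Hperm g \<otimes>\<^bsub>BijGroup (lists \<X>)\<^esub> Hperm h"
    using gh by (intro Bij_eqI[OF Hperm_Bij B])
      (simp_all add: BijGroup_mult_apply Hperm_Bij Hperm_apply hact_mult hact_closed del: in_lists_conv_set)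
qed (simp add: BijGroup_carrier Hperm_Bij)

subsection \<open>The multispinal group is self-similar and contracting\<close>

abbreviation "\<GG> \<equiv> multispinal_group G H \<X> act \<Phi>"

definition nucleus :: "('x list \<Rightarrow> 'x list) set" where
  "nucleus = Gperm ` carrier G \<union> Hperm ` carrier H"

lemma nucleus_gens: "nucleus = multispinal_gens G H \<X> act \<Phi>"
  by (simp add: nucleus_def multispinal_gens_def Gperm_def Hperm_def)

lemma nucleus_Bij: "nucleus \<subseteq> carrier (BijGroup (lists \<X>))"
  by (auto simp: nucleus_def BijGroup_carrier Gperm_Bij Hperm_Bij)

lemma \<GG>_subgroup: "subgroup (carrier \<GG>) (BijGroup (lists \<X>))"
  using group.generate_is_subgroup[OF group_BijGroup nucleus_Bij]
  by (simp add: multispinal_group_def nucleus_gens)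

lemma \<GG>_eq: "\<GG> = BijGroup (lists \<X>) \<lparr>carrier := carrier \<GG>\<rparr>"
  by (simp add: multispinal_group_def)

lemma \<GG>_group: "group \<GG>"
  using subgroup.subgroup_is_group[OF \<GG>_subgroup group_BijGroup] \<GG>_eq by simp

lemma \<GG>_Bij: "f \<in> carrier \<GG> \<Longrightarrow> f \<in> Bij (lists \<X>)"
  using subgroup.subset[OF \<GG>_subgroup] by (auto simp: BijGroup_carrier)

lemma \<GG>_mult: "f \<otimes>\<^bsub>\<GG>\<^esub> g = f \<otimes>\<^bsub>BijGroup (lists \<X>)\<^esub> g"
  and \<GG>_one: "\<one>\<^bsub>\<GG>\<^esub> = \<one>\<^bsub>BijGroup (lists \<X>)\<^esub>"
  by (simp_all add: multispinal_group_def)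

lemma nucleus_sub: "nucleus \<subseteq> carrier \<GG>"
  by (auto simp: multispinal_group_def nucleus_gens intro: generate.incl)

lemma Gperm_\<GG>: "g \<in> carrier G \<Longrightarrow> Gperm g \<in> carrier \<GG>"
  and Hperm_\<GG>: "h \<in> carrier H \<Longrightarrow> Hperm h \<in> carrier \<GG>"
  using nucleus_sub by (auto simp: nucleus_def)

lemma \<GG>_gen: "carrier \<GG> = generate \<GG> nucleus"
  using group.generate_consistent[OF group_BijGroup nucleus_sub \<GG>_subgroup] \<GG>_eq
  by (simp add: multispinal_group_def nucleus_gens)

lemma Gperm_hom_\<GG>: "Gperm \<in> hom G \<GG>"
  using Gperm_hom by (auto simp: hom_def \<GG>_mult Gperm_\<GG>)

lemma Hperm_hom_\<GG>: "Hperm \<in> hom H \<GG>"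
  using Hperm_hom by (auto simp: hom_def \<GG>_mult Hperm_\<GG>)

lemma Gperm_inv: "g \<in> carrier G \<Longrightarrow> inv\<^bsub>\<GG>\<^esub> (Gperm g) = Gperm (inv\<^bsub>G\<^esub> g)"
  using group_hom.hom_inv[of G \<GG> Gperm g] Gperm_hom_\<GG> \<GG>_group G.is_group
  by (simp add: group_hom_def group_hom_axioms_def)

lemma Hperm_inv: "h \<in> carrier H \<Longrightarrow> inv\<^bsub>\<GG>\<^esub> (Hperm h) = Hperm (inv\<^bsub>H\<^esub> h)"
  using group_hom.hom_inv[of H \<GG> Hperm h] Hperm_hom_\<GG> \<GG>_group group_H
  by (simp add: group_hom_def group_hom_axioms_def)

lemma Gperm_one: "Gperm \<one>\<^bsub>G\<^esub> = \<one>\<^bsub>\<GG>\<^esub>"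
  and Hperm_one: "Hperm \<one>\<^bsub>H\<^esub> = \<one>\<^bsub>\<GG>\<^esub>"
  using hom_one[OF Gperm_hom_\<GG> G.is_group \<GG>_group] hom_one[OF Hperm_hom_\<GG> group_H \<GG>_group] by auto

lemma nucleus_Cons:
  assumes "s \<in> nucleus" "x \<in> \<X>"
  obtains y k where "y \<in> \<X>" "k \<in> nucleus" "\<And>w. w \<in> lists \<X> \<Longrightarrow> s (x # w) = y # k w"
proof -
  from assms(1) consider g where "g \<in> carrier G" "s = Gperm g" | h where "h \<in> carrier H" "s = Hperm h"
    by (auto simp: nucleus_def)
  then show ?thesis
  proof cases
    case (1 g)
    from assms(2) show ?thesis
    proof (cases rule: letter_type_cases)
      case a: (1 \<alpha>)
      show ?thesis
        by (rule that[of x "Gperm (\<alpha> g)"]) (use 1 a assms(2) in \<open>auto simp: nucleus_def Gperm_apply auto_hom\<close>)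
    next
      case l: (2 l)
      show ?thesis
        by (rule that[of x "Hperm (l g)"]) (use 1 l assms(2) in \<open>auto simp: nucleus_def Gperm_apply Hperm_apply hom_GH\<close>)
    qed
  next
    case (2 h)
    show ?thesis
      by (rule that[of "act h x" "Gperm \<one>\<^bsub>G\<^esub>"])
        (use 2 assms(2) in \<open>auto simp: nucleus_def Gperm_apply Hperm_apply act_H gact_one\<close>)
  qed
qed

lemma length_nucleus: "s \<in> nucleus \<Longrightarrow> w \<in> lists \<X> \<Longrightarrow> length (s w) = length w"
  by (auto simp: nucleus_def Gperm_def Hperm_def length_gact length_hact)

lemma nucleus_inv: "s \<in> nucleus \<Longrightarrow> inv\<^bsub>\<GG>\<^esub> s \<in> nucleus"
  unfolding nucleus_def using Gperm_inv Hperm_inv by fastforce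

lemma one_nucleus: "\<one>\<^bsub>\<GG>\<^esub> \<in> nucleus"
  unfolding Gperm_one[symmetric] nucleus_def by simp

lemma \<GG>_properties:
  assumes "f \<in> carrier \<GG>"
  shows "(\<forall>w \<in> lists \<X>. length (f w) = length w) \<and>
    (\<forall>x \<in> \<X>. \<exists>y \<in> \<X>. \<exists>k \<in> carrier \<GG>. \<forall>w \<in> lists \<X>. f (x # w) = y # k w)"
proof -
  have nuc: "(\<forall>w \<in> lists \<X>. length (s w) = length w) \<and>
    (\<forall>x \<in> \<X>. \<exists>y \<in> \<X>. \<exists>k \<in> carrier \<GG>. \<forall>w \<in> lists \<X>. s (x # w) = y # k w)" if "s \<in> nucleus" for s
    using that nucleus_Cons[OF that] length_nucleus nucleus_sub by (metis subsetD)
  from assms have "f \<in> generate \<GG> nucleus" using \<GG>_gen by simp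
  then show ?thesis
  proof induction
    case one
    show ?case by (rule nuc[OF one_nucleus])
  next
    case (incl s) then show ?case by (rule nuc)
  next
    case (inv s) then show ?case by (intro nuc nucleus_inv)
  next
    case (eng f g)
    have c: "f \<in> carrier \<GG>" "g \<in> carrier \<GG>" using eng.hyps \<GG>_gen by auto
    have app: "(f' \<otimes>\<^bsub>\<GG>\<^esub> g') w = f' (g' w)" if "f' \<in> carrier \<GG>" "g' \<in> carrier \<GG>" "w \<in> lists \<X>" for f' g' w
      using that \<GG>_Bij by (simp add: \<GG>_mult BijGroup_mult_apply del: in_lists_conv_set)
    have cl: "g' w \<in> lists \<X>" if "g' \<in> carrier \<GG>" "w \<in> lists \<X>" for g' w
      using Bij_imp_funcset[OF \<GG>_Bij] that by blast
    show ?case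
    proof (intro conjI ballI)
      show "length ((f \<otimes>\<^bsub>\<GG>\<^esub> g) w) = length w" if "w \<in> lists \<X>" for w
        using that eng.IH c app cl by metis
      fix x assume "x \<in> \<X>"
      then obtain y k where y: "y \<in> \<X>" "k \<in> carrier \<GG>" "\<And>w. w \<in> lists \<X> \<Longrightarrow> g (x # w) = y # k w"
        using eng.IH by metis
      then obtain z m where z: "z \<in> \<X>" "m \<in> carrier \<GG>" "\<And>w. w \<in> lists \<X> \<Longrightarrow> f (y # w) = z # m w"
        using eng.IH by metis
      have "(f \<otimes>\<^bsub>\<GG>\<^esub> g) (x # w) = z # (m \<otimes>\<^bsub>\<GG>\<^esub> k) w" if w: "w \<in> lists \<X>" for w
        using app[OF c, of "x # w"] app[OF z(2) y(2) w] y(3)[OF w] z(3)[OF cl[OF y(2) w]] w \<open>x \<in> \<X>\<close> by simp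
      moreover have "m \<otimes>\<^bsub>\<GG>\<^esub> k \<in> carrier \<GG>"
        using y z group.is_monoid[OF \<GG>_group] by (simp add: monoid.m_closed)
      ultimately show "\<exists>y\<in>\<X>. \<exists>k\<in>carrier \<GG>. \<forall>w\<in>lists \<X>. (f \<otimes>\<^bsub>\<GG>\<^esub> g) (x # w) = y # k w"
        using z(1) by blast
    qed
  qed
qed

lemma \<GG>_self_similar: "self_similar_group \<GG> \<X> (\<lambda>f. f)"
proof -
  have "(\<lambda>f. f) \<in> hom \<GG> (BijGroup (lists \<X>))"
    using \<GG>_Bij by (auto simp: hom_def BijGroup_carrier \<GG>_mult)
  then have "group_action \<GG> (lists \<X>) (\<lambda>f. f)"
    by (simp add: group_action_def group_hom_def group_hom_axioms_def \<GG>_group group_BijGroup)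
  moreover have "\<exists>k\<in>carrier \<GG>. \<forall>w\<in>lists \<X>. g (x # w) = g [x] @ k w" if "g \<in> carrier \<GG>" "x \<in> \<X>" for g x
  proof -
    note gx = that
    obtain y k where k: "k \<in> carrier \<GG>" "\<forall>w \<in> lists \<X>. g (x # w) = y # k w"
      using \<GG>_properties[OF gx(1)] gx(2) by blast
    then have "g [x] = y # k []" by simp
    moreover have "k [] = []" using \<GG>_properties[OF k(1)] by (metis length_0_conv lists.Nil list.size(3))
    ultimately show ?thesis using k by auto
  qed
  ultimately show ?thesis
    using \<GG>_properties finite_X card_X
    by (intro self_similar_group.intro faithful_action.intro faithful_action_axioms.intro
        self_similar_group_axioms.intro) auto
qed

sublocale SS: self_similar_group \<GG> \<X> "\<lambda>f. f"
  by (rule \<GG>_self_similar)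

text \<open>
  Sections of elements of \<open>H\<close> are trivial, so in a product of two elements of the nucleus either both factors
  lie in \<open>G\<close>, or at most one has a nontrivial section.
\<close>

lemma nucleus_contracting:
  assumes J: "ideal J (free_star_algebra TYPE('k::field) (\<X> <+> carrier \<GG>))"
    and rel: "nekrashevych_relators TYPE('k) \<GG> \<X> (\<lambda>f. f) \<subseteq> J"
  shows "contracting_nekrashevych_ideal \<GG> \<X> (\<lambda>f. f) J nucleus"
proof -
  have sec: "word_section \<GG> \<X> (\<lambda>f. f) s x \<in> nucleus"
    if "s \<in> carrier \<GG>" "x \<in> \<X>" "k \<in> nucleus" "\<And>w. w \<in> lists \<X> \<Longrightarrow> s (x # w) = y # k w" for s x k y
    using SS.word_section_eqI[of s x k "[y]"] that nucleus_sub by auto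
  have sec_nucleus: "word_section \<GG> \<X> (\<lambda>f. f) s x \<in> nucleus" if sx: "s \<in> nucleus" "x \<in> \<X>" for s x
  proof -
    obtain y k where "y \<in> \<X>" "k \<in> nucleus" "\<And>w. w \<in> lists \<X> \<Longrightarrow> s (x # w) = y # k w"
      using nucleus_Cons[OF sx] by blast
    then show ?thesis using sec[of s x k y] sx nucleus_sub by blast
  qed
  have app: "(f' \<otimes>\<^bsub>\<GG>\<^esub> g') w = f' (g' w)" if "f' \<in> carrier \<GG>" "g' \<in> carrier \<GG>" "w \<in> lists \<X>" for f' g' w
    by (rule SS.act_mult[OF that])
  show ?thesis
  proof (intro contracting_nekrashevych_ideal.intro nekrashevych_ideal.intro
      nekrashevych_ideal_axioms.intro contracting_nekrashevych_ideal_axioms.intro \<GG>_self_similar J rel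
      nucleus_sub \<GG>_gen nucleus_inv)
    show "\<one>\<^bsub>\<GG>\<^esub> \<in> nucleus" by (rule one_nucleus)
  next
    fix s x assume "s \<in> nucleus" "x \<in> \<X>"
    then show "word_section \<GG> \<X> (\<lambda>f. f) s x \<in> nucleus" by (rule sec_nucleus)
  next
    fix s t x assume st: "s \<in> nucleus" "t \<in> nucleus" and x: "x \<in> \<X>"
    have c: "s \<in> carrier \<GG>" "t \<in> carrier \<GG>" "s \<otimes>\<^bsub>\<GG>\<^esub> t \<in> carrier \<GG>"
      using st nucleus_sub monoid.m_closed[OF group.is_monoid[OF \<GG>_group]] by auto
    obtain y k where k: "y \<in> \<X>" "k \<in> nucleus" "\<And>w. w \<in> lists \<X> \<Longrightarrow> t (x # w) = y # k w"
      using nucleus_Cons[OF st(2) x] by blast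
    obtain z m where m: "z \<in> \<X>" "m \<in> nucleus" "\<And>w. w \<in> lists \<X> \<Longrightarrow> s (y # w) = z # m w"
      using nucleus_Cons[OF st(1) k(1)] by blast
    have km: "k \<in> carrier \<GG>" "m \<in> carrier \<GG>" using k m nucleus_sub by auto
    have st_x: "(s \<otimes>\<^bsub>\<GG>\<^esub> t) (x # w) = z # m (k w)" if w: "w \<in> lists \<X>" for w
    proof -
      have "k w \<in> lists \<X>" using SS.act_closed km w by blast
      then show ?thesis using app[OF c(1,2), of "x # w"] k(3)[OF w] m(3) w x by simp
    qed
    have one: "(\<one>\<^bsub>\<GG>\<^esub>) w = w" if "w \<in> lists \<X>" for w using SS.act_one that by simp
    \<comment> \<open>Elements of \<open>H\<close> have trivial sections, so at least one factor of \<open>m k\<close> is trivial, unless both lie in \<open>G\<close>.\<close>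
    consider g g' where "s = Gperm g" "t = Gperm g'" "g \<in> carrier G" "g' \<in> carrier G"
      | h where "s = Hperm h" "h \<in> carrier H" | h where "t = Hperm h" "h \<in> carrier H"
      using st by (auto simp: nucleus_def)
    then show "word_section \<GG> \<X> (\<lambda>f. f) (s \<otimes>\<^bsub>\<GG>\<^esub> t) x \<in> nucleus"
    proof cases
      case 1
      then have "s \<otimes>\<^bsub>\<GG>\<^esub> t = Gperm (g \<otimes>\<^bsub>G\<^esub> g')" using Gperm_hom_\<GG> by (simp add: hom_mult)
      then have "s \<otimes>\<^bsub>\<GG>\<^esub> t \<in> nucleus" using 1 by (simp add: nucleus_def)
      then show ?thesis using x by (rule sec_nucleus)
    next
      case (2 h)
      have "m w = w" if "w \<in> lists \<X>" for w
        using m(3)[OF that] k(1) that by (simp add: 2 Hperm_apply)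
      then have "(s \<otimes>\<^bsub>\<GG>\<^esub> t) (x # w) = z # k w" if "w \<in> lists \<X>" for w
        using st_x[OF that] SS.act_closed[OF km(1) that] by simp
      then show ?thesis using sec[OF c(3) x k(2)] by blast
    next
      case (3 h)
      have "k w = w" if "w \<in> lists \<X>" for w
        using k(3)[OF that] x that by (simp add: 3 Hperm_apply)
      then have "(s \<otimes>\<^bsub>\<GG>\<^esub> t) (x # w) = z # m w" if "w \<in> lists \<X>" for w
        using st_x[OF that] that by simp
      then show ?thesis using sec[OF c(3) x m(2)] by blast
    qed
  qed
qed

end

context multispinal_data
begin

interpretation H': group H by (rule group_H)
interpretation Aut: group "AutoGroup G" by (rule G.AutoGroup)

lemma AutoGroup_simps:
  "carrier (AutoGroup G) = auto G" "\<one>\<^bsub>AutoGroup G\<^esub> = (\<lambda>x\<in>carrier G. x)"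
  "\<alpha> \<in> auto G \<Longrightarrow> \<beta> \<in> auto G \<Longrightarrow> \<alpha> \<otimes>\<^bsub>AutoGroup G\<^esub> \<beta> = compose (carrier G) \<alpha> \<beta>"
  by (simp_all add: AutoGroup_def BijGroup_def auto_def)

lemma spinal_A_auto: "spinal_A G \<X> \<Phi> \<subseteq> auto G"
  using Aut.generate_incl[of "spinal_aut \<X> \<Phi>"] spinal_aut_auto by (simp add: spinal_A_def AutoGroup_simps)

lemma finite_AutoGroup: "finite (carrier (AutoGroup G))"
proof (rule finite_subset)
  show "carrier (AutoGroup G) \<subseteq> carrier G \<rightarrow>\<^sub>E carrier G"
    using auto_hom(1) by (auto simp: AutoGroup_simps PiE_def auto_def Bij_def)
qed (simp add: finite_PiE finite_G)

subsection \<open>Descending along words\<close>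

lemma aut_word:
  assumes "p \<in> lists \<X>" "\<And>x. x \<in> set p \<Longrightarrow> \<Phi> x \<in> range Inl"
  shows "\<exists>\<alpha> \<in> spinal_A G \<X> \<Phi>. \<forall>g \<in> carrier G. \<forall>w. gact g (p @ w) = p @ gact (\<alpha> g) w"
  using assms
proof (induction p rule: list.induct)
  case Nil
  have "(\<lambda>x\<in>carrier G. x) \<in> spinal_A G \<X> \<Phi>"
    using generate.one[of "AutoGroup G" "spinal_aut \<X> \<Phi>"] by (simp add: spinal_A_def AutoGroup_simps)
  then show ?case by (intro bexI[of _ "\<lambda>x\<in>carrier G. x"]) auto
next
  case (Cons x p)
  have p: "x \<in> \<X>" "p \<in> lists \<X>" using Cons.prems(1) by auto
  have "\<And>y. y \<in> set p \<Longrightarrow> \<Phi> y \<in> range Inl" using Cons.prems(2) by simp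
  from Cons.IH[OF p(2) this] obtain \<alpha> where \<alpha>: "\<alpha> \<in> spinal_A G \<X> \<Phi>"
    "\<And>g w. g \<in> carrier G \<Longrightarrow> gact g (p @ w) = p @ gact (\<alpha> g) w" by blast
  obtain \<beta> where \<beta>: "\<Phi> x = Inl \<beta>" "\<beta> \<in> spinal_aut \<X> \<Phi>" "\<beta> \<in> auto G"
  proof -
    have "\<Phi> x \<in> range Inl" using Cons.prems(2) by simp
    then show ?thesis using that by (cases rule: letter_type_cases[OF p(1)]) auto
  qed
  have a: "\<alpha> \<in> auto G" using \<alpha>(1) spinal_A_auto by blast
  have "compose (carrier G) \<alpha> \<beta> \<in> spinal_A G \<X> \<Phi>"
    using generate.eng[of \<alpha> "AutoGroup G" "spinal_aut \<X> \<Phi>" \<beta>] \<alpha>(1)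
      generate.incl[OF \<beta>(2), of "AutoGroup G"]
    by (simp add: spinal_A_def AutoGroup_simps a \<beta>)
  moreover have "gact g ((x # p) @ w) = (x # p) @ gact (compose (carrier G) \<alpha> \<beta> g) w" if "g \<in> carrier G" for g w
    using that \<alpha>(2)[OF auto_hom(1)[OF \<beta>(3) that]] by (simp add: \<beta>(1) compose_def)
  ultimately show ?case by blast
qed

text \<open>
  Paths exist for generators and compose; that they exist for inverses is due to the finiteness of \<open>Aut(G)\<close>.
\<close>

lemma spinal_A_path:
  assumes "\<alpha> \<in> spinal_A G \<X> \<Phi>"
  shows "\<exists>q \<in> lists \<X>. \<forall>g \<in> carrier G. \<forall>w. gact g (q @ w) = q @ gact (\<alpha> g) w"
proof -
  define P where "P \<alpha> \<longleftrightarrow> (\<exists>q \<in> lists \<X>. \<forall>g \<in> carrier G. \<forall>w. gact g (q @ w) = q @ gact (\<alpha> g) w)" for \<alpha>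
  have P_one: "P \<one>\<^bsub>AutoGroup G\<^esub>"
    unfolding P_def by (intro bexI[of _ "[]"]) (auto simp: AutoGroup_simps)
  have P_mult: "P (\<alpha> \<otimes>\<^bsub>AutoGroup G\<^esub> \<beta>)"
    if ab: "\<alpha> \<in> auto G" "\<beta> \<in> auto G" "P \<alpha>" "P \<beta>" for \<alpha> \<beta>
  proof -
    obtain q where q: "q \<in> lists \<X>" "\<And>g w. g \<in> carrier G \<Longrightarrow> gact g (q @ w) = q @ gact (\<alpha> g) w"
      using ab(3) unfolding P_def by blast
    obtain r where r: "r \<in> lists \<X>" "\<And>g w. g \<in> carrier G \<Longrightarrow> gact g (r @ w) = r @ gact (\<beta> g) w"
      using ab(4) unfolding P_def by blast
    have "gact g ((r @ q) @ w) = (r @ q) @ gact ((\<alpha> \<otimes>\<^bsub>AutoGroup G\<^esub> \<beta>) g) w" if "g \<in> carrier G" for g w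
      using that r(2)[OF that] q(2)[OF auto_hom(1)[OF ab(2) that]] ab(1,2)
      by (simp add: AutoGroup_simps compose_def)
    then show ?thesis unfolding P_def using q(1) r(1) by (intro bexI[of _ "r @ q"]) auto
  qed
  have P_incl: "P \<alpha>" if "\<alpha> \<in> spinal_aut \<X> \<Phi>" for \<alpha>
  proof -
    obtain x where "x \<in> \<X>" "\<Phi> x = Inl \<alpha>"
      using \<open>\<alpha> \<in> spinal_aut \<X> \<Phi>\<close> unfolding spinal_aut_def by (metis imageE mem_Collect_eq)
    then show ?thesis unfolding P_def by (intro bexI[of _ "[x]"]) auto
  qed
  \<comment> \<open>Inverses of generators are powers, as \<open>G\<close> is finite.\<close>
  have P_inv: "P (inv\<^bsub>AutoGroup G\<^esub> \<alpha>)" if a: "\<alpha> \<in> spinal_aut \<X> \<Phi>" for \<alpha>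
  proof -
    have ac: "\<alpha> \<in> carrier (AutoGroup G)" using a spinal_aut_auto by (auto simp: AutoGroup_simps)
    have pow: "P (\<alpha> [^]\<^bsub>AutoGroup G\<^esub> n)" for n :: nat
    proof (induction n)
      case (Suc n)
      have "\<alpha> [^]\<^bsub>AutoGroup G\<^esub> n \<in> carrier (AutoGroup G)" using ac by (rule Aut.nat_pow_closed)
      then show ?case using Suc P_mult P_incl[OF a] ac by (simp add: AutoGroup_simps(1))
    qed (simp add: P_one)
    have "\<alpha> [^]\<^bsub>AutoGroup G\<^esub> Suc (Aut.ord \<alpha> - 1) = \<one>\<^bsub>AutoGroup G\<^esub>"
      using Aut.ord_ge_1[OF finite_AutoGroup ac] Aut.pow_ord_eq_1[OF ac] by simp
    then have "\<alpha> [^]\<^bsub>AutoGroup G\<^esub> (Aut.ord \<alpha> - 1) \<otimes>\<^bsub>AutoGroup G\<^esub> \<alpha> = \<one>\<^bsub>AutoGroup G\<^esub>" by simp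
    then have "inv\<^bsub>AutoGroup G\<^esub> \<alpha> = \<alpha> [^]\<^bsub>AutoGroup G\<^esub> (Aut.ord \<alpha> - 1)"
      using ac by (intro Aut.inv_equality) auto
    then show ?thesis using pow by simp
  qed
  from assms have "\<alpha> \<in> generate (AutoGroup G) (spinal_aut \<X> \<Phi>)" by (simp add: spinal_A_def)
  then have "P \<alpha>"
  proof induction
    case (eng \<alpha> \<beta>)
    then show ?case using P_mult spinal_A_auto unfolding spinal_A_def by blast
  qed (use P_one P_incl P_inv in blast)+
  then show ?thesis by (simp add: P_def)
qed

lemma spinal_B_factor:
  assumes "l \<in> spinal_B G \<X> \<Phi>"
  shows "\<exists>m \<alpha>. m \<in> spinal_hom \<X> \<Phi> \<and> \<alpha> \<in> spinal_A G \<X> \<Phi> \<and> m \<in> hom G H \<and> \<alpha> \<in> auto G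
    \<and> (\<forall>g \<in> carrier G. l g = m (\<alpha> g))"
  using assms spinal_hom_hom spinal_A_auto by (fastforce simp: spinal_B_def compose_def)

lemma spinal_B_hom:
  assumes "l \<in> spinal_B G \<X> \<Phi>"
  shows "l \<in> hom G H"
proof -
  from spinal_B_factor[OF assms] obtain m \<alpha> where "m \<in> hom G H" "\<alpha> \<in> auto G"
    "\<forall>g \<in> carrier G. l g = m (\<alpha> g)" by blast
  then show ?thesis by (intro homI) (simp_all add: auto_hom hom_GH)
qed

lemma spinal_B_nonempty: "spinal_B G \<X> \<Phi> \<noteq> {}"
  using S2 generate.one by (fastforce simp: spinal_B_def spinal_A_def)

text \<open>
  If \<open>\<lambda> = \<mu> \<alpha>\<close>, the word consists of a path for \<open>\<alpha>\<close> and a letter \<open>z\<close> with \<open>\<Phi>(z) = \<mu>\<close>.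
\<close>

lemma spinal_B_path:
  assumes "l \<in> spinal_B G \<X> \<Phi>"
  shows "\<exists>q \<in> lists \<X>. \<forall>g \<in> carrier G. \<forall>w. gact g (q @ w) = q @ hact (l g) w"
proof -
  from spinal_B_factor[OF assms] obtain m \<alpha> where l: "m \<in> spinal_hom \<X> \<Phi>" "\<alpha> \<in> spinal_A G \<X> \<Phi>"
    "\<alpha> \<in> auto G" "\<And>g. g \<in> carrier G \<Longrightarrow> l g = m (\<alpha> g)" by blast
  obtain z where z: "z \<in> \<X>" "\<Phi> z = Inr m"
    using l(1) unfolding spinal_hom_def by (metis imageE mem_Collect_eq)
  obtain q where q: "q \<in> lists \<X>" "\<And>g w. g \<in> carrier G \<Longrightarrow> gact g (q @ w) = q @ gact (\<alpha> g) w"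
    using spinal_A_path[OF l(2)] by blast
  have "gact g ((q @ [z]) @ w) = (q @ [z]) @ hact (l g) w" if "g \<in> carrier G" for g w
    using q(2)[OF that, of "z # w"] z(2) l(4)[OF that] by simp
  then show ?thesis using q(1) z(1) by (intro bexI[of _ "q @ [z]"]) auto
qed

lemma first_hom_letter:
  assumes "p \<in> lists \<X>" "z \<in> \<X>" "\<And>x. x \<in> set p \<Longrightarrow> \<Phi> x \<in> range Inl" "\<Phi> z \<notin> range Inl"
  shows "\<exists>l \<in> spinal_B G \<X> \<Phi>. \<forall>g \<in> carrier G. \<forall>w. gact g ((p @ [z]) @ w) = (p @ [z]) @ hact (l g) w"
proof -
  obtain \<alpha> where \<alpha>: "\<alpha> \<in> spinal_A G \<X> \<Phi>" "\<And>g w. g \<in> carrier G \<Longrightarrow> gact g (p @ w) = p @ gact (\<alpha> g) w"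
    using aut_word[OF assms(1,3)] by blast
  obtain m where m: "\<Phi> z = Inr m" "m \<in> spinal_hom \<X> \<Phi>"
    using assms(4) by (cases rule: letter_type_cases[OF assms(2)]) auto
  have "compose (carrier G) m \<alpha> \<in> spinal_B G \<X> \<Phi>" using m(2) \<alpha>(1) by (auto simp: spinal_B_def)
  moreover have "gact g ((p @ [z]) @ w) = (p @ [z]) @ hact (compose (carrier G) m \<alpha> g) w"
    if "g \<in> carrier G" for g w
    using \<alpha>(2)[OF that, of "z # w"] m(1) that by (simp add: compose_def)
  ultimately show ?thesis by blast
qed

text \<open>This is where the condition on the kernels enters: \<open>G\<close> acts faithfully on words.\<close>

lemma gact_faithful:
  assumes g: "g \<in> carrier G" and triv: "\<And>w. w \<in> lists \<X> \<Longrightarrow> gact g w = w"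
  shows "g = \<one>\<^bsub>G\<^esub>"
proof -
  obtain x where x: "x \<in> \<X>" using X_nonempty by blast
  have "g \<in> kernel G H l" if l: "l \<in> spinal_B G \<X> \<Phi>" for l
  proof -
    obtain q where q: "q \<in> lists \<X>" "\<And>w. gact g (q @ w) = q @ hact (l g) w"
      using spinal_B_path[OF l] g by blast
    have "gact g (q @ [x]) = q @ [x]" using q(1) x by (intro triv) auto
    then have "act (l g) x = x" using q(2)[of "[x]"] by simp
    then show ?thesis
      using act_H_fixed[of "l g" x] hom_GH(1)[OF spinal_B_hom[OF l] g] x g by (simp add: kernel_def)
  qed
  then show ?thesis using S3 by blast
qed

end

context multispinal_data
begin

interpretation H': group H by (rule group_H)

text \<open>
  Membership in the intersection of the kernels of the maps \<open>KG \<rightarrow> KH\<close> induced by the \<open>\<lambda> \<in> B\<close>.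
\<close>

definition killed :: "('g \<Rightarrow> 'k::field) \<Rightarrow> bool" where
  "killed a \<longleftrightarrow> finite (supp a) \<and> supp a \<subseteq> carrier G \<and> (\<forall>l \<in> spinal_B G \<X> \<Phi>. lin_ext l a = (\<lambda>_. 0))"

lemma kernels_trivial_iff:
  "(\<Inter>l \<in> spinal_B G \<X> \<Phi>. a_kernel (monoid_algebra TYPE('k::field) G) (monoid_algebra TYPE('k) H) (lin_ext l))
      = {\<zero>\<^bsub>monoid_algebra TYPE('k) G\<^esub>}
    \<longleftrightarrow> (\<forall>a :: 'g \<Rightarrow> 'k. killed a \<longrightarrow> a = (\<lambda>_. 0))"
proof -
  have "(\<Inter>l \<in> spinal_B G \<X> \<Phi>. a_kernel (monoid_algebra TYPE('k) G) (monoid_algebra TYPE('k) H) (lin_ext l))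
      = {a. killed a}"
    using spinal_B_nonempty by (auto simp: killed_def a_kernel_def' monoid_algebra_simps)
  moreover have "killed (\<lambda>_. 0 :: 'k)" by (simp add: killed_def lin_ext_def)
  ultimately show ?thesis by (auto simp: monoid_algebra_simps)
qed

subsection \<open>Ideals strictly above the relations\<close>

text \<open>
  As \<open>H\<close> acts freely, distinct pairs \<open>(u, h)\<close> give distinct words \<open>u h(x)\<close>. So a further letter \<open>x\<close> turns the
  combination into one of words without group elements, and nothing cancels.
\<close>

lemma hom_combination_in_ideal:
  fixes e :: "'x list \<times> 'h \<Rightarrow> 'k::field"
  assumes "nekrashevych_ideal \<GG> \<X> (\<lambda>f. f) J"
    and e: "finite (supp e)" "supp e \<subseteq> lists \<X> \<times> carrier H" "supp e \<noteq> {}"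
    and eJ: "lin_ext (\<lambda>(u, h). normal_word (u, Hperm h)) e \<in> J"
  shows "J = carrier (free_star_algebra TYPE('k) (\<X> <+> carrier \<GG>))"
proof -
  interpret J: nekrashevych_ideal \<GG> \<X> "\<lambda>f. f" J by fact
  obtain x where x: "x \<in> \<X>" using X_nonempty by blast
  let ?r = "\<lambda>(u, h). u @ [act h x]"
  have weq: "J.W.weq (normal_word (u, Hperm h) @ lt_word [x]) (lt_word (u @ [act h x]))"
    if "u \<in> lists \<X>" "h \<in> carrier H" for u h
  proof -
    have hx: "act h x \<in> \<X>" using act_H x that by blast
    have "J.W.weq (normal_word (u, Hperm h) @ lt_word [x]) (normal_word (u @ [act h x], \<one>\<^bsub>\<GG>\<^esub>))"
      using that x hx Hperm_\<GG> SS.act_one by (intro J.normal_word_lt_word) (auto simp: Hperm_apply)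
    moreover have "J.W.weq (lt_word (u @ [act h x]) @ [(Inr \<one>\<^bsub>\<GG>\<^esub>, False)]) (lt_word (u @ [act h x]) @ [])"
      using that hx by (intro J.weq_prefix J.gr_one) (simp add: star_words_simps)
    ultimately show ?thesis
      using J.W.weq_trans[of _ "normal_word (u @ [act h x], \<one>\<^bsub>\<GG>\<^esub>)"] by (simp add: normal_word_def)
  qed
  have "lin_ext (\<lambda>w. w @ lt_word [x]) (lin_ext (\<lambda>(u, h). normal_word (u, Hperm h)) e) \<in> J
      \<longleftrightarrow> lin_ext lt_word (lin_ext ?r e) \<in> J"
  proof (rule J.lin_ext_translate[OF e(1)])
    fix p assume "p \<in> supp e"
    then obtain u h where "p = (u, h)" "u \<in> lists \<X>" "h \<in> carrier H" using e(2) by (cases p) auto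
    then show "J.W.weq ((\<lambda>(u, h). normal_word (u, Hperm h)) p @ lt_word [x]) (lt_word (?r p))"
      using weq[of u h] by simp
  qed
  then have "lin_ext lt_word (lin_ext ?r e) \<in> J"
    using J.lt_translate[OF eJ, of "[x]"] x by simp
  moreover have inj: "inj_on ?r (supp e)"
  proof (rule inj_onI)
    fix p p' assume p: "p \<in> supp e" "p' \<in> supp e" and eq: "?r p = ?r p'"
    obtain u h u' h' where uh: "p = (u, h)" "p' = (u', h')" "h \<in> carrier H" "h' \<in> carrier H"
      using p e(2) by (cases p; cases p') auto
    have "u = u'" "act h x = act h' x" using eq uh by auto
    then show "p = p'" using act_H_inj[OF uh(3,4) x] uh by simp
  qed
  moreover have "supp (lin_ext ?r e) \<noteq> {}"
  proof -
    obtain p where p: "p \<in> supp e" using e(3) by blast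
    then have "lin_ext ?r e (?r p) \<noteq> 0" using lin_ext_inj[OF inj p] by (simp add: supp_def)
    then show ?thesis unfolding supp_def by blast
  qed
  moreover have "supp (lin_ext ?r e) \<subseteq> lists \<X>"
  proof -
    have "?r ` (lists \<X> \<times> carrier H) \<subseteq> lists \<X>" using act_H(1)[OF _ x] by auto
    then have "?r ` supp e \<subseteq> lists \<X>" using e(2) by blast
    then show ?thesis using supp_lin_ext[of ?r e] by blast
  qed
  ultimately show ?thesis
    using J.lt_combination_in_J finite_supp_lin_ext[OF e(1)] by blast
qed

text \<open>
  For a fixed word \<open>u\<close>, the coefficients form an element of \<open>KG\<close>. It has a nonzero image under some \<open>\<lambda> \<in> B\<close>,
  and multiplication by a word along which \<open>\<lambda>\<close> is read off replaces it by this image.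
\<close>

lemma aut_combination_in_ideal:
  fixes d :: "'x list \<times> 'g \<Rightarrow> 'k::field"
  assumes "nekrashevych_ideal \<GG> \<X> (\<lambda>f. f) J"
    and no_killed: "\<And>a :: 'g \<Rightarrow> 'k. killed a \<Longrightarrow> a = (\<lambda>_. 0)"
    and d: "finite (supp d)" "supp d \<subseteq> lists \<X> \<times> carrier G" "supp d \<noteq> {}"
    and dJ: "lin_ext (\<lambda>(u, g). normal_word (u, Gperm g)) d \<in> J"
  shows "J = carrier (free_star_algebra TYPE('k) (\<X> <+> carrier \<GG>))"
proof -
  interpret J: nekrashevych_ideal \<GG> \<X> "\<lambda>f. f" J by fact
  obtain u0 g0 where ug: "(u0, g0) \<in> supp d" using d(3) by force
  let ?a = "\<lambda>g. d (u0, g)"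
  have supp_a: "supp ?a = {g. (u0, g) \<in> supp d}" by (auto simp: supp_def)
  have fin_a: "finite (supp ?a)" "supp ?a \<subseteq> carrier G"
    using finite_subset[of "supp ?a" "snd ` supp d"] d unfolding supp_a by force+
  have "?a \<noteq> (\<lambda>_. 0)" using ug by (auto simp: supp_def dest: fun_cong)
  then have "\<not> killed ?a" using no_killed by blast
  then obtain l where l: "l \<in> spinal_B G \<X> \<Phi>" "lin_ext l ?a \<noteq> (\<lambda>_. 0)"
    using fin_a by (auto simp: killed_def)
  then obtain h where h: "lin_ext l ?a h \<noteq> 0" by blast
  obtain q where q: "q \<in> lists \<X>" "\<And>g w. g \<in> carrier G \<Longrightarrow> gact g (q @ w) = q @ hact (l g) w"
    using spinal_B_path[OF l(1)] by blast
  note lH = hom_GH(1)[OF spinal_B_hom[OF l(1)]]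
  let ?r = "\<lambda>(u, g). (u @ q, l g)"
  let ?e = "lin_ext ?r d"
  have weq: "J.W.weq (normal_word (u, Gperm g) @ lt_word q) (normal_word (u @ q, Hperm (l g)))"
    if "u \<in> lists \<X>" "g \<in> carrier G" for u g
    using that q lH Gperm_\<GG> Hperm_\<GG>
    by (intro J.normal_word_lt_word) (simp_all add: Gperm_apply Hperm_apply del: in_lists_conv_set)
  have "lin_ext (\<lambda>w. w @ lt_word q) (lin_ext (\<lambda>(u, g). normal_word (u, Gperm g)) d) \<in> J
      \<longleftrightarrow> lin_ext (\<lambda>(u, h). normal_word (u, Hperm h)) ?e \<in> J"
  proof (rule J.lin_ext_translate[OF d(1)])
    fix p assume "p \<in> supp d"
    then obtain u g where "p = (u, g)" "u \<in> lists \<X>" "g \<in> carrier G" using d(2) by (cases p) auto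
    then show "J.W.weq ((\<lambda>(u, g). normal_word (u, Gperm g)) p @ lt_word q)
        ((\<lambda>(u, h). normal_word (u, Hperm h)) (?r p))"
      using weq[of u g] by simp
  qed
  then have "lin_ext (\<lambda>(u, h). normal_word (u, Hperm h)) ?e \<in> J"
    using J.lt_translate[OF dJ q(1)] by simp
  moreover have "?e (u0 @ q, h) = lin_ext l ?a h"
  proof -
    have "{p \<in> supp d. ?r p = (u0 @ q, h)} = Pair u0 ` {g \<in> supp ?a. l g = h}"
      unfolding supp_a by auto
    then show ?thesis
      by (simp add: lin_ext_def[of ?r] lin_ext_def[of l] sum.reindex inj_on_def)
  qed
  then have "(u0 @ q, h) \<in> supp ?e" using h by (simp add: supp_def)
  moreover have "supp ?e \<subseteq> lists \<X> \<times> carrier H"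
  proof -
    have "?r ` (lists \<X> \<times> carrier G) \<subseteq> lists \<X> \<times> carrier H" using q(1) lH by auto
    then have "?r ` supp d \<subseteq> lists \<X> \<times> carrier H" using d(2) by blast
    then show ?thesis using supp_lin_ext[of ?r d] by blast
  qed
  ultimately show ?thesis
    using hom_combination_in_ideal[OF assms(1) finite_supp_lin_ext[OF d(1)]] by blast
qed

text \<open>After a letter \<open>y\<close>, all group elements lie in \<open>G\<close> or all lie in \<open>H\<close>; here \<open>D\<close> stands for either.\<close>

lemma descend_one_letter:
  fixes I J :: "((('x + ('x list \<Rightarrow> 'x list)) \<times> bool) list \<Rightarrow> 'k::field) set"
    and D :: "'i set" and p :: "'i \<Rightarrow> 'x list \<Rightarrow> 'x list"
  assumes I: "nekrashevych_ideal \<GG> \<X> (\<lambda>f. f) I" and J: "nekrashevych_ideal \<GG> \<X> (\<lambda>f. f) J"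
    and c: "finite (supp c)" "supp c \<subseteq> lists \<X> \<times> nucleus" and y: "y \<in> \<X>"
    and yI: "lin_ext (\<lambda>w. w @ lt_word [y]) (lin_ext normal_word c) \<notin> I"
    and yJ: "lin_ext (\<lambda>w. w @ lt_word [y]) (lin_ext normal_word c) \<in> J"
    and D: "\<And>g. g \<in> D \<Longrightarrow> p g \<in> carrier \<GG>"
    and ex: "\<And>s. s \<in> nucleus \<Longrightarrow> \<exists>z g. z \<in> \<X> \<and> g \<in> D \<and> (\<forall>w \<in> lists \<X>. s (y # w) = z # p g w)"
  shows "\<exists>d. finite (supp d) \<and> supp d \<subseteq> lists \<X> \<times> D \<and> supp d \<noteq> {} \<and>
      lin_ext (\<lambda>(u, g). normal_word (u, p g)) d \<in> J"
proof -
  interpret I: nekrashevych_ideal \<GG> \<X> "\<lambda>f. f" I by fact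
  obtain r1 r2 where r: "\<And>s. s \<in> nucleus \<Longrightarrow> r1 s \<in> \<X>" "\<And>s. s \<in> nucleus \<Longrightarrow> r2 s \<in> D"
    "\<And>s w. s \<in> nucleus \<Longrightarrow> w \<in> lists \<X> \<Longrightarrow> s (y # w) = r1 s # p (r2 s) w"
    using ex by metis
  let ?r = "\<lambda>(u, s). (u @ [r1 s], r2 s)"
  let ?n = "\<lambda>(u, g). normal_word (u, p g)"
  let ?d = "lin_ext ?r c"
  have fin: "finite (supp ?d)" using c(1) by (rule finite_supp_lin_ext)
  have "?r ` (lists \<X> \<times> nucleus) \<subseteq> lists \<X> \<times> D" using r(1,2) by auto
  then have "?r ` supp c \<subseteq> lists \<X> \<times> D" using c(2) by blast
  then have sub: "supp ?d \<subseteq> lists \<X> \<times> D" using supp_lin_ext[of ?r c] by blast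
  have in_ideal: "lin_ext (\<lambda>w. w @ lt_word [y]) (lin_ext normal_word c) \<in> L \<longleftrightarrow> lin_ext ?n ?d \<in> L"
    if "nekrashevych_ideal \<GG> \<X> (\<lambda>f. f) L" for L :: "((('x + ('x list \<Rightarrow> 'x list)) \<times> bool) list \<Rightarrow> 'k) set"
  proof -
    interpret L: nekrashevych_ideal \<GG> \<X> "\<lambda>f. f" L by fact
    have weq: "L.W.weq (normal_word (u, s) @ lt_word [y]) (normal_word (u @ [r1 s], p (r2 s)))"
      if "u \<in> lists \<X>" "s \<in> nucleus" for u s
      using that y r D nucleus_sub by (intro L.normal_word_lt_word) auto
    show ?thesis
    proof (rule L.lin_ext_translate[OF c(1)])
      fix q assume "q \<in> supp c"
      then obtain u s where "q = (u, s)" "u \<in> lists \<X>" "s \<in> nucleus" using c(2) by (cases q) auto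
      then show "L.W.weq (normal_word q @ lt_word [y]) (?n (?r q))"
        using weq[of u s] by simp
    qed
  qed
  have "lin_ext ?n ?d \<notin> I" using in_ideal[OF I] yI by blast
  moreover have "lin_ext ?n ?d \<in> J" using in_ideal[OF J] yJ by blast
  moreover have "supp ?d \<noteq> {}"
  proof
    assume "supp ?d = {}"
    then have "lin_ext ?n ?d = (\<lambda>_. 0)" by (simp add: lin_ext_def)
    then show False using \<open>lin_ext ?n ?d \<notin> I\<close> I.W.J_zero by simp
  qed
  ultimately show ?thesis using fin sub by blast
qed

text \<open>
  The ideal \<open>I\<close> stands for the relations. An element outside \<open>I\<close> is brought into normal form by multiplication with
  words, in such a way that the result stays outside \<open>I\<close>, hence has a nonzero coefficient, and stays in \<open>J\<close>.
\<close>

lemma ideal_above_relations: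
  fixes I J :: "((('x + ('x list \<Rightarrow> 'x list)) \<times> bool) list \<Rightarrow> 'k::field) set"
  assumes I: "ideal I (free_star_algebra TYPE('k) (\<X> <+> carrier \<GG>))"
    and J: "ideal J (free_star_algebra TYPE('k) (\<X> <+> carrier \<GG>))"
    and rel: "nekrashevych_relators TYPE('k) \<GG> \<X> (\<lambda>f. f) \<subseteq> I" and IJ: "I \<subseteq> J" "J \<noteq> I"
    and no_killed: "\<And>a :: 'g \<Rightarrow> 'k. killed a \<Longrightarrow> a = (\<lambda>_. 0)"
  shows "J = carrier (free_star_algebra TYPE('k) (\<X> <+> carrier \<GG>))"
proof -
  have relJ: "nekrashevych_relators TYPE('k) \<GG> \<X> (\<lambda>f. f) \<subseteq> J" using rel IJ(1) by blast
  interpret I: contracting_nekrashevych_ideal \<GG> \<X> "\<lambda>f. f" I nucleus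
    by (rule nucleus_contracting[OF I rel])
  interpret J: contracting_nekrashevych_ideal \<GG> \<X> "\<lambda>f. f" J nucleus
    by (rule nucleus_contracting[OF J relJ])
  have nI: "nekrashevych_ideal \<GG> \<X> (\<lambda>f. f) I" by (rule I.nekrashevych_ideal_axioms)
  have nJ: "nekrashevych_ideal \<GG> \<X> (\<lambda>f. f) J" by (rule J.nekrashevych_ideal_axioms)
  obtain a where a: "a \<in> J" "a \<notin> I" using IJ by blast
  have aF: "a \<in> carrier (free_star_algebra TYPE('k) (\<X> <+> carrier \<GG>))"
    using additive_subgroup.a_subset[OF ideal.axioms(1)[OF J]] a(1) by blast
  obtain v c where v: "v \<in> lists \<X>" and c: "finite (supp c)" "supp c \<subseteq> lists \<X> \<times> nucleus"
    and av: "lin_ext (\<lambda>w. w @ lt_word v) a \<notin> I"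
    and avc: "(\<lambda>w. lin_ext (\<lambda>w. w @ lt_word v) a w - lin_ext normal_word c w) \<in> I"
    using I.normal_form_outside_J[OF aF a(2)] .
  let ?f = "lin_ext normal_word c"
  have fI: "?f \<notin> I" using I.W.J_cong[OF avc] av by blast
  have fJ: "?f \<in> J"
    using J.W.J_cong[of "lin_ext (\<lambda>w. w @ lt_word v) a" ?f] avc IJ(1) J.lt_translate[OF a(1) v] by blast
  have fF: "?f \<in> carrier (free_star_algebra TYPE('k) (\<X> <+> carrier \<GG>))"
    using additive_subgroup.a_subset[OF ideal.axioms(1)[OF J]] fJ by blast
  obtain y where y: "y \<in> \<X>" "lin_ext (\<lambda>w. w @ lt_word [y]) ?f \<notin> I"
  proof -
    obtain v where "v \<in> lists \<X>" "length v = 1" "lin_ext (\<lambda>w. w @ lt_word v) ?f \<notin> I"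
      using I.in_J_if_translates[OF fF, of 1] fI by blast
    then show ?thesis using that by (cases v) auto
  qed
  have yJ: "lin_ext (\<lambda>w. w @ lt_word [y]) ?f \<in> J" using J.lt_translate[OF fJ, of "[y]"] y(1) by simp
  from y(1) show ?thesis
  proof (cases rule: letter_type_cases)
    case (1 \<alpha>)
    have "\<exists>z g. z \<in> \<X> \<and> g \<in> carrier G \<and> (\<forall>w \<in> lists \<X>. s (y # w) = z # Gperm g w)" if "s \<in> nucleus" for s
    proof -
      from that consider g where "g \<in> carrier G" "s = Gperm g" | h where "h \<in> carrier H" "s = Hperm h"
        by (auto simp: nucleus_def)
      then show ?thesis
      proof cases
        case (1 g)
        then show ?thesis using \<open>\<Phi> y = Inl \<alpha>\<close> y(1) auto_hom(1)[OF \<open>\<alpha> \<in> auto G\<close>]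
          by (intro exI[of _ y] exI[of _ "\<alpha> g"]) (auto simp: Gperm_apply)
      next
        case (2 h)
        then show ?thesis using y(1)
          by (intro exI[of _ "act h y"] exI[of _ "\<one>\<^bsub>G\<^esub>"]) (auto simp: Gperm_apply Hperm_apply act_H gact_one)
      qed
    qed
    then obtain d where "finite (supp d)" "supp d \<subseteq> lists \<X> \<times> carrier G" "supp d \<noteq> {}"
      "lin_ext (\<lambda>(u, g). normal_word (u, Gperm g)) d \<in> J"
      using descend_one_letter[OF nI nJ c y yJ, of "carrier G" Gperm] Gperm_\<GG> by blast
    then show ?thesis by (intro aut_combination_in_ideal[OF nJ no_killed])
  next
    case (2 l)
    have "\<exists>z h. z \<in> \<X> \<and> h \<in> carrier H \<and> (\<forall>w \<in> lists \<X>. s (y # w) = z # Hperm h w)" if "s \<in> nucleus" for s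
    proof -
      from that consider g where "g \<in> carrier G" "s = Gperm g" | h where "h \<in> carrier H" "s = Hperm h"
        by (auto simp: nucleus_def)
      then show ?thesis
      proof cases
        case (1 g)
        then show ?thesis using \<open>\<Phi> y = Inr l\<close> y(1) hom_GH(1)[OF \<open>l \<in> hom G H\<close>]
          by (intro exI[of _ y] exI[of _ "l g"]) (auto simp: Gperm_apply Hperm_apply)
      next
        case (2 h)
        then show ?thesis using y(1)
          by (intro exI[of _ "act h y"] exI[of _ "\<one>\<^bsub>H\<^esub>"]) (auto simp: Hperm_apply act_H hact_one)
      qed
    qed
    then obtain d where "finite (supp d)" "supp d \<subseteq> lists \<X> \<times> carrier H" "supp d \<noteq> {}"
      "lin_ext (\<lambda>(u, g). normal_word (u, Hperm g)) d \<in> J"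
      using descend_one_letter[OF nI nJ c y yJ, of "carrier H" Hperm] Hperm_\<GG> by blast
    then show ?thesis by (intro hom_combination_in_ideal[OF nJ])
  qed
qed

end

section \<open>The criterion in terms of group algebras\<close>

lemma evaluate_cong: "(\<And>w. w \<in> supp a \<Longrightarrow> h w = h' w) \<Longrightarrow> evaluate h a = evaluate h' a"
  by (simp add: evaluate_def)

context multispinal_data
begin

interpretation H': group H by (rule group_H)

lemma gact_replicate:
  assumes "\<Phi> x = Inl \<alpha>"
  shows "gact k (replicate n x @ z) = replicate n x @ gact ((\<alpha> ^^ n) k) z"
  by (induction n arbitrary: k) (simp_all add: assms funpow_swap1)

lemma auto_funpow:
  assumes "\<alpha> \<in> auto G" "k \<in> carrier G"
  shows "(\<alpha> ^^ n) k \<in> carrier G \<and> ((\<alpha> ^^ n) k = \<one>\<^bsub>G\<^esub> \<longrightarrow> k = \<one>\<^bsub>G\<^esub>)"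
proof (induction n)
  case (Suc n)
  have "(\<alpha> ^^ n) k = \<one>\<^bsub>G\<^esub>" if "\<alpha> ((\<alpha> ^^ n) k) = \<one>\<^bsub>G\<^esub>"
    using inj_onD[OF auto_hom(4)[OF assms(1)], of "(\<alpha> ^^ n) k" "\<one>\<^bsub>G\<^esub>"] that Suc auto_hom(3)[OF assms(1)] by simp
  then show ?case using Suc auto_hom(1)[OF assms(1)] by auto
qed (simp add: assms)

lemma pointed:
  "x0 \<in> \<X> \<Longrightarrow> pointed_self_similar_group \<GG> \<X> (\<lambda>f. f) x0"
  by (intro pointed_self_similar_group.intro pointed_self_similar_group_axioms.intro \<GG>_self_similar)

context
  fixes x0 \<alpha>0
  assumes x0: "x0 \<in> \<X>" "\<Phi> x0 = Inl \<alpha>0" "\<alpha>0 \<in> auto G"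
begin

interpretation P: pointed_self_similar_group \<GG> \<X> "\<lambda>f. f" x0
  by (rule pointed[OF x0(1)])

lemma ev_lists: "P.ev (\<lambda>i. i \<in> lists \<X>)"
  using x0(1) by (auto simp: P.ev_def)

lemma germ_ident: "P.germ (\<lambda>i. i)"
  unfolding P.germ_def
proof
  fix m
  have "P.ev (\<lambda>i. i \<in> lists \<X> \<and> take m i = replicate m x0)"
    unfolding P.ev_def using x0(1) by (intro exI[of _ m]) auto
  then show "\<exists>p\<in>lists \<X>. length p = m \<and> P.ev (\<lambda>i. i \<in> lists \<X> \<and> take m i = p)"
    using x0(1) by (intro bexI[of _ "replicate m x0"]) auto
qed

text \<open>
  On words that begin with \<open>n\<close> letters \<open>x0\<close>, \<open>k\<close> acts as \<open>\<alpha>0\<^sup>n(k)\<close>, and \<open>\<alpha>0\<close> is injective.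
\<close>

lemma ev_gact_trivial:
  assumes k: "k \<in> carrier G" and ev: "P.ev (\<lambda>i. gact k i = i)"
  shows "k = \<one>\<^bsub>G\<^esub>"
proof -
  obtain n where n: "\<And>z. z \<in> lists \<X> \<Longrightarrow> gact k (replicate n x0 @ z) = replicate n x0 @ z"
    using ev unfolding P.ev_def by blast
  then have "(\<alpha>0 ^^ n) k = \<one>\<^bsub>G\<^esub>"
    using auto_funpow[OF x0(3) k] by (intro gact_faithful) (auto simp: gact_replicate[OF x0(2)])
  then show ?thesis using auto_funpow[OF x0(3) k] by blast
qed

definition group_element :: "('g \<Rightarrow> 'k::field) \<Rightarrow> (('x + ('x list \<Rightarrow> 'x list)) \<times> bool) list \<Rightarrow> 'k" where
  "group_element = lin_ext (\<lambda>g. [(Inr (Gperm g), False)])"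

lemma evaluate_group_element:
  assumes "finite (supp a)" "supp a \<subseteq> carrier G"
  shows "evaluate (\<lambda>w. P.word_op w f F) (group_element a)
    = evaluate (\<lambda>g. f (\<lambda>i. Gperm (inv\<^bsub>G\<^esub> g) (F i))) a"
  unfolding group_element_def evaluate_lin_ext[OF assms(1)]
  using assms(2) by (intro evaluate_cong) (auto simp: Gperm_inv)

text \<open>
  The indicator function of the germ of the identity is moved by \<open>g\<close> to that of the germ of \<open>g\<close>. These germs are
  distinct, so evaluation at the germ of \<open>g0\<close> recovers the coefficient of \<open>g0\<close>.
\<close>

lemma group_element_nonzero:
  assumes a: "finite (supp a)" "supp a \<subseteq> carrier G" "a \<noteq> (\<lambda>_. 0 :: 'k::field)"
  shows "group_element a \<notin> P.germ_annihilator P.same_germ"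
proof
  assume mem: "group_element a \<in> P.germ_annihilator P.same_germ"
  obtain g0 where g0: "g0 \<in> supp a" using a(3) by (auto simp: supp_def)
  then have g0G: "g0 \<in> carrier G" using a(2) by blast
  let ?f = "\<lambda>F. if P.ev (\<lambda>i. F i = i) then 1 else 0 :: 'k"
  let ?F = "\<lambda>i. Gperm g0 i"
  have "P.germ_invariant P.same_germ ?f"
  proof -
    have "P.ev (\<lambda>i. F i = i) \<longleftrightarrow> P.ev (\<lambda>i. F' i = i)" if eq: "P.ev (\<lambda>i. F i = F' i)" for F F'
    proof
      show "P.ev (\<lambda>i. F' i = i)" if "P.ev (\<lambda>i. F i = i)" using eq that by (rule P.ev_mono2) simp
      show "P.ev (\<lambda>i. F i = i)" if "P.ev (\<lambda>i. F' i = i)" using eq that by (rule P.ev_mono2) simp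
    qed
    then show ?thesis by (simp add: P.germ_invariant_def P.same_germ_def)
  qed
  moreover have "P.germ ?F" using P.germ_act[OF germ_ident Gperm_\<GG>[OF g0G]] .
  ultimately have "evaluate (\<lambda>w. P.word_op w ?f ?F) (group_element a) = 0"
    using mem unfolding P.germ_annihilator_def by blast
  then have "evaluate (\<lambda>g. ?f (\<lambda>i. Gperm (inv\<^bsub>G\<^esub> g) (Gperm g0 i))) a = 0"
    by (simp add: evaluate_group_element[OF a(1,2)])
  moreover have "?f (\<lambda>i. Gperm (inv\<^bsub>G\<^esub> g) (Gperm g0 i)) = (if g = g0 then 1 else 0)" if g: "g \<in> supp a" for g
  proof -
    have gG: "g \<in> carrier G" using g a(2) by blast
    have eq: "Gperm (inv\<^bsub>G\<^esub> g) (Gperm g0 i) = gact (inv\<^bsub>G\<^esub> g \<otimes>\<^bsub>G\<^esub> g0) i" if "i \<in> lists \<X>" for i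
    proof -
      have "gact g0 i \<in> lists \<X>" using gact_closed[OF g0G that] .
      then show ?thesis using gact_mult[of "inv\<^bsub>G\<^esub> g" g0 i] that gG g0G by (simp only: Gperm_apply G.inv_closed)
    qed
    have "g = g0" if "P.ev (\<lambda>i. Gperm (inv\<^bsub>G\<^esub> g) (Gperm g0 i) = i)"
    proof -
      have "P.ev (\<lambda>i. gact (inv\<^bsub>G\<^esub> g \<otimes>\<^bsub>G\<^esub> g0) i = i)"
        using ev_lists that by (rule P.ev_mono2) (metis eq)
      then have "inv\<^bsub>G\<^esub> g \<otimes>\<^bsub>G\<^esub> g0 = \<one>\<^bsub>G\<^esub>" using gG g0G by (intro ev_gact_trivial) auto
      then have "inv\<^bsub>G\<^esub> g0 = inv\<^bsub>G\<^esub> g" using gG g0G by (intro G.inv_equality) auto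
      then show ?thesis using gG g0G by (metis G.inv_inv)
    qed
    moreover have "P.ev (\<lambda>i. Gperm (inv\<^bsub>G\<^esub> g) (Gperm g0 i) = i)" if "g = g0"
      by (rule P.ev_mono[OF ev_lists]) (use eq that g0G gact_one in simp)
    ultimately show ?thesis by auto
  qed
  ultimately have "evaluate (\<lambda>g. if g = g0 then 1 else 0) a = 0"
    using evaluate_cong[of a "\<lambda>g. ?f (\<lambda>i. Gperm (inv\<^bsub>G\<^esub> g) (Gperm g0 i))" "\<lambda>g. if g = g0 then 1 else 0"]
    by (simp only:)
  then have "(\<Sum>g\<in>supp a. if g = g0 then a g else 0) = 0"
    unfolding evaluate_def by (simp add: if_distrib cong: if_cong)
  then have "a g0 = 0" using a(1) g0 by simp
  then show False using g0 by (simp add: supp_def)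
qed

text \<open>
  On functions of points, \<open>G\<close> acts through some \<open>\<lambda> \<in> B\<close>: if the point has a letter in \<open>Hom(G,H)\<close>,
  the first one determines \<open>\<lambda>\<close>; otherwise \<open>G\<close> fixes the point and any \<open>\<lambda>\<close> will do.
\<close>

lemma point_action_factors:
  assumes f: "P.germ_invariant P.same_point f" and F: "P.germ F"
  shows "\<exists>l \<in> spinal_B G \<X> \<Phi>. \<exists>\<phi>. \<forall>g \<in> carrier G. f (\<lambda>i. Gperm (inv\<^bsub>G\<^esub> g) (F i)) = \<phi> (l g)"
proof -
  have germ: "P.germ (\<lambda>i. Gperm g (F i))" if "g \<in> carrier G" for g
    using P.germ_act[OF F Gperm_\<GG>[OF that]] .
  show ?thesis
  proof (cases "\<exists>m p. p \<in> lists \<X> \<and> P.ev (\<lambda>i. F i \<in> lists \<X> \<and> take m (F i) = p) \<and> (\<exists>x \<in> set p. \<Phi> x \<notin> range Inl)")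
    case True
    then obtain m p where p: "p \<in> lists \<X>" "P.ev (\<lambda>i. F i \<in> lists \<X> \<and> take m (F i) = p)"
      "\<exists>x \<in> set p. \<Phi> x \<notin> range Inl" by blast
    obtain q z r where qzr: "p = q @ z # r" "\<Phi> z \<notin> range Inl" "\<forall>x \<in> set q. \<not> \<Phi> x \<notin> range Inl"
      using split_list_first_prop[OF p(3)] by blast
    have qz: "q \<in> lists \<X>" "z \<in> \<X>" using p(1) qzr(1) by auto
    obtain l where l: "l \<in> spinal_B G \<X> \<Phi>"
      "\<And>g w. g \<in> carrier G \<Longrightarrow> gact g ((q @ [z]) @ w) = (q @ [z]) @ hact (l g) w"
      using first_hom_letter[OF qz _ qzr(2)] qzr(3) by blast
    have same: "f (\<lambda>i. Gperm (inv\<^bsub>G\<^esub> g) (F i)) = f (\<lambda>i. Gperm (inv\<^bsub>G\<^esub> g') (F i))"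
      if g: "g \<in> carrier G" "g' \<in> carrier G" "l g = l g'" for g g'
    proof -
      have inv: "l (inv\<^bsub>G\<^esub> g) = l (inv\<^bsub>G\<^esub> g')"
        using group_hom.hom_inv[of G H l] spinal_B_hom[OF l(1)] g group_H G.is_group
        by (simp add: group_hom_def group_hom_axioms_def)
      have "Gperm (inv\<^bsub>G\<^esub> g) w = Gperm (inv\<^bsub>G\<^esub> g') w" if w: "w \<in> lists \<X> \<and> take m w = p" for w
      proof -
        have "w = (q @ [z]) @ (r @ drop m w)"
          using w qzr(1) by (metis append.assoc append_Cons append_Nil append_take_drop_id)
        then have "gact (inv\<^bsub>G\<^esub> g) w = gact (inv\<^bsub>G\<^esub> g') w"
          using l(2) inv g(1,2) by (metis G.inv_closed)
        then show ?thesis using w by (simp only: Gperm_apply)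
      qed
      then have "P.same_germ (\<lambda>i. Gperm (inv\<^bsub>G\<^esub> g) (F i)) (\<lambda>i. Gperm (inv\<^bsub>G\<^esub> g') (F i))"
        unfolding P.same_germ_def by (rule P.ev_mono[OF p(2)])
      then have "P.same_point (\<lambda>i. Gperm (inv\<^bsub>G\<^esub> g) (F i)) (\<lambda>i. Gperm (inv\<^bsub>G\<^esub> g') (F i))"
        using P.same_point_congruence unfolding P.germ_congruence_def by blast
      then show ?thesis using f germ g unfolding P.germ_invariant_def by (metis G.inv_closed)
    qed
    define s where "s = inv_into (carrier G) l"
    have s: "s (l g) \<in> carrier G" "l (s (l g)) = l g" if "g \<in> carrier G" for g
      using that by (simp_all add: s_def inv_into_into f_inv_into_f)
    have "f (\<lambda>i. Gperm (inv\<^bsub>G\<^esub> g) (F i)) = f (\<lambda>i. Gperm (inv\<^bsub>G\<^esub> (s (l g))) (F i))" if g: "g \<in> carrier G" for g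
      using same[OF g s(1)[OF g] s(2)[OF g, symmetric]] .
    then show ?thesis using l(1)
      by (intro bexI[of _ l] exI[of _ "\<lambda>h. f (\<lambda>i. Gperm (inv\<^bsub>G\<^esub> (s h)) (F i))"] ballI)
  next
    case False
    have "f (\<lambda>i. Gperm (inv\<^bsub>G\<^esub> g) (F i)) = f F" if g: "g \<in> carrier G" for g
    proof -
      have gi: "inv\<^bsub>G\<^esub> g \<in> carrier G" using g by simp
      have "P.same_point (\<lambda>i. Gperm (inv\<^bsub>G\<^esub> g) (F i)) F"
        unfolding P.same_point_def
      proof
        fix m
        obtain p where p: "p \<in> lists \<X>" "P.ev (\<lambda>i. F i \<in> lists \<X> \<and> take m (F i) = p)"
          using F by (auto simp: P.germ_def)
        then have "\<And>x. x \<in> set p \<Longrightarrow> \<Phi> x \<in> range Inl" using False by blast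
        from aut_word[OF p(1) this] obtain \<beta> where "\<And>w. gact (inv\<^bsub>G\<^esub> g) (p @ w) = p @ gact (\<beta> (inv\<^bsub>G\<^esub> g)) w"
          using gi by blast
        from this[of "[]"] have fix_p: "gact (inv\<^bsub>G\<^esub> g) p = p" by simp
        show "P.ev (\<lambda>i. take m (Gperm (inv\<^bsub>G\<^esub> g) (F i)) = take m (F i))"
        proof (rule P.ev_mono[OF p(2)])
          fix i assume i: "F i \<in> lists \<X> \<and> take m (F i) = p"
          then have "take m (Gperm (inv\<^bsub>G\<^esub> g) (F i)) = Gperm (inv\<^bsub>G\<^esub> g) p"
            using SS.take_act[OF Gperm_\<GG>[OF gi], of "F i" m] by simp
          then show "take m (Gperm (inv\<^bsub>G\<^esub> g) (F i)) = take m (F i)"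
            using i fix_p p(1) by (simp only: Gperm_apply)
        qed
      qed
      then show ?thesis using f germ[OF gi] F unfolding P.germ_invariant_def by blast
    qed
    moreover obtain l where "l \<in> spinal_B G \<X> \<Phi>" using spinal_B_nonempty by blast
    ultimately show ?thesis by (intro bexI[of _ l] exI[of _ "\<lambda>_. f F"]) auto
  qed
qed

lemma killed_annihilates:
  assumes "killed (a :: 'g \<Rightarrow> 'k::field)"
  shows "group_element a \<in> P.germ_annihilator P.same_point"
proof -
  have a: "finite (supp a)" "supp a \<subseteq> carrier G" using assms by (auto simp: killed_def)
  have "supp (group_element a) \<subseteq> (\<lambda>g. [(Inr (Gperm g), False)]) ` supp a"
    unfolding group_element_def by (rule supp_lin_ext)
  also have "\<dots> \<subseteq> carrier P.W\<Gamma>" using a(2) Gperm_\<GG> by (auto simp: star_words_simps)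
  finally have "group_element a \<in> carrier (monoid_algebra TYPE('k) P.W\<Gamma>)"
    using finite_supp_lin_ext[OF a(1)] by (simp add: monoid_algebra_simps group_element_def)
  moreover have "evaluate (\<lambda>w. P.word_op w f F) (group_element a) = 0"
    if f: "P.germ_invariant P.same_point f" and F: "P.germ F" for f F
  proof -
    obtain l \<phi> where l: "l \<in> spinal_B G \<X> \<Phi>"
      "\<And>g. g \<in> carrier G \<Longrightarrow> f (\<lambda>i. Gperm (inv\<^bsub>G\<^esub> g) (F i)) = \<phi> (l g)"
      using point_action_factors[OF f F] by blast
    have "evaluate (\<lambda>w. P.word_op w f F) (group_element a) = evaluate (\<lambda>g. \<phi> (l g)) a"
      unfolding evaluate_group_element[OF a] using a(2) l(2) by (intro evaluate_cong) auto
    also have "\<dots> = evaluate \<phi> (lin_ext l a)" using a(1) by (rule evaluate_lin_ext[symmetric])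
    also have "lin_ext l a = (\<lambda>_. 0)" using assms l(1) by (simp add: killed_def)
    finally show ?thesis by (simp add: evaluate_def)
  qed
  ultimately show ?thesis unfolding P.germ_annihilator_def by blast
qed

lemma one_not_annihilated:
  "(delta [] :: _ \<Rightarrow> 'k::field) \<notin> P.germ_annihilator R"
proof
  assume "(delta [] :: _ \<Rightarrow> 'k) \<in> P.germ_annihilator R"
  moreover have "P.germ_invariant R (\<lambda>_. 1 :: 'k)" by (simp add: P.germ_invariant_def)
  ultimately have "evaluate (\<lambda>w. P.word_op w (\<lambda>_. 1 :: 'k) (\<lambda>i. i)) (delta []) = 0"
    using germ_ident unfolding P.germ_annihilator_def by blast
  then show False by (simp add: evaluate_delta)
qed

text \<open>
  A nonzero killed element separates the ideal of relations from the annihilator of the functions of points, which is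
  a proper ideal as it does not contain \<open>1\<close>.
\<close>

lemma simple_iff_no_killed_aux:
  "simple_ring (nekrashevych_algebra TYPE('k::field) \<GG> \<X> (\<lambda>f. f)) \<longleftrightarrow>
    (\<forall>a :: 'g \<Rightarrow> 'k. killed a \<longrightarrow> a = (\<lambda>_. 0))"
proof -
  let ?F = "monoid_algebra TYPE('k) P.W\<Gamma>"
  let ?N = "nekrashevych_relators TYPE('k) \<GG> \<X> (\<lambda>f. f)"
  let ?R = "?N \<union> free_star ` ?N"
  let ?I = "Idl\<^bsub>?F\<^esub> ?R"
  have ring: "ring ?F" by (intro monoid.monoid_algebra_ring star_words_monoid)
  interpret F: ring ?F by (rule ring)
  have R_sub: "?R \<subseteq> P.germ_annihilator P.same_germ" "?R \<subseteq> P.germ_annihilator P.same_point"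
    by (rule P.germ_annihilator_relators[OF P.same_germ_congruence] P.germ_annihilator_relators[OF P.same_point_congruence])+
  have id: "ideal (P.germ_annihilator P.same_germ) ?F" "ideal (P.germ_annihilator P.same_point) ?F"
    by (rule P.germ_annihilator_ideal[OF P.same_germ_congruence] P.germ_annihilator_ideal[OF P.same_point_congruence])+
  have "P.germ_annihilator P.same_germ \<subseteq> carrier ?F" unfolding P.germ_annihilator_def by blast
  then have RF: "?R \<subseteq> carrier ?F" using R_sub(1) by blast
  have I: "ideal ?I ?F" by (rule F.genideal_ideal[OF RF])
  have RI: "?R \<subseteq> ?I" by (rule F.genideal_self[OF RF])
  have IA: "?I \<subseteq> P.germ_annihilator P.same_germ" "?I \<subseteq> P.germ_annihilator P.same_point"
    by (rule F.genideal_minimal[OF id(1) R_sub(1)] F.genideal_minimal[OF id(2) R_sub(2)])+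
  have one: "delta [] \<in> carrier ?F" by (simp add: monoid_algebra_simps star_words_simps supp_delta)
  have "simple_ring (nekrashevych_algebra TYPE('k) \<GG> \<X> (\<lambda>f. f)) \<longleftrightarrow>
    ?I \<noteq> carrier ?F \<and> (\<forall>J. ideal J ?F \<and> ?I \<subseteq> J \<longrightarrow> J = ?I \<or> J = carrier ?F)"
    unfolding nekrashevych_algebra_def star_algebra_pres_def by (rule simple_quotient_iff[OF ring I])
  also have "\<dots> \<longleftrightarrow> (\<forall>a :: 'g \<Rightarrow> 'k. killed a \<longrightarrow> a = (\<lambda>_. 0))"
  proof
    assume "\<forall>a :: 'g \<Rightarrow> 'k. killed a \<longrightarrow> a = (\<lambda>_. 0)"
    then have "J = carrier ?F" if "ideal J ?F" "?I \<subseteq> J" "J \<noteq> ?I" for J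
      using RI by (intro ideal_above_relations[OF I that(1) _ that(2,3)]) auto
    moreover have "?I \<noteq> carrier ?F" using one one_not_annihilated IA(1) by blast
    ultimately show "?I \<noteq> carrier ?F \<and> (\<forall>J. ideal J ?F \<and> ?I \<subseteq> J \<longrightarrow> J = ?I \<or> J = carrier ?F)" by blast
  next
    assume simple: "?I \<noteq> carrier ?F \<and> (\<forall>J. ideal J ?F \<and> ?I \<subseteq> J \<longrightarrow> J = ?I \<or> J = carrier ?F)"
    show "\<forall>a :: 'g \<Rightarrow> 'k. killed a \<longrightarrow> a = (\<lambda>_. 0)"
    proof (intro allI impI, rule ccontr)
      fix a :: "'g \<Rightarrow> 'k" assume a: "killed a" "a \<noteq> (\<lambda>_. 0)"
      have "group_element a \<notin> ?I"
        using group_element_nonzero[OF _ _ a(2)] a(1) IA(1) unfolding killed_def by blast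
      then have "P.germ_annihilator P.same_point \<noteq> ?I" using killed_annihilates[OF a(1)] by blast
      then have "P.germ_annihilator P.same_point = carrier ?F" using simple id(2) IA(2) by blast
      then show False using one one_not_annihilated by blast
    qed
  qed
  finally show ?thesis .
qed

end

lemma simple_iff_no_killed:
  "simple_ring (nekrashevych_algebra TYPE('k::field) \<GG> \<X> (\<lambda>f. f)) \<longleftrightarrow>
    (\<forall>a :: 'g \<Rightarrow> 'k. killed a \<longrightarrow> a = (\<lambda>_. 0))"
proof -
  obtain \<alpha> where \<alpha>: "Inl \<alpha> \<in> \<Phi> ` \<X>" using S1 unfolding spinal_aut_def by blast
  then obtain x where "x \<in> \<X>" "\<Phi> x = Inl \<alpha>" by (metis imageE)
  moreover have "\<alpha> \<in> auto G" using \<alpha> spinal_aut_auto by (auto simp: spinal_aut_def)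
  ultimately show ?thesis by (rule simple_iff_no_killed_aux)
qed

subsection \<open>Bad characteristic\<close>

text \<open>
  A nonempty fibre is a coset of the kernel.
\<close>

lemma card_fibre:
  assumes m: "m \<in> hom G H"
  shows "card (kernel G H m) dvd card {g \<in> carrier G. m g = h}"
proof (cases "\<exists>g0 \<in> carrier G. m g0 = h")
  case True
  then obtain g0 where g0: "g0 \<in> carrier G" "m g0 = h" by blast
  have "bij_betw (\<lambda>k. g0 \<otimes>\<^bsub>G\<^esub> k) (kernel G H m) {g \<in> carrier G. m g = h}"
  proof (rule bij_betw_byWitness[where f' = "\<lambda>g. inv\<^bsub>G\<^esub> g0 \<otimes>\<^bsub>G\<^esub> g"])
    show "\<forall>k\<in>kernel G H m. inv\<^bsub>G\<^esub> g0 \<otimes>\<^bsub>G\<^esub> (g0 \<otimes>\<^bsub>G\<^esub> k) = k"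
      using g0 by (simp add: kernel_def G.m_assoc[symmetric])
    show "\<forall>g\<in>{g \<in> carrier G. m g = h}. g0 \<otimes>\<^bsub>G\<^esub> (inv\<^bsub>G\<^esub> g0 \<otimes>\<^bsub>G\<^esub> g) = g"
      using g0 by (simp add: G.m_assoc[symmetric])
    show "(\<lambda>k. g0 \<otimes>\<^bsub>G\<^esub> k) ` kernel G H m \<subseteq> {g \<in> carrier G. m g = h}"
      using g0 hom_GH[OF m] by (auto simp: kernel_def)
    have "m (inv\<^bsub>G\<^esub> g0 \<otimes>\<^bsub>G\<^esub> g) = \<one>\<^bsub>H\<^esub>" if "g \<in> carrier G" "m g = h" for g
    proof -
      have "m (inv\<^bsub>G\<^esub> g0 \<otimes>\<^bsub>G\<^esub> g) = m (inv\<^bsub>G\<^esub> g0 \<otimes>\<^bsub>G\<^esub> g0)" using that g0 by (simp only: hom_GH(2)[OF m] G.inv_closed)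
      also have "\<dots> = \<one>\<^bsub>H\<^esub>" using g0 hom_GH(3)[OF m] by simp
      finally show ?thesis .
    qed
    then show "(\<lambda>g. inv\<^bsub>G\<^esub> g0 \<otimes>\<^bsub>G\<^esub> g) ` {g \<in> carrier G. m g = h} \<subseteq> kernel G H m"
      using g0 by (auto simp: kernel_def)
  qed
  then show ?thesis by (simp add: bij_betw_same_card)
next
  case False
  then have "{g \<in> carrier G. m g = h} = {}" by blast
  then show ?thesis by (simp only: card.empty dvd_0_right)
qed

text \<open>
  The coefficients of the image under \<open>\<lambda>\<close> are the sizes of the fibres of \<open>\<lambda>\<close>. Composition with an automorphism
  does not change the sizes of fibres.
\<close>

lemma sum_of_group_killed:
  assumes "\<forall>l \<in> spinal_hom \<X> \<Phi>. CHAR('k::field) dvd card (kernel G H l)"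
  shows "killed (\<lambda>g. if g \<in> carrier G then 1 else 0 :: 'k)"
proof -
  let ?a = "\<lambda>g. if g \<in> carrier G then 1 else 0 :: 'k"
  have supp: "supp ?a = carrier G" by (auto simp: supp_def)
  have "lin_ext l ?a h = 0" if l: "l \<in> spinal_B G \<X> \<Phi>" for l h
  proof -
    obtain m \<alpha> where m: "m \<in> spinal_hom \<X> \<Phi>" "m \<in> hom G H" "\<alpha> \<in> auto G"
      "\<And>g. g \<in> carrier G \<Longrightarrow> l g = m (\<alpha> g)"
      using spinal_B_factor[OF l] by blast
    have "bij_betw \<alpha> (carrier G) (carrier G)" using m(3) by (auto simp: auto_def Bij_def)
    then have im: "\<alpha> ` carrier G = carrier G" by (simp add: bij_betw_def)
    have "\<alpha> ` {g \<in> carrier G. l g = h} = {g \<in> carrier G. m g = h}"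
    proof
      show "\<alpha> ` {g \<in> carrier G. l g = h} \<subseteq> {g \<in> carrier G. m g = h}"
        using m(4) auto_hom(1)[OF m(3)] by auto
      show "{g \<in> carrier G. m g = h} \<subseteq> \<alpha> ` {g \<in> carrier G. l g = h}"
      proof
        fix g assume g: "g \<in> {g \<in> carrier G. m g = h}"
        then obtain g' where "g' \<in> carrier G" "g = \<alpha> g'" using im by blast
        then show "g \<in> \<alpha> ` {g \<in> carrier G. l g = h}" using g m(4) by auto
      qed
    qed
    moreover have "card (\<alpha> ` {g \<in> carrier G. l g = h}) = card {g \<in> carrier G. l g = h}"
      by (rule card_image, rule inj_on_subset[OF auto_hom(4)[OF m(3)]]) blast
    ultimately have "card {g \<in> carrier G. l g = h} = card {g \<in> carrier G. m g = h}" by simp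
    moreover have "CHAR('k) dvd card {g \<in> carrier G. m g = h}"
      using assms m(1) card_fibre[OF m(2)] dvd_trans by blast
    ultimately have "of_nat (card {g \<in> carrier G. l g = h}) = (0 :: 'k)"
      by (simp add: of_nat_eq_0_iff_char_dvd)
    moreover have "lin_ext l ?a h = (\<Sum>g \<in> {g \<in> carrier G. l g = h}. 1)"
      unfolding lin_ext_def supp by (intro sum.cong) auto
    ultimately show ?thesis by simp
  qed
  then show ?thesis using finite_G by (auto simp: killed_def supp)
qed

end

section \<open>Irreducible representations\<close>

lemma GL_simps:
  "A \<in> carrier (GL TYPE('l::field) n) \<Longrightarrow> A \<in> carrier_mat n n"
  "A \<otimes>\<^bsub>GL TYPE('l) n\<^esub> B = A * B"
  "\<one>\<^bsub>GL TYPE('l) n\<^esub> = 1\<^sub>m n"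
  by (auto simp: GL_def units_of_def ring_mat_def Units_def)

lemma GL_group: "group (GL TYPE('l::field) n)"
proof -
  interpret ring "ring_mat TYPE('l) n ()" by (rule ring_mat)
  show ?thesis unfolding GL_def by (rule units_group)
qed

lemma subspace_vecI:
  fixes S :: "'l::field vec set"
  assumes "S \<subseteq> carrier_vec n" "0\<^sub>v n \<in> S" "\<And>v w. v \<in> S \<Longrightarrow> w \<in> S \<Longrightarrow> v + w \<in> S"
    "\<And>c v. v \<in> S \<Longrightarrow> c \<cdot>\<^sub>v v \<in> S"
  shows "VectorSpace.subspace class_ring S (module_vec TYPE('l) n)"
  by (intro VectorSpace.subspace.intro vec_vs submodule.intro vec_module)
    (use assms in \<open>auto simp: module_vec_simps\<close>)

lemma subspace_vecD:
  fixes S :: "'l::field vec set"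
  assumes "VectorSpace.subspace class_ring S (module_vec TYPE('l) n)"
  shows "S \<subseteq> carrier_vec n" "0\<^sub>v n \<in> S" "\<And>v w. v \<in> S \<Longrightarrow> w \<in> S \<Longrightarrow> v + w \<in> S"
    "\<And>c v. v \<in> S \<Longrightarrow> c \<cdot>\<^sub>v v \<in> S"
proof -
  have sm: "submodule class_ring S (module_vec TYPE('l) n)"
    using assms by (simp add: VectorSpace.subspace_def)
  show "S \<subseteq> carrier_vec n" "0\<^sub>v n \<in> S" "\<And>v w. v \<in> S \<Longrightarrow> w \<in> S \<Longrightarrow> v + w \<in> S"
    using submodule.subset[OF sm] submodule.zero_closed[OF sm] submodule.m_closed[OF sm]
    by (auto simp: module_vec_simps)
  show "\<And>c v. v \<in> S \<Longrightarrow> c \<cdot>\<^sub>v v \<in> S"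
    using submodule.smult_closed[OF sm] by (auto simp: module_vec_simps class_ring_simps)
qed

text \<open>
  The vectors fixed by a normal subgroup form a subrepresentation. So if \<open>\<rho>\<close> is irreducible and nontrivial on
  \<open>N\<close>, there are none, and the sum of \<open>\<rho>\<close> over \<open>N\<close>, whose columns are fixed, vanishes.
\<close>

lemma sum_over_normal_subgroup:
  fixes \<rho> :: "'g \<Rightarrow> 'l::field mat"
  assumes G: "group G" and \<rho>: "irreducible_rep G n \<rho>" and N: "N \<lhd> G"
    and notin: "\<not> N \<subseteq> kernel G (GL TYPE('l) n) \<rho>" and ij: "i < n" "j < n"
  shows "(\<Sum>k\<in>N. \<rho> k $$ (i, j)) = 0"
proof -
  interpret G: group G by fact
  interpret N: normal N G by fact
  have hom: "\<rho> \<in> hom G (GL TYPE('l) n)" using \<rho> by (simp add: irreducible_rep_def)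
  have carr: "\<rho> g \<in> carrier_mat n n" if "g \<in> carrier G" for g
    using hom that GL_simps(1) by (auto simp: hom_def)
  have mult: "\<rho> (g \<otimes>\<^bsub>G\<^esub> h) = \<rho> g * \<rho> h" if "g \<in> carrier G" "h \<in> carrier G" for g h
    using hom_mult[OF hom that] by (simp add: GL_simps)
  let ?W = "{v \<in> carrier_vec n. \<forall>k \<in> N. \<rho> k *\<^sub>v v = v}"
  have NG: "k \<in> carrier G" if "k \<in> N" for k using that N.subset by blast
  have "VectorSpace.subspace class_ring ?W (module_vec TYPE('l) n)"
  proof (rule subspace_vecI)
    have "\<rho> k *\<^sub>v 0\<^sub>v n = 0\<^sub>v n" if "k \<in> N" for k
      using carr[OF NG[OF that]] by (intro eq_vecI) auto
    then show "0\<^sub>v n \<in> ?W" by simp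
  qed (use carr NG in \<open>auto simp: mult_add_distrib_mat_vec[of _ n n] mult_mat_vec[of _ n n]\<close>)
  moreover have "\<rho> g *\<^sub>v v \<in> ?W" if g: "g \<in> carrier G" and v: "v \<in> ?W" for g v
  proof -
    have "\<rho> k *\<^sub>v (\<rho> g *\<^sub>v v) = \<rho> g *\<^sub>v v" if k: "k \<in> N" for k
    proof -
      let ?k = "inv\<^bsub>G\<^esub> g \<otimes>\<^bsub>G\<^esub> k \<otimes>\<^bsub>G\<^esub> g"
      have k': "?k \<in> N" using N.inv_op_closed1[OF g k] .
      have "k \<otimes>\<^bsub>G\<^esub> g = g \<otimes>\<^bsub>G\<^esub> ?k" using g NG[OF k] by (simp add: G.m_assoc[symmetric])
      then have eq: "\<rho> k * \<rho> g = \<rho> g * \<rho> ?k"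
        by (simp only: mult[OF NG[OF k] g, symmetric] mult[OF g NG[OF k'], symmetric])
      have vn: "v \<in> carrier_vec n" using v by blast
      have "\<rho> k *\<^sub>v (\<rho> g *\<^sub>v v) = (\<rho> k * \<rho> g) *\<^sub>v v"
        by (rule assoc_mult_mat_vec[OF carr[OF NG[OF k]] carr[OF g] vn, symmetric])
      also have "\<dots> = \<rho> g *\<^sub>v (\<rho> ?k *\<^sub>v v)"
        unfolding eq by (rule assoc_mult_mat_vec[OF carr[OF g] carr[OF NG[OF k']] vn])
      also have "\<rho> ?k *\<^sub>v v = v" using v k' by blast
      finally show ?thesis .
    qed
    then show ?thesis using v carr[OF g] by simp
  qed
  ultimately have cases: "?W = {0\<^sub>v n} \<or> ?W = carrier_vec n"
    using \<rho> unfolding irreducible_rep_def by blast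
  have "?W \<noteq> carrier_vec n"
  proof
    assume W: "?W = carrier_vec n"
    have "\<rho> k = 1\<^sub>m n" if k: "k \<in> N" for k
    proof (rule eq_matI)
      fix a b assume ab: "a < dim_row (1\<^sub>m n :: 'l mat)" "b < dim_col (1\<^sub>m n :: 'l mat)"
      have "unit_vec n b \<in> ?W" unfolding W by simp
      then have "\<rho> k *\<^sub>v unit_vec n b = unit_vec n b" using k by blast
      moreover have "(\<rho> k *\<^sub>v unit_vec n b) $ a = \<rho> k $$ (a, b)"
        using carr[OF NG[OF k]] ab by (simp add: scalar_prod_right_unit)
      ultimately show "\<rho> k $$ (a, b) = 1\<^sub>m n $$ (a, b)" using ab by (simp add: unit_vec_def)
    qed (use carr[OF NG[OF k]] in auto)
    then show False using notin NG by (auto simp: kernel_def GL_simps)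
  qed
  with cases have W0: "?W = {0\<^sub>v n}" by blast
  let ?v = "vec n (\<lambda>i. \<Sum>k\<in>N. \<rho> k $$ (i, j))"
  have "\<rho> m *\<^sub>v ?v = ?v" if m: "m \<in> N" for m
  proof (rule eq_vecI)
    fix a assume a: "a < dim_vec ?v"
    have "(\<rho> m *\<^sub>v ?v) $ a = (\<Sum>t<n. \<rho> m $$ (a, t) * (\<Sum>k\<in>N. \<rho> k $$ (t, j)))"
      using carr[OF NG[OF m]] a by (simp add: scalar_prod_def atLeast0LessThan)
    also have "\<dots> = (\<Sum>t<n. \<Sum>k\<in>N. \<rho> m $$ (a, t) * \<rho> k $$ (t, j))" by (simp add: sum_distrib_left)
    also have "\<dots> = (\<Sum>k\<in>N. \<Sum>t<n. \<rho> m $$ (a, t) * \<rho> k $$ (t, j))" by (rule sum.swap)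
    also have "\<dots> = (\<Sum>k\<in>N. \<rho> (m \<otimes>\<^bsub>G\<^esub> k) $$ (a, j))"
    proof (intro sum.cong refl)
      fix k assume k: "k \<in> N"
      show "(\<Sum>t<n. \<rho> m $$ (a, t) * \<rho> k $$ (t, j)) = \<rho> (m \<otimes>\<^bsub>G\<^esub> k) $$ (a, j)"
        using carr[OF NG[OF m]] carr[OF NG[OF k]] a ij mult[OF NG[OF m] NG[OF k]]
        by (simp add: scalar_prod_def atLeast0LessThan)
    qed
    also have "\<dots> = (\<Sum>k\<in>N. \<rho> k $$ (a, j))"
    proof (rule sum.reindex_bij_witness[of _ "\<lambda>k. inv\<^bsub>G\<^esub> m \<otimes>\<^bsub>G\<^esub> k" "\<lambda>k. m \<otimes>\<^bsub>G\<^esub> k"])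
    qed (use m NG N.m_closed N.m_inv_closed in \<open>auto simp: G.m_assoc[symmetric]\<close>)
    finally show "(\<rho> m *\<^sub>v ?v) $ a = ?v $ a" using a by simp
  qed (use carr[OF NG[OF m]] in auto)
  then have "?v \<in> ?W" by simp
  then have "?v = 0\<^sub>v n" unfolding W0 by blast
  then have "?v $ i = 0" using ij by simp
  then show ?thesis using ij by simp
qed

text \<open>Such a map carries solutions of linear equations with coefficients \<open>0\<close> and \<open>1\<close> from the closure to \<open>K\<close>.\<close>

lemma linear_functional_alg_closure:
  "\<exists>f :: 'k::field alg_closure \<Rightarrow> 'k. f 1 = 1 \<and> (\<forall>x y. f (x + y) = f x + f y)"
proof -
  interpret vs: vector_space_pair "\<lambda>(c :: 'k) (x :: 'k alg_closure). to_ac c * x" "(*) :: 'k \<Rightarrow> 'k \<Rightarrow> 'k"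
    by unfold_locales (simp_all add: algebra_simps)
  have "vs.vs1.independent {1 :: 'k alg_closure}" by simp
  from vs.linear_independent_extend[OF this, of "\<lambda>_. 1"]
  obtain f where f: "Vector_Spaces.linear (\<lambda>c x. to_ac c * x) (*) f" "f (1 :: 'k alg_closure) = (1 :: 'k)" by auto
  have "f (x + y) = f x + f y" for x y
    using f(1) by (rule vs.linear_add)
  then show ?thesis using f(2) by blast
qed

text \<open>A coefficient of \<open>\<rho>(g\<^sup>-\<^sup>1)\<close> is a function of \<open>g\<close> that sums to \<open>0\<close> over the fibres of every \<open>\<lambda>\<close> in question.\<close>

lemma coefficient_killed:
  fixes \<rho> :: "'g \<Rightarrow> 'k::field alg_closure mat"
  assumes G: "group G" "group H" and fin: "finite (carrier G)" and \<rho>: "irreducible_rep G n \<rho>"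
  shows "\<exists>a :: 'g \<Rightarrow> 'k. supp a \<subseteq> carrier G \<and> a \<noteq> (\<lambda>_. 0) \<and>
    (\<forall>l \<in> hom G H. \<not> kernel G H l \<subseteq> kernel G (GL TYPE('k alg_closure) n) \<rho> \<longrightarrow> lin_ext l a = (\<lambda>_. 0))"
proof -
  interpret G: group G by fact
  have n: "0 < n" and hom: "\<rho> \<in> hom G (GL TYPE('k alg_closure) n)"
    using \<rho> by (auto simp: irreducible_rep_def)
  have carr: "\<rho> g \<in> carrier_mat n n" if "g \<in> carrier G" for g
    using hom that GL_simps(1) by (auto simp: hom_def)
  have mult: "\<rho> (g \<otimes>\<^bsub>G\<^esub> h) = \<rho> g * \<rho> h" if "g \<in> carrier G" "h \<in> carrier G" for g h
    using hom_mult[OF hom that] by (simp add: GL_simps)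
  have one: "\<rho> \<one>\<^bsub>G\<^esub> = 1\<^sub>m n"
    using hom_one[OF hom G(1) GL_group] by (simp add: GL_simps)
  obtain f :: "'k alg_closure \<Rightarrow> 'k" where f: "f 1 = 1" "\<And>x y. f (x + y) = f x + f y"
    using linear_functional_alg_closure by blast
  have f0: "f 0 = 0" using f(2)[of 0 0] by (metis add.right_neutral add_left_cancel)
  have fsum: "f (sum h A) = (\<Sum>x\<in>A. f (h x))" for h and A :: "'g set"
    by (induction A rule: infinite_finite_induct) (simp_all add: f0 f(2))
  define a where "a = (\<lambda>g. if g \<in> carrier G then f (\<rho> (inv\<^bsub>G\<^esub> g) $$ (0, 0)) else 0)"
  have sub: "supp a \<subseteq> carrier G" by (auto simp: supp_def a_def)
  have "a \<one>\<^bsub>G\<^esub> = 1" using n by (simp add: a_def one f(1))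
  then have ne: "a \<noteq> (\<lambda>_. 0)" by auto
  have "lin_ext l a h = 0" if l: "l \<in> hom G H" "\<not> kernel G H l \<subseteq> kernel G (GL TYPE('k alg_closure) n) \<rho>" for l h
  proof -
    have gh: "group_hom G H l" using G l(1) by (simp add: group_hom_def group_hom_axioms_def)
    let ?N = "kernel G H l"
    have N: "?N \<lhd> G" by (rule group_hom.normal_kernel[OF gh])
    have NG: "k \<in> carrier G" if "k \<in> ?N" for k using that by (simp add: kernel_def)
    have "lin_ext l a h = (\<Sum>g\<in>carrier G. a g * delta (l g) h)"
      using fin sub by (rule lin_ext_eq_sum)
    also have "\<dots> = (\<Sum>g\<in>{g \<in> carrier G. l g = h}. a g)"
      using fin by (intro sum.mono_neutral_cong_right) (auto simp: delta_def)
    also have "\<dots> = 0"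
    proof (cases "\<exists>g0 \<in> carrier G. l g0 = h")
      case True
      then obtain g0 where g0: "g0 \<in> carrier G" "l g0 = h" by blast
      \<comment> \<open>The fibre is \<open>g\<^sub>0 N\<close>; inverses turn it into \<open>N g\<^sub>0\<^sup>-\<^sup>1\<close>.\<close>
      have "(\<Sum>g\<in>{g \<in> carrier G. l g = h}. a g) = (\<Sum>k\<in>?N. f (\<rho> (k \<otimes>\<^bsub>G\<^esub> inv\<^bsub>G\<^esub> g0) $$ (0, 0)))"
      proof (rule sum.reindex_bij_witness[of _ "\<lambda>k. g0 \<otimes>\<^bsub>G\<^esub> inv\<^bsub>G\<^esub> k" "\<lambda>g. inv\<^bsub>G\<^esub> g \<otimes>\<^bsub>G\<^esub> g0"])
        fix g assume "g \<in> {g \<in> carrier G. l g = h}"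
        then have g: "g \<in> carrier G" "l g = h" by auto
        show "g0 \<otimes>\<^bsub>G\<^esub> inv\<^bsub>G\<^esub> (inv\<^bsub>G\<^esub> g \<otimes>\<^bsub>G\<^esub> g0) = g"
          using g g0 by (simp add: G.inv_mult_group G.m_assoc[symmetric])
        show "inv\<^bsub>G\<^esub> g \<otimes>\<^bsub>G\<^esub> g0 \<in> ?N"
          using g g0 G(2) group_hom.hom_mult[OF gh] group_hom.hom_inv[OF gh] hom_in_carrier[OF l(1)]
          by (auto simp: kernel_def group.l_inv)
        show "f (\<rho> (inv\<^bsub>G\<^esub> g \<otimes>\<^bsub>G\<^esub> g0 \<otimes>\<^bsub>G\<^esub> inv\<^bsub>G\<^esub> g0) $$ (0, 0)) = a g"
          using g g0 by (simp add: a_def G.m_assoc)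
      next
        fix k assume k: "k \<in> ?N"
        then have kG: "k \<in> carrier G" "l k = \<one>\<^bsub>H\<^esub>" by (auto simp: kernel_def)
        show "inv\<^bsub>G\<^esub> (g0 \<otimes>\<^bsub>G\<^esub> inv\<^bsub>G\<^esub> k) \<otimes>\<^bsub>G\<^esub> g0 = k"
          using kG g0 by (simp add: G.inv_mult_group G.m_assoc)
        interpret H: group H by fact
        have "l (g0 \<otimes>\<^bsub>G\<^esub> inv\<^bsub>G\<^esub> k) = h"
          using kG g0 group_hom.hom_mult[OF gh] group_hom.hom_inv[OF gh] hom_in_carrier[OF l(1) g0(1)] by simp
        then show "g0 \<otimes>\<^bsub>G\<^esub> inv\<^bsub>G\<^esub> k \<in> {g \<in> carrier G. l g = h}" using kG g0 by simp
      qed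
      also have "\<dots> = f (\<Sum>k\<in>?N. \<rho> (k \<otimes>\<^bsub>G\<^esub> inv\<^bsub>G\<^esub> g0) $$ (0, 0))" by (rule fsum[symmetric])
      also have "(\<Sum>k\<in>?N. \<rho> (k \<otimes>\<^bsub>G\<^esub> inv\<^bsub>G\<^esub> g0) $$ (0, 0))
          = (\<Sum>k\<in>?N. \<Sum>t<n. \<rho> k $$ (0, t) * \<rho> (inv\<^bsub>G\<^esub> g0) $$ (t, 0))"
      proof (intro sum.cong refl)
        fix k assume k: "k \<in> ?N"
        show "\<rho> (k \<otimes>\<^bsub>G\<^esub> inv\<^bsub>G\<^esub> g0) $$ (0, 0) = (\<Sum>t<n. \<rho> k $$ (0, t) * \<rho> (inv\<^bsub>G\<^esub> g0) $$ (t, 0))"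
          using carr[OF NG[OF k]] carr[of "inv\<^bsub>G\<^esub> g0"] g0 n mult[OF NG[OF k], of "inv\<^bsub>G\<^esub> g0"]
          by (simp add: scalar_prod_def atLeast0LessThan)
      qed
      also have "\<dots> = (\<Sum>t<n. (\<Sum>k\<in>?N. \<rho> k $$ (0, t)) * \<rho> (inv\<^bsub>G\<^esub> g0) $$ (t, 0))"
        unfolding sum_distrib_right by (rule sum.swap)
      also have "\<dots> = 0"
        using sum_over_normal_subgroup[OF G(1) \<rho> N l(2) n] by (intro sum.neutral) simp
      finally show ?thesis by (simp add: f0)
    next
      case False
      then have "{g \<in> carrier G. l g = h} = {}" by blast
      then show ?thesis by (simp only: sum.empty)
    qed
    finally show ?thesis .
  qed
  then show ?thesis using sub ne by blast
qed

subsection \<open>The regular representation\<close>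

global_interpretation fun_space: vector_space "\<lambda>(c :: 'l::field) (f :: 'g \<Rightarrow> 'l) x. c * f x"
  defines fun_subspace = fun_space.subspace
    and fun_span = fun_space.span
    and fun_dependent = fun_space.dependent
    and fun_dim = fun_space.dim
    and fun_representation = fun_space.representation
  by unfold_locales (auto simp: fun_eq_iff algebra_simps)

lemma sum_fun_apply: "(\<Sum>i\<in>A. F i) x = (\<Sum>i\<in>A. F i x :: 'l::field)"
  by (induction A rule: infinite_finite_induct) simp_all

locale finite_group = group G for G (structure) +
  assumes fin: "finite (carrier G)"
begin

text \<open>
  The left regular representation on functions supported on \<open>G\<close>.
\<close>

definition translate :: "'a \<Rightarrow> ('a \<Rightarrow> 'l::field) \<Rightarrow> 'a \<Rightarrow> 'l" where
  "translate g f = (\<lambda>x. if x \<in> carrier G then f (inv g \<otimes> x) else 0)"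

definition algebra_action :: "('a \<Rightarrow> 'l::field) \<Rightarrow> ('a \<Rightarrow> 'l) \<Rightarrow> 'a \<Rightarrow> 'l" where
  "algebra_action b f = (\<lambda>x. \<Sum>g\<in>carrier G. b g * translate g f x)"

definition invariant :: "('a \<Rightarrow> 'l::field) set \<Rightarrow> bool" where
  "invariant W \<longleftrightarrow> fun_subspace W \<and> (\<forall>f\<in>W. supp f \<subseteq> carrier G) \<and> (\<forall>g\<in>carrier G. \<forall>f\<in>W. translate g f \<in> W)"

lemma translate_add: "translate g (f + f') = translate g f + (translate g f' :: 'a \<Rightarrow> 'l::field)"
  and translate_scale: "translate g (\<lambda>x. c * f x) = (\<lambda>x. c * translate g f x :: 'l)"
  by (auto simp: translate_def fun_eq_iff)

lemma translate_sum:
  "translate g (\<lambda>x. \<Sum>i\<in>A. c i * F i x) = (\<lambda>x. \<Sum>i\<in>A. c i * translate g (F i) x :: 'l::field)"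
  by (auto simp: translate_def fun_eq_iff)

lemma translate_mult:
  assumes "g \<in> carrier G" "h \<in> carrier G"
  shows "translate g (translate h f) = translate (g \<otimes> h) f"
proof
  fix x
  show "translate g (translate h f) x = translate (g \<otimes> h) f x"
    using assms by (cases "x \<in> carrier G") (simp_all add: translate_def inv_mult_group m_assoc)
qed

lemma translate_one: "supp f \<subseteq> carrier G \<Longrightarrow> translate \<one> f = f"
  by (rule ext) (auto simp: translate_def supp_def)

lemma algebra_action_add: "algebra_action b (f + f') = algebra_action b f + (algebra_action b f' :: 'a \<Rightarrow> 'l::field)"
  by (simp add: algebra_action_def translate_add fun_eq_iff sum.distrib distrib_left)

lemma invariant_sum:
  "invariant W \<Longrightarrow> (\<And>i. i \<in> A \<Longrightarrow> F i \<in> W) \<Longrightarrow> (\<lambda>x. \<Sum>i\<in>A. c i * F i x) \<in> (W :: ('a \<Rightarrow> 'l::field) set)"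
proof -
  assume W: "invariant W" and F: "\<And>i. i \<in> A \<Longrightarrow> F i \<in> W"
  have "(\<Sum>i\<in>A. (\<lambda>x. c i * F i x)) \<in> W"
    using W F unfolding invariant_def
    by (intro fun_space.subspace_sum) (auto intro: fun_space.subspace_scale)
  moreover have "(\<Sum>i\<in>A. (\<lambda>x. c i * F i x)) = (\<lambda>x. \<Sum>i\<in>A. c i * F i x)"
    by (simp add: fun_eq_iff sum_fun_apply)
  ultimately show ?thesis by simp
qed

lemma invariant_basis:
  assumes "invariant (W :: ('a \<Rightarrow> 'l::field) set)"
  obtains B where "B \<subseteq> W" "\<not> fun_dependent B" "fun_span B = W" "finite B" "card B = fun_dim W"
proof -
  have sub: "fun_subspace W" and W: "\<And>f. f \<in> W \<Longrightarrow> supp f \<subseteq> carrier G"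
    using assms by (auto simp: invariant_def)
  obtain B where B: "B \<subseteq> W" "\<not> fun_dependent B" "W \<subseteq> fun_span B" "card B = fun_dim W"
    using fun_space.basis_exists[of W] .
  have span: "fun_span B = W" using B(1,3) fun_space.span_minimal[OF B(1) sub] by blast
  let ?D = "delta ` carrier G :: ('a \<Rightarrow> 'l) set"
  have "f \<in> fun_span ?D" if f: "f \<in> W" for f
  proof -
    have "(\<Sum>g\<in>carrier G. f g * delta g x) = f x" for x
      using fin W[OF f] by (cases "x \<in> carrier G") (auto simp: delta_def supp_def if_distrib cong: if_cong)
    then have "f = (\<Sum>g\<in>carrier G. (\<lambda>x. f g * delta g x))"
      by (simp add: fun_eq_iff sum_fun_apply)
    moreover have "(\<Sum>g\<in>carrier G. (\<lambda>x. f g * delta g x)) \<in> fun_span ?D"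
      by (intro fun_space.span_sum fun_space.span_scale fun_space.span_base) auto
    ultimately show ?thesis by simp
  qed
  then have "finite B"
    using fun_space.independent_span_bound[of ?D B] B(1,2) fin by blast
  then show ?thesis using that B span by blast
qed

lemma invariant_dim_less:
  assumes U: "invariant U" and W: "invariant (W :: ('a \<Rightarrow> 'l::field) set)" and "U \<subseteq> W" "U \<noteq> W"
  shows "fun_dim U < fun_dim W"
proof -
  obtain B where B: "B \<subseteq> U" "\<not> fun_dependent B" "fun_span B = U" "finite B" "card B = fun_dim U"
    using invariant_basis[OF U] .
  obtain C where C: "C \<subseteq> W" "\<not> fun_dependent C" "fun_span C = W" "finite C" "card C = fun_dim W"
    using invariant_basis[OF W] .
  obtain w where w: "w \<in> W" "w \<notin> U" using assms by blast
  have "\<not> fun_dependent (insert w B)" using B w by (intro fun_space.independent_insertI) auto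
  moreover have "insert w B \<subseteq> fun_span C" using B C w assms(3) by auto
  ultimately have "card (insert w B) \<le> card C"
    using fun_space.independent_span_bound[OF C(4)] by blast
  moreover have "w \<notin> B" using B(1) w by blast
  ultimately show ?thesis using B C by simp
qed

text \<open>Maschke's averaging argument, in the form of an equivariant projection onto \<open>U\<close>.\<close>

lemma maschke_projection:
  assumes char: "of_nat (Coset.order G) \<noteq> (0 :: 'l::field)" and U: "invariant (U :: ('a \<Rightarrow> 'l) set)"
  obtains p where "\<And>f f'. p (f + f') = p f + p f'" "\<And>c f. p (\<lambda>x. c * f x) = (\<lambda>x. c * p f x)"
    "\<And>f. p f \<in> U" "\<And>f. f \<in> U \<Longrightarrow> p f = f"
    "\<And>g f. g \<in> carrier G \<Longrightarrow> supp f \<subseteq> carrier G \<Longrightarrow> p (translate g f) = translate g (p f)"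
proof -
  interpret vp: vector_space_pair "\<lambda>(c :: 'l) (f :: 'a \<Rightarrow> 'l) x. c * f x" "\<lambda>(c :: 'l) (f :: 'a \<Rightarrow> 'l) x. c * f x"
    by unfold_locales
  have sub: "fun_subspace U" using U by (simp add: invariant_def)
  have "Vector_Spaces.linear (\<lambda>(c :: 'l) (f :: 'a \<Rightarrow> 'l) x. c * f x) (\<lambda>c f x. c * f x) (\<lambda>f. f)"
    by (rule fun_space.linear_ident)
  from vp.linear_exists_left_inverse_on[OF this sub[unfolded fun_subspace_def] inj_on_id2]
  obtain q where q: "range q \<subseteq> U" "Vector_Spaces.linear (\<lambda>(c :: 'l) (f :: 'a \<Rightarrow> 'l) x. c * f x) (\<lambda>c f x. c * f x) q"
    "\<And>v. v \<in> U \<Longrightarrow> q v = v" by blast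
  have q_add: "q (f + f') = q f + q f'" for f f' using vp.linear_add[OF q(2)] .
  have q_scale: "q (\<lambda>x. c * f x) = (\<lambda>x. c * q f x)" for c f using vp.linear_scale[OF q(2)] .
  let ?n = "of_nat (Coset.order G) :: 'l"
  define p where "p f = (\<lambda>x. \<Sum>g\<in>carrier G. inverse ?n * translate g (q (translate (inv g) f)) x)" for f
  have tU: "translate g f \<in> U" if "g \<in> carrier G" "f \<in> U" for g f using U that by (auto simp: invariant_def)
  show ?thesis
  proof
    show "p (f + f') = p f + p f'" for f f'
      by (simp add: p_def translate_add q_add fun_eq_iff sum.distrib distrib_left)
    show "p (\<lambda>x. c * f x) = (\<lambda>x. c * p f x)" for c f
      by (simp add: p_def translate_scale q_scale fun_eq_iff sum_distrib_left mult.left_commute)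
    show "p f \<in> U" for f
      unfolding p_def using q(1) by (intro invariant_sum[OF U] tU) auto
    show "p f = f" if f: "f \<in> U" for f
    proof
      fix x
      have "translate g (q (translate (inv g) f)) = f" if g: "g \<in> carrier G" for g
      proof -
        have "translate g (q (translate (inv g) f)) = translate (g \<otimes> inv g) f"
          using q(3)[OF tU[OF inv_closed[OF g] f]] translate_mult[OF g inv_closed[OF g]] by simp
        moreover have "supp f \<subseteq> carrier G" using f U by (simp add: invariant_def)
        ultimately show ?thesis using g translate_one[of f] by simp
      qed
      then have "p f x = (\<Sum>g\<in>carrier G. inverse ?n * f x)" by (simp add: p_def)
      also have "\<dots> = f x" using char by (simp add: Coset.order_def)
      finally show "p f x = f x" .
    qed
    show "p (translate h f) = translate h (p f)" if h: "h \<in> carrier G" and f: "supp f \<subseteq> carrier G" for h f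
    proof
      fix x
      have "translate h (p f) x = (\<Sum>g\<in>carrier G. inverse ?n * translate h (translate g (q (translate (inv g) f))) x)"
        unfolding p_def translate_sum ..
      also have "\<dots> = (\<Sum>g\<in>carrier G. inverse ?n * translate (h \<otimes> g) (q (translate (inv g) f)) x)"
        using h by (simp add: translate_mult)
      also have "\<dots> = (\<Sum>g\<in>carrier G. inverse ?n * translate g (q (translate (inv g) (translate h f))) x)"
      proof (rule sum.reindex_bij_witness[of _ "\<lambda>g. inv h \<otimes> g" "\<lambda>g. h \<otimes> g"])
        fix g assume g: "g \<in> carrier G"
        have "inv (h \<otimes> g) \<otimes> h = inv g" using g h by (simp add: inv_mult_group m_assoc)
        then have "translate (inv (h \<otimes> g)) (translate h f) = translate (inv g) f"
          using g h by (simp add: translate_mult)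
        then show "inverse ?n * translate (h \<otimes> g) (q (translate (inv (h \<otimes> g)) (translate h f))) x
            = inverse ?n * translate (h \<otimes> g) (q (translate (inv g) f)) x" by simp
      qed (use h in \<open>auto simp: m_assoc[symmetric]\<close>)
      finally show "p (translate h f) x = translate h (p f) x" by (simp add: p_def)
    qed
  qed
qed

text \<open>
  Among the invariant subspaces on which \<open>b\<close> acts nontrivially, one of minimal dimension is irreducible: it
  is the sum of any proper invariant subspace and a complement, and \<open>b\<close> would act trivially on both.
\<close>

lemma irreducible_subspace_detecting:
  assumes char: "of_nat (Coset.order G) \<noteq> (0 :: 'l::field)" and b: "supp b \<subseteq> carrier G" "b \<noteq> (\<lambda>_. 0 :: 'l)"
  obtains W where "invariant (W :: ('a \<Rightarrow> 'l) set)" "\<exists>f\<in>W. algebra_action b f \<noteq> 0"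
    "\<And>U. invariant U \<Longrightarrow> U \<subseteq> W \<Longrightarrow> U = {0} \<or> U = W"
proof -
  define P where "P W \<longleftrightarrow> invariant W \<and> (\<exists>f\<in>W. algebra_action b f \<noteq> 0)" for W :: "('a \<Rightarrow> 'l) set"
  let ?V = "{f :: 'a \<Rightarrow> 'l. supp f \<subseteq> carrier G}"
  have "invariant ?V"
    unfolding invariant_def
  proof (intro conjI ballI)
    have V: "?V = {f. \<forall>x. x \<notin> carrier G \<longrightarrow> f x = 0}" by (auto simp: supp_def)
    show "fun_subspace ?V" unfolding V by (rule fun_space.subspaceI) auto
  qed (auto simp: supp_def translate_def split: if_splits)
  moreover have "algebra_action b (delta \<one>) = b"
  proof
    fix x
    have "algebra_action b (delta \<one>) x = (\<Sum>g\<in>carrier G. if g = x then b g else 0)"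
    proof (unfold algebra_action_def, rule sum.cong[OF refl])
      fix g assume g: "g \<in> carrier G"
      have "inv g \<otimes> x = \<one> \<longleftrightarrow> g = x" if "x \<in> carrier G"
        using g that by (metis inv_closed inv_equality inv_inv l_inv)
      then show "b g * translate g (delta \<one>) x = (if g = x then b g else 0)"
        using g by (auto simp: translate_def delta_def)
    qed
    also have "\<dots> = b x" using fin b(1) by (auto simp: supp_def)
    finally show "algebra_action b (delta \<one>) x = b x" .
  qed
  ultimately have "P ?V"
    unfolding P_def using b(2) by (intro conjI bexI[of _ "delta \<one>"]) (auto simp: supp_delta fun_eq_iff)
  then obtain W where W: "P W" "\<And>U. P U \<Longrightarrow> fun_dim W \<le> fun_dim U"
    using ex_has_least_nat[of P ?V fun_dim] by blast
  have irred: "U = {0} \<or> U = W" if U: "invariant U" "U \<subseteq> W" for U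
  proof (rule ccontr)
    assume *: "\<not> (U = {0} \<or> U = W)"
    have WI: "invariant W" and WS: "fun_subspace W" using W(1) by (auto simp: P_def invariant_def)
    have small: "algebra_action b f = 0" if "invariant V" "V \<subseteq> W" "V \<noteq> W" "f \<in> V" for V f
      using invariant_dim_less[OF that(1) WI that(2,3)] W(2)[of V] that unfolding P_def by force
    obtain p where p: "\<And>f f'. p (f + f') = p f + p f'" "\<And>c f. p (\<lambda>x. c * f x) = (\<lambda>x. c * p f x)"
      "\<And>f. p f \<in> U" "\<And>f. f \<in> U \<Longrightarrow> p f = f"
      "\<And>g f. g \<in> carrier G \<Longrightarrow> supp f \<subseteq> carrier G \<Longrightarrow> p (translate g f) = translate g (p f)"
      using maschke_projection[OF char U(1)] by blast
    let ?C = "{f \<in> W. p f = 0}"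
    have p0: "p 0 = 0" using p(2)[of 0 0] by (simp add: zero_fun_def)
    have C: "invariant ?C"
      unfolding invariant_def
    proof (intro conjI ballI)
      show "fun_subspace ?C"
      proof (rule fun_space.subspaceI)
        show "0 \<in> ?C" using fun_space.subspace_0[OF WS] p0 by simp
        show "f + f' \<in> ?C" if "f \<in> ?C" "f' \<in> ?C" for f f'
          using fun_space.subspace_add[OF WS, of f f'] p(1)[of f f'] that by simp
        show "(\<lambda>x. c * f x) \<in> ?C" if "f \<in> ?C" for c f
          using fun_space.subspace_scale[OF WS, of f c] p(2)[of c f] that by (simp add: fun_eq_iff)
      qed
      show "supp f \<subseteq> carrier G" if "f \<in> ?C" for f using WI that by (auto simp: invariant_def)
      show "translate g f \<in> ?C" if "g \<in> carrier G" "f \<in> ?C" for g f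
        using WI that p(5)[of g f] by (auto simp: invariant_def translate_def zero_fun_def fun_eq_iff)
    qed
    have "0 \<in> U" using U(1) by (auto simp: invariant_def fun_space.subspace_0)
    then obtain u where u: "u \<in> U" "u \<noteq> 0" using * by blast
    then have "u \<notin> ?C" "u \<in> W" using p(4) U(2) by auto
    then have C': "?C \<noteq> W" by blast
    obtain f where f: "f \<in> W" "algebra_action b f \<noteq> 0" using W(1) by (auto simp: P_def)
    have pf: "p f \<in> U" "p f \<in> W" using p(3) U(2) by auto
    have "p (f - p f) + p (p f) = p f" using p(1)[of "f - p f" "p f"] by simp
    then have "p (f - p f) = 0" using p(4)[OF p(3)] by simp
    then have "f - p f \<in> ?C" using fun_space.subspace_diff[OF WS f(1) pf(2)] by simp
    then have "algebra_action b (f - p f) = 0" using small[OF C _ C'] by blast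
    moreover have "algebra_action b (p f) = 0" using small[OF U] pf(1) * by blast
    moreover have "algebra_action b f = algebra_action b (f - p f) + algebra_action b (p f)"
      using algebra_action_add[of b "f - p f" "p f"] by simp
    ultimately show False using f(2) by simp
  qed
  show ?thesis using that[of W] W(1) irred unfolding P_def by blast
qed

text \<open>Choosing a basis turns the irreducible subspace into a matrix representation.\<close>

lemma irreducible_rep_detecting:
  assumes char: "of_nat (Coset.order G) \<noteq> (0 :: 'l::field)" and b: "supp b \<subseteq> carrier G" "b \<noteq> (\<lambda>_. 0 :: 'l)"
  obtains n and \<rho> :: "'a \<Rightarrow> 'l::field mat" and i j where "irreducible_rep G n \<rho>" "i < n" "j < n"
    "(\<Sum>g\<in>carrier G. b g * \<rho> g $$ (i, j)) \<noteq> 0"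
proof -
  obtain W where W: "invariant (W :: ('a \<Rightarrow> 'l) set)" "\<exists>f\<in>W. algebra_action b f \<noteq> 0"
    "\<And>U. invariant U \<Longrightarrow> U \<subseteq> W \<Longrightarrow> U = {0} \<or> U = W"
    using irreducible_subspace_detecting[OF char b] by blast
  have WS: "fun_subspace W" and Wsupp: "\<And>f. f \<in> W \<Longrightarrow> supp f \<subseteq> carrier G"
    and WT: "\<And>g f. g \<in> carrier G \<Longrightarrow> f \<in> W \<Longrightarrow> translate g f \<in> W"
    using W(1) by (auto simp: invariant_def)
  obtain B where B: "B \<subseteq> W" "\<not> fun_dependent B" "fun_span B = W" "finite B"
    using invariant_basis[OF W(1)] .
  obtain bs where bs: "set bs = B" "distinct bs" using finite_distinct_list[OF B(4)] by blast
  define n where "n = length bs"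
  define r where "r f i = fun_representation B f (bs ! i)" for f i
  have bsW: "bs ! i \<in> W" if "i < n" for i using that bs(1) B(1) by (auto simp: n_def)
  have sum_bs: "(\<Sum>v\<in>B. h v) = (\<Sum>i<n. h (bs ! i))" for h :: "_ \<Rightarrow> 'l"
    using sum.reindex_bij_betw[OF bij_betw_nth[OF bs(2) _ bs(1)[symmetric]], of "{..<n}" h]
    by (simp add: n_def)
  have expand: "f x = (\<Sum>i<n. r f i * (bs ! i) x)" if "f \<in> W" for f x
  proof -
    have "f = (\<Sum>v\<in>B. (\<lambda>x. fun_representation B f v * v x))"
      using fun_space.sum_representation_eq[OF B(2) _ B(4) order.refl, of f] that B(3) by simp
    then have "f x = (\<Sum>v\<in>B. fun_representation B f v * v x)" by (metis (no_types, lifting) sum.cong sum_fun_apply)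
    then show ?thesis by (simp add: sum_bs r_def)
  qed
  have r_add: "r (f + f') i = r f i + r f' i" if "f \<in> W" "f' \<in> W" for f f' i
    using fun_space.representation_add[OF B(2), of f' f] that B(3) by (simp add: r_def)
  have r_scale: "r (\<lambda>x. c * f x) i = c * r f i" if "f \<in> W" for c f i
    using fun_space.representation_scale[OF B(2), of f c] that B(3) by (simp add: r_def)
  have r_bs: "r (bs ! j) i = (if i = j then 1 else 0)" if "i < n" "j < n" for i j
    using fun_space.representation_basis[OF B(2), of "bs ! j"] that bs nth_eq_iff_index_eq[OF bs(2)]
    by (auto simp: r_def n_def)
  have r_sum: "r (\<lambda>x. \<Sum>j\<in>A. c j * F j x) i = (\<Sum>j\<in>A. c j * r (F j) i)"
    if "finite A" "\<And>j. j \<in> A \<Longrightarrow> F j \<in> W" for A :: "'z set" and c F i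
    using that
  proof (induction A)
    case empty
    have "(0 :: 'a \<Rightarrow> 'l) \<in> W" using WS by (rule fun_space.subspace_0)
    then show ?case using r_scale[of 0 0 i] by (simp add: zero_fun_def)
  next
    case (insert j A)
    have "(\<lambda>x. \<Sum>j\<in>A. c j * F j x) \<in> W" using insert by (intro invariant_sum[OF W(1)]) auto
    moreover have "(\<lambda>x. c j * F j x) \<in> W" using insert WS by (intro fun_space.subspace_scale) auto
    ultimately have "r ((\<lambda>x. c j * F j x) + (\<lambda>x. \<Sum>j\<in>A. c j * F j x)) i = c j * r (F j) i + (\<Sum>j\<in>A. c j * r (F j) i)"
      using insert r_add r_scale by simp
    then show ?case using insert by (simp add: plus_fun_def)
  qed
  define \<rho> where "\<rho> g = mat n n (\<lambda>(i, j). r (translate g (bs ! j)) i)" for g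
  have \<rho>_carrier: "\<rho> g \<in> carrier_mat n n" for g by (simp add: \<rho>_def)
  have r_translate: "r (translate g f) i = (\<Sum>j<n. \<rho> g $$ (i, j) * r f j)"
    if g: "g \<in> carrier G" and f: "f \<in> W" and i: "i < n" for g f i
  proof -
    have f_eq: "f = (\<lambda>x. \<Sum>j<n. r f j * (bs ! j) x)" using expand[OF f] by (rule ext)
    have "r (translate g f) i = r (\<lambda>x. \<Sum>j<n. r f j * translate g (bs ! j) x) i"
      by (subst f_eq) (simp add: translate_sum)
    also have "\<dots> = (\<Sum>j<n. r f j * r (translate g (bs ! j)) i)"
      using WT[OF g] bsW by (intro r_sum) auto
    finally show ?thesis using i by (simp add: \<rho>_def mult.commute)
  qed
  have mult: "\<rho> (g \<otimes> h) = \<rho> g * \<rho> h" if gh: "g \<in> carrier G" "h \<in> carrier G" for g h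
  proof (rule eq_matI)
    fix i j assume "i < dim_row (\<rho> g * \<rho> h)" "j < dim_col (\<rho> g * \<rho> h)"
    then have ij: "i < n" "j < n" by (simp_all add: \<rho>_def)
    have "\<rho> (g \<otimes> h) $$ (i, j) = r (translate g (translate h (bs ! j))) i"
      using ij gh by (simp add: \<rho>_def translate_mult)
    also have "\<dots> = (\<Sum>k<n. \<rho> g $$ (i, k) * r (translate h (bs ! j)) k)"
      by (intro r_translate gh ij WT bsW)
    also have "\<dots> = (\<rho> g * \<rho> h) $$ (i, j)"
      using ij by (simp add: scalar_prod_def \<rho>_def atLeast0LessThan)
    finally show "\<rho> (g \<otimes> h) $$ (i, j) = (\<rho> g * \<rho> h) $$ (i, j)" .
  qed (simp_all add: \<rho>_def)
  have one: "\<rho> \<one> = 1\<^sub>m n"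
    by (rule eq_matI) (auto simp: \<rho>_def translate_one[OF Wsupp[OF bsW]] r_bs)
  have hom: "\<rho> \<in> hom G (GL TYPE('l) n)"
  proof (rule homI)
    fix g assume g: "g \<in> carrier G"
    have "\<rho> g * \<rho> (inv g) = 1\<^sub>m n" "\<rho> (inv g) * \<rho> g = 1\<^sub>m n"
      using mult[OF g inv_closed[OF g]] mult[OF inv_closed[OF g] g] g one by simp_all
    then show "\<rho> g \<in> carrier (GL TYPE('l) n)"
      using \<rho>_carrier by (auto simp: GL_def units_of_def Units_def ring_mat_def)
  qed (simp add: mult GL_simps)
  obtain f where f: "f \<in> W" "algebra_action b f \<noteq> 0" using W(2) by blast
  have f_eq: "algebra_action b f = (\<lambda>x. \<Sum>g\<in>carrier G. b g * translate g f x)" by (simp add: algebra_action_def)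
  have bW: "algebra_action b f \<in> W" unfolding f_eq by (intro invariant_sum[OF W(1)] WT f(1))
  have "\<exists>i<n. r (algebra_action b f) i \<noteq> 0"
  proof (rule ccontr)
    assume "\<not> (\<exists>i<n. r (algebra_action b f) i \<noteq> 0)"
    then have "algebra_action b f x = 0" for x using expand[OF bW, of x] by simp
    then show False using f(2) by (simp add: fun_eq_iff)
  qed
  then obtain i where i: "i < n" "r (algebra_action b f) i \<noteq> 0" by blast
  have "r (algebra_action b f) i = (\<Sum>g\<in>carrier G. b g * r (translate g f) i)"
    unfolding f_eq using fin WT f(1) by (intro r_sum) auto
  also have "\<dots> = (\<Sum>g\<in>carrier G. \<Sum>j<n. b g * \<rho> g $$ (i, j) * r f j)"
    using r_translate[OF _ f(1) i(1)] by (simp add: sum_distrib_left mult.assoc)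
  also have "\<dots> = (\<Sum>j<n. (\<Sum>g\<in>carrier G. b g * \<rho> g $$ (i, j)) * r f j)"
    unfolding sum_distrib_right by (rule sum.swap)
  finally have "\<exists>j<n. (\<Sum>g\<in>carrier G. b g * \<rho> g $$ (i, j)) \<noteq> 0"
    using i(2) by (metis (no_types, lifting) lessThan_iff mult_zero_left sum.neutral)
  then obtain j where j: "j < n" "(\<Sum>g\<in>carrier G. b g * \<rho> g $$ (i, j)) \<noteq> 0" by blast
  have "S = {0\<^sub>v n} \<or> S = carrier_vec n"
    if S: "VectorSpace.subspace class_ring S (module_vec TYPE('l) n)"
      and inv: "\<forall>g\<in>carrier G. \<forall>v\<in>S. \<rho> g *\<^sub>v v \<in> S" for S
  proof -
    note SD = subspace_vecD[OF S]
    define c where "c f = vec n (r f)" for f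
    let ?U = "{f \<in> W. c f \<in> S}"
    define d :: "'l vec \<Rightarrow> 'a \<Rightarrow> 'l" where "d v = (\<lambda>x. \<Sum>i<n. v $ i * (bs ! i) x)" for v
    have d: "d v \<in> W" for v unfolding d_def using bsW by (intro invariant_sum[OF W(1)]) auto
    have cd: "c (d v) = v" if "v \<in> carrier_vec n" for v
    proof (rule eq_vecI)
      fix i assume "i < dim_vec v"
      then have i: "i < n" using that by simp
      have "c (d v) $ i = (\<Sum>j<n. v $ j * r (bs ! j) i)"
        using i r_sum[of "{..<n}" "\<lambda>j. bs ! j" "\<lambda>j. v $ j" i] bsW by (simp add: c_def d_def)
      also have "\<dots> = (\<Sum>j<n. if j = i then v $ j else 0)"
        using i by (intro sum.cong) (auto simp: r_bs)
      finally show "c (d v) $ i = v $ i" using i by simp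
    qed (use that in \<open>simp add: c_def\<close>)
    have c_add: "c (f + f') = c f + c f'" if "f \<in> W" "f' \<in> W" for f f'
      using that by (auto simp: c_def r_add)
    have c_scale: "c (\<lambda>x. a * f x) = a \<cdot>\<^sub>v c f" if "f \<in> W" for a f
      using that by (auto simp: c_def r_scale)
    have W0: "0 \<in> W" using WS by (rule fun_space.subspace_0)
    have "r 0 i = 0" for i using r_scale[OF W0, of 0 i] by (simp add: zero_fun_def)
    then have c0: "c 0 = 0\<^sub>v n" by (intro eq_vecI) (simp_all add: c_def)
    have "invariant ?U"
      unfolding invariant_def
    proof (intro conjI ballI)
      show "fun_subspace ?U"
      proof (rule fun_space.subspaceI)
        show "0 \<in> ?U" using W0 SD(2) c0 by simp
        show "f + f' \<in> ?U" if "f \<in> ?U" "f' \<in> ?U" for f f'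
          using fun_space.subspace_add[OF WS, of f f'] c_add[of f f'] SD(3) that by simp
        show "(\<lambda>x. a * f x) \<in> ?U" if "f \<in> ?U" for a f
          using fun_space.subspace_scale[OF WS, of f a] c_scale[of f a] SD(4) that by simp
      qed
      show "supp f \<subseteq> carrier G" if "f \<in> ?U" for f using that Wsupp by blast
      fix g f assume g: "g \<in> carrier G" and f: "f \<in> ?U"
      have "c (translate g f) = \<rho> g *\<^sub>v c f"
      proof (rule eq_vecI)
        fix i assume "i < dim_vec (\<rho> g *\<^sub>v c f)"
        then have i: "i < n" by (simp add: \<rho>_def)
        then show "c (translate g f) $ i = (\<rho> g *\<^sub>v c f) $ i"
          using r_translate[OF g _ i, of f] f \<rho>_carrier[of g]
          by (simp add: c_def scalar_prod_def atLeast0LessThan)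
      qed (simp add: c_def \<rho>_def)
      then show "translate g f \<in> ?U" using f g WT inv by auto
    qed
    then consider "?U = {0}" | "?U = W" using W(3) by blast
    then show ?thesis
    proof cases
      case 1
      have "v = 0\<^sub>v n" if v: "v \<in> S" for v
      proof -
        have vn: "v \<in> carrier_vec n" using SD(1) v by blast
        then have "d v \<in> ?U" using d cd v by simp
        then have "d v = 0" using 1 by blast
        then show ?thesis using cd[OF vn] c0 by simp
      qed
      then show ?thesis using SD(2) by blast
    next
      case 2
      have "v \<in> S" if "v \<in> carrier_vec n" for v
      proof -
        have "d v \<in> ?U" unfolding 2 by (rule d)
        then show ?thesis using cd[OF that] by simp
      qed
      then show ?thesis using SD(1) by blast
    qed
  qed
  moreover have "0 < n" using i(1) by simp
  ultimately have "irreducible_rep G n \<rho>" using hom by (auto simp: irreducible_rep_def)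
  then show ?thesis using that i(1) j by blast
qed

end

subsection \<open>The criterion in terms of irreducible representations\<close>

context multispinal_data
begin

text \<open>
  If \<open>ker \<lambda> \<le> ker \<rho>\<close>, then \<open>\<rho>(a)\<close> is determined by the image of \<open>a\<close> under \<open>\<lambda>\<close>, which is \<open>0\<close>. So any \<open>\<rho>\<close>
  with \<open>\<rho>(a) \<noteq> 0\<close> will do.
\<close>

lemma killed_detected_by_reps:
  assumes char: "\<not> CHAR('k::field) dvd Coset.order G" and a: "killed (a :: 'g \<Rightarrow> 'k)" "a \<noteq> (\<lambda>_. 0)"
  shows "\<exists>n (\<rho> :: 'g \<Rightarrow> 'k alg_closure mat). irreducible_rep G n \<rho> \<and>
    (\<forall>l \<in> spinal_B G \<X> \<Phi>. \<not> kernel G H l \<subseteq> kernel G (GL TYPE('k alg_closure) n) \<rho>)"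
proof -
  interpret finite_group G by unfold_locales (rule finite_G)
  let ?b = "\<lambda>g. to_ac (a g)"
  have supp_b: "supp ?b = supp a" by (simp add: supp_def)
  have a_sub: "finite (supp a)" "supp a \<subseteq> carrier G" using a(1) by (auto simp: killed_def)
  have b_sub: "supp ?b \<subseteq> carrier G" "?b \<noteq> (\<lambda>_. 0)"
    using a a_sub supp_b by (auto simp: fun_eq_iff)
  have "of_nat (Coset.order G) \<noteq> (0 :: 'k alg_closure)"
    using char by (simp add: of_nat_eq_0_iff_char_dvd)
  then obtain n and \<rho> :: "'g \<Rightarrow> 'k alg_closure mat" and i j where \<rho>: "irreducible_rep G n \<rho>"
    and ij: "i < n" "j < n" and ne: "(\<Sum>g\<in>carrier G. ?b g * \<rho> g $$ (i, j)) \<noteq> 0"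
    using irreducible_rep_detecting[OF _ b_sub] by blast
  have hom: "\<rho> \<in> hom G (GL TYPE('k alg_closure) n)" using \<rho> by (simp add: irreducible_rep_def)
  have "\<not> kernel G H l \<subseteq> kernel G (GL TYPE('k alg_closure) n) \<rho>" if l: "l \<in> spinal_B G \<X> \<Phi>" for l
  proof
    assume ker: "kernel G H l \<subseteq> kernel G (GL TYPE('k alg_closure) n) \<rho>"
    have lh: "l \<in> hom G H" by (rule spinal_B_hom[OF l])
    interpret H': group H by (rule group_H)
    have same: "\<rho> g = \<rho> g'" if g: "g \<in> carrier G" "g' \<in> carrier G" "l g = l g'" for g g'
    proof -
      have gi: "inv\<^bsub>G\<^esub> g' \<in> carrier G" using g by simp
      have "l (inv\<^bsub>G\<^esub> g' \<otimes>\<^bsub>G\<^esub> g) = l (inv\<^bsub>G\<^esub> g') \<otimes>\<^bsub>H\<^esub> l g'"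
        using g gi by (simp only: hom_GH(2)[OF lh])
      also have "\<dots> = l (inv\<^bsub>G\<^esub> g' \<otimes>\<^bsub>G\<^esub> g')" by (simp only: hom_GH(2)[OF lh gi g(2)])
      also have "\<dots> = \<one>\<^bsub>H\<^esub>" using g hom_GH(3)[OF lh] by simp
      finally have "inv\<^bsub>G\<^esub> g' \<otimes>\<^bsub>G\<^esub> g \<in> kernel G H l" using g by (simp add: kernel_def)
      then have k: "\<rho> (inv\<^bsub>G\<^esub> g' \<otimes>\<^bsub>G\<^esub> g) = 1\<^sub>m n" using ker by (auto simp: kernel_def GL_simps)
      have "g = g' \<otimes>\<^bsub>G\<^esub> (inv\<^bsub>G\<^esub> g' \<otimes>\<^bsub>G\<^esub> g)" using g by (simp add: G.m_assoc[symmetric])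
      then have "\<rho> g = \<rho> g' * \<rho> (inv\<^bsub>G\<^esub> g' \<otimes>\<^bsub>G\<^esub> g)"
        using hom_mult[OF hom g(2), of "inv\<^bsub>G\<^esub> g' \<otimes>\<^bsub>G\<^esub> g"] g by (simp add: GL_simps)
      moreover have "\<rho> g' \<in> carrier_mat n n" using hom g(2) GL_simps(1) by (auto simp: hom_def)
      ultimately show ?thesis using k by simp
    qed
    define \<phi> where "\<phi> h = \<rho> (inv_into (carrier G) l h) $$ (i, j)" for h
    have \<phi>: "\<rho> g $$ (i, j) = \<phi> (l g)" if "g \<in> carrier G" for g
      unfolding \<phi>_def using that same[of g "inv_into (carrier G) l (l g)"]
      by (simp add: inv_into_into f_inv_into_f)
    have "lin_ext l ?b h = to_ac (lin_ext l a h)" for h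
      by (simp add: lin_ext_def supp_b to_ac_sum)
    then have zero: "lin_ext l ?b = (\<lambda>_. 0)" using a(1) l by (simp add: killed_def fun_eq_iff)
    have "(\<Sum>g\<in>carrier G. ?b g * \<rho> g $$ (i, j)) = evaluate (\<lambda>g. \<rho> g $$ (i, j)) ?b"
      by (rule evaluate_eq_sum[OF finite_G b_sub(1), symmetric])
    also have "\<dots> = evaluate (\<lambda>g. \<phi> (l g)) ?b"
      using b_sub(1) \<phi> by (intro evaluate_cong) auto
    also have "\<dots> = evaluate \<phi> (lin_ext l ?b)"
      using a_sub supp_b by (intro evaluate_lin_ext[symmetric]) simp
    also have "\<dots> = 0" by (simp add: zero evaluate_def)
    finally show False using ne by simp
  qed
  then show ?thesis using \<rho> by blast
qed

lemma no_killed_iff_reps: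
  assumes char: "\<not> CHAR('k::field) dvd Coset.order G"
  shows "(\<forall>a :: 'g \<Rightarrow> 'k. killed a \<longrightarrow> a = (\<lambda>_. 0)) \<longleftrightarrow>
    (\<forall>n (\<rho> :: 'g \<Rightarrow> 'k alg_closure mat). irreducible_rep G n \<rho> \<longrightarrow>
      (\<exists>l \<in> spinal_B G \<X> \<Phi>. kernel G H l \<subseteq> kernel G (GL TYPE('k alg_closure) n) \<rho>))"
    (is "?none \<longleftrightarrow> ?reps")
proof
  assume none: ?none
  show ?reps
  proof (intro allI impI, rule ccontr)
    fix n and \<rho> :: "'g \<Rightarrow> 'k alg_closure mat"
    assume \<rho>: "irreducible_rep G n \<rho>"
      and no: "\<not> (\<exists>l \<in> spinal_B G \<X> \<Phi>. kernel G H l \<subseteq> kernel G (GL TYPE('k alg_closure) n) \<rho>)"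
    obtain a :: "'g \<Rightarrow> 'k" where a: "supp a \<subseteq> carrier G" "a \<noteq> (\<lambda>_. 0)"
      "\<And>l. l \<in> hom G H \<Longrightarrow> \<not> kernel G H l \<subseteq> kernel G (GL TYPE('k alg_closure) n) \<rho> \<Longrightarrow> lin_ext l a = (\<lambda>_. 0)"
      using coefficient_killed[OF G.is_group group_H finite_G \<rho>] by blast
    have "killed a"
      unfolding killed_def using a(1,3) no spinal_B_hom finite_subset[OF a(1) finite_G] by blast
    then show False using none a(2) by blast
  qed
next
  assume ?reps
  then show ?none using killed_detected_by_reps[OF char] by blast
qed

end

theorem theorem7p6:
  fixes G :: "('g, 'c) monoid_scheme" and H :: "('h, 'd) monoid_scheme"
    and \<X> :: "'x set" and act :: "'h \<Rightarrow> 'x \<Rightarrow> 'x"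
    and \<Phi> :: "'x \<Rightarrow> ('g \<Rightarrow> 'g) + ('g \<Rightarrow> 'h)"
  assumes "multispinal_data G H \<X> act \<Phi>"
  shows
    "(simple_ring (nekrashevych_algebra TYPE('k::field) (multispinal_group G H \<X> act \<Phi>) \<X> (\<lambda>g. g))
        \<longleftrightarrow> (\<Inter>l \<in> spinal_B G \<X> \<Phi>.
               a_kernel (monoid_algebra TYPE('k) G) (monoid_algebra TYPE('k) H) (lin_ext l))
             = {\<zero>\<^bsub>monoid_algebra TYPE('k) G\<^esub>})
     \<and> (\<not> CHAR('k) dvd Coset.order G \<longrightarrow>
        (simple_ring (nekrashevych_algebra TYPE('k) (multispinal_group G H \<X> act \<Phi>) \<X> (\<lambda>g. g))
          \<longleftrightarrow> (\<forall>n (\<rho> :: 'g \<Rightarrow> 'k alg_closure mat). irreducible_rep G n \<rho> \<longrightarrow>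
                (\<exists>l \<in> spinal_B G \<X> \<Phi>. kernel G H l \<subseteq> kernel G (GL TYPE('k alg_closure) n) \<rho>))))
     \<and> ((\<forall>l \<in> spinal_hom \<X> \<Phi>. CHAR('k) dvd card (kernel G H l)) \<longrightarrow>
        \<not> simple_ring (nekrashevych_algebra TYPE('k) (multispinal_group G H \<X> act \<Phi>) \<X> (\<lambda>g. g)))"
proof -
  interpret multispinal_data G H \<X> act \<Phi> by fact
  have "\<not> simple_ring (nekrashevych_algebra TYPE('k) \<GG> \<X> (\<lambda>g. g))"
    if "\<forall>l \<in> spinal_hom \<X> \<Phi>. CHAR('k) dvd card (kernel G H l)"
  proof -
    have "(\<lambda>g. if g \<in> carrier G then 1 else 0 :: 'k) \<noteq> (\<lambda>_. 0)"
      using G.one_closed by (metis zero_neq_one)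
    then show ?thesis using sum_of_group_killed[OF that] simple_iff_no_killed by blast
  qed
  then show ?thesis
    using simple_iff_no_killed[where ?'k = 'k] kernels_trivial_iff[where ?'k = 'k]
      no_killed_iff_reps[where ?'k = 'k] by simp
qed

end
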